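(* Let $\varepsilon\in(0,1)$ be a constant. Given a simplex graph $H$ with $n$ vertices and an isometric embedding $H\to Q_k$, where $k={\rm idim}(H)$, one can compute in $O(n^{2+1/\varepsilon})$ time an isometric embedding of $H$ into $\Gamma_{f'}$ for some $f'\le (1+\varepsilon)\,{\rm fdim}(H)$.
   Context: All graphs are finite. The $d$-cube $Q_d$ has vertex set $\{0,1\}^d$, two vertices adjacent iff they differ in exactly one coordinate. A Fibonacci string is a binary string with no two consecutive $1$s; the Fibonacci cube $\Gamma_d$ is the subgraph of $Q_d$ induced by the Fibonacci strings of length $d$. An isometric embedding is an injective map preserving shortest-path distances; computing an embedding means assigning to each vertex its binary tuple. ${\rm idim}(H)$ (resp. ${\rm fdim}(H)$) is the least $k$ such that $H$ isometrically embeds into $Q_k$ (resp. $\Gamma_k$). For a graph $G$, the simplex graph $\kappa(G)$ has a vertex $u_K$ for each clique $K$ of $G$ (including the empty set, single vertices and edges), with $u_K$ and $u_{K'}$ adjacent iff $K$ and $K'$ differ by exactly one vertex. A simplex graph is a graph of the form $\kappa(G)$ for some graph $G$. *)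

theory Defs
  imports "Graph_Theory.Graph_Theory" "HOL-Library.Landau_Symbols"
begin

section \<open>Cubes, isometric embeddings, simplex graphs\<close>

text \<open>
  Finite simple graphs are the instances of the locale \<open>pair_graph\<close>: finite, loop-free, and
  with a symmetric set of arcs.  Distances are the library's shortest-path distances with unit
  arc weights; they are extended reals, infinite between vertices in different components.
\<close>

definition gdist :: "('a, 'b) pre_digraph \<Rightarrow> 'a \<Rightarrow> 'a \<Rightarrow> ereal" where
  "gdist G u v = wf_digraph.\<mu> G (\<lambda>_. 1) u v"

definition isometric_embedding ::
    "('a, 'b) pre_digraph \<Rightarrow> ('c, 'd) pre_digraph \<Rightarrow> ('a \<Rightarrow> 'c) \<Rightarrow> bool" where
  "isometric_embedding G H f \<longleftrightarrow>
     inj_on f (verts G) \<and> f ` verts G \<subseteq> verts H \<and>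
     (\<forall>u\<in>verts G. \<forall>v\<in>verts G. gdist H (f u) (f v) = gdist G u v)"

definition cube :: "nat \<Rightarrow> bool list pair_pre_digraph" where
  "cube d = \<lparr> pverts = {x. length x = d},
              parcs = {(x, y). length x = d \<and> length y = d \<and>
                               card {i. i < d \<and> x ! i \<noteq> y ! i} = 1} \<rparr>"

definition fibonacci_string :: "bool list \<Rightarrow> bool" where
  "fibonacci_string x \<longleftrightarrow> successively (\<lambda>a b. \<not> (a \<and> b)) x"

definition fibonacci_cube :: "nat \<Rightarrow> (bool list, bool list \<times> bool list) pre_digraph" where
  "fibonacci_cube d = with_proj (cube d) \<restriction> {x. length x = d \<and> fibonacci_string x}"

text \<open>
  Both dimensions are only meaningful if some embedding exists, which is the case for
  simplex graphs.
\<close>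

definition idim :: "('a, 'b) pre_digraph \<Rightarrow> nat" where
  "idim H = (LEAST k. \<exists>f. isometric_embedding H (with_proj (cube k)) f)"

definition fdim :: "('a, 'b) pre_digraph \<Rightarrow> nat" where
  "fdim H = (LEAST k. \<exists>f. isometric_embedding H (fibonacci_cube k) f)"

definition clique :: "'a pair_pre_digraph \<Rightarrow> 'a set \<Rightarrow> bool" where
  "clique G K \<longleftrightarrow> K \<subseteq> pverts G \<and> (\<forall>u\<in>K. \<forall>v\<in>K. u \<noteq> v \<longrightarrow> (u, v) \<in> parcs G)"

definition kappa :: "'a pair_pre_digraph \<Rightarrow> 'a set pair_pre_digraph" where
  "kappa G = \<lparr> pverts = {K. clique G K},
               parcs = {(K, L). clique G K \<and> clique G L \<and> card ((K - L) \<union> (L - K)) = 1} \<rparr>"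

text \<open>
  Every finite graph is isomorphic to one on natural numbers, so quantifying over graphs
  with vertices of type \<^typ>\<open>nat\<close> is no restriction.
\<close>

definition is_simplex_graph :: "'a pair_pre_digraph \<Rightarrow> bool" where
  "is_simplex_graph H \<longleftrightarrow>
     (\<exists>G :: nat pair_pre_digraph. pair_graph G \<and> digraph_iso (with_proj (kappa G)) (with_proj H))"


section \<open>A word RAM\<close>

text \<open>
  Running times refer to a unit-cost word RAM, presented as a structured programming language.
  A machine has registers and an indirectly addressed memory.  Its words have \<open>w\<close> bits and
  arithmetic is modulo \<open>2 ^ w\<close>, so that no step can operate on large numbers.  Every
  arithmetic operation, register access, memory access, assignment and test costs one unit.
\<close>

datatype binop = Add | Sub | Mul | Div | Mod | Less | Equal

datatype exp = Const nat | Reg nat | Mem exp | Op binop exp exp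

datatype com =
    Skip
  | Assign nat exp
  | Store exp exp
  | Seq com com
  | Cond exp com com
  | While exp com

record state =
  regs :: "nat \<Rightarrow> nat"
  mem :: "nat \<Rightarrow> nat"

fun apply_op :: "nat \<Rightarrow> binop \<Rightarrow> nat \<Rightarrow> nat \<Rightarrow> nat" where
  "apply_op w Add x y = (x + y) mod 2 ^ w"
| "apply_op w Sub x y = nat ((int x - int y) mod 2 ^ w)"
| "apply_op w Mul x y = (x * y) mod 2 ^ w"
| "apply_op w Div x y = (x div y) mod 2 ^ w"
| "apply_op w Mod x y = (x mod y) mod 2 ^ w"
| "apply_op w Less x y = of_bool (x < y) mod 2 ^ w"
| "apply_op w Equal x y = of_bool (x = y) mod 2 ^ w"

fun eval_exp :: "nat \<Rightarrow> exp \<Rightarrow> state \<Rightarrow> nat" where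
  "eval_exp w (Const c) s = c mod 2 ^ w"
| "eval_exp w (Reg r) s = regs s r mod 2 ^ w"
| "eval_exp w (Mem e) s = mem s (eval_exp w e s) mod 2 ^ w"
| "eval_exp w (Op f e1 e2) s = apply_op w f (eval_exp w e1 s) (eval_exp w e2 s)"

fun exp_cost :: "exp \<Rightarrow> nat" where
  "exp_cost (Const c) = 1"
| "exp_cost (Reg r) = 1"
| "exp_cost (Mem e) = 1 + exp_cost e"
| "exp_cost (Op f e1 e2) = 1 + exp_cost e1 + exp_cost e2"

text \<open>
  \<open>exec w c s t s'\<close>: with word size \<open>w\<close>, program \<open>c\<close> started in \<open>s\<close> halts in \<open>s'\<close> after
  \<open>t\<close> steps.  In tests, nonzero means true.
\<close>

inductive exec :: "nat \<Rightarrow> com \<Rightarrow> state \<Rightarrow> nat \<Rightarrow> state \<Rightarrow> bool" for w :: nat where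
  Skip: "exec w Skip s 1 s"
| Assign: "exec w (Assign r e) s (1 + exp_cost e) (s\<lparr>regs := (regs s)(r := eval_exp w e s)\<rparr>)"
| Store: "exec w (Store a e) s (1 + exp_cost a + exp_cost e)
            (s\<lparr>mem := (mem s)(eval_exp w a s := eval_exp w e s)\<rparr>)"
| Seq: "exec w c1 s t1 s' \<Longrightarrow> exec w c2 s' t2 s'' \<Longrightarrow> exec w (Seq c1 c2) s (t1 + t2) s''"
| CondTrue: "eval_exp w e s \<noteq> 0 \<Longrightarrow> exec w c1 s t s' \<Longrightarrow>
               exec w (Cond e c1 c2) s (1 + exp_cost e + t) s'"
| CondFalse: "eval_exp w e s = 0 \<Longrightarrow> exec w c2 s t s' \<Longrightarrow>
               exec w (Cond e c1 c2) s (1 + exp_cost e + t) s'"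
| WhileFalse: "eval_exp w e s = 0 \<Longrightarrow> exec w (While e c) s (1 + exp_cost e) s"
| WhileTrue: "eval_exp w e s \<noteq> 0 \<Longrightarrow> exec w c s t1 s' \<Longrightarrow> exec w (While e c) s' t2 s'' \<Longrightarrow>
               exec w (While e c) s (1 + exp_cost e + t1 + t2) s''"

inductive_cases SkipE: "exec w Skip s t s'"
inductive_cases AssignE: "exec w (Assign r e) s t s'"
inductive_cases StoreE: "exec w (Store a e) s t s'"
inductive_cases SeqE: "exec w (Seq c1 c2) s t s'"
inductive_cases CondE: "exec w (Cond e c1 c2) s t s'"
inductive_cases WhileE: "exec w (While e c) s t s'"

lemma exec_deterministic:
  "exec w c s t s' \<Longrightarrow> exec w c s u s'' \<Longrightarrow> t = u \<and> s' = s''"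
proof (induction arbitrary: u s'' rule: exec.induct)
  case (Skip s)
  then show ?case by (elim SkipE) simp
next
  case (Assign r e s)
  then show ?case by (elim AssignE) simp
next
  case (Store a e s)
  then show ?case by (elim StoreE) simp
next
  case (Seq c1 s t1 s1 c2 t2 s2)
  show ?case by (rule SeqE[OF Seq.prems]) (auto dest!: Seq.IH)
next
  case (CondTrue e s c1 t s1 c2)
  show ?case by (rule CondE[OF CondTrue.prems]) (insert CondTrue.hyps(1), auto dest!: CondTrue.IH)
next
  case (CondFalse e s c2 t s1 c1)
  show ?case by (rule CondE[OF CondFalse.prems]) (insert CondFalse.hyps(1), auto dest!: CondFalse.IH)
next
  case (WhileFalse e s c)
  show ?case by (rule WhileE[OF WhileFalse.prems]) (insert WhileFalse.hyps(1), auto)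
next
  case (WhileTrue e s c t1 s1 t2 s2)
  show ?case by (rule WhileE[OF WhileTrue.prems]) (insert WhileTrue.hyps(1), auto dest!: WhileTrue.IH)
qed

text \<open>
  An instance consists of a graph \<open>H\<close> with vertices \<open>0, \<dots>, n - 1\<close> and a map \<open>\<phi>\<close> from its
  vertices to binary \<open>k\<close>-tuples.  Initially, registers 0 and 1 hold \<open>n\<close> and \<open>k\<close>, and the memory
  holds the adjacency matrix of \<open>H\<close> followed by the \<open>n \<times> k\<close> table of \<open>\<phi>\<close>, both row by row.
  Everything else is zero.
\<close>

definition input_state :: "nat \<Rightarrow> nat pair_pre_digraph \<Rightarrow> nat \<Rightarrow> (nat \<Rightarrow> bool list) \<Rightarrow> state" where
  "input_state n H k \<phi> =
     \<lparr> regs = (\<lambda>_. 0)(0 := n, 1 := k),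
       mem = (\<lambda>a. if a < n * n then of_bool ((a div n, a mod n) \<in> parcs H)
                   else if a < n * n + n * k
                     then of_bool (\<phi> ((a - n * n) div k) ! ((a - n * n) mod k))
                   else 0) \<rparr>"

text \<open>
  On halting, register 0 holds the dimension \<open>d\<close> of the computed tuples and register 1 the
  address of the \<open>n \<times> d\<close> table of the computed map \<open>\<psi>\<close>, again row by row.
\<close>

definition is_output :: "nat \<Rightarrow> nat \<Rightarrow> (nat \<Rightarrow> bool list) \<Rightarrow> state \<Rightarrow> bool" where
  "is_output n d \<psi> s \<longleftrightarrow>
     regs s 0 = d \<and>
     (\<forall>i<n. \<forall>j<d. mem s (regs s 1 + i * d + j) = of_bool (\<psi> i ! j))"

end

theory Submission
  imports Defs "HOL-Library.Nat_Bijection"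
begin

text \<open>
  In an isometric embedding of \<open>\<kappa>(G)\<close> into a Fibonacci cube every vertex of \<open>G\<close> owns one coordinate,
  and the coordinates of two adjacent vertices are not consecutive, because the four cliques on
  these two vertices show all four bit patterns.  Hence \<open>fdim(\<kappa>(G))\<close> is \<open>k\<close> plus the least number of
  adjacent consecutive pairs in an order of the \<open>k\<close> vertices: one zero coordinate separates
  each such pair.

  Let \<open>q = \<lceil>1/\<epsilon>\<rceil>\<close>.  A greedy order appends a non-neighbour of the last vertex as long as there is one.
  The vertices at which it gets stuck, together with its last vertex, form a clique, so if it has \<open>s\<close>
  adjacent consecutive pairs then \<open>2 ^ (s + 1) \<le> n\<close>.  If \<open>q * s \<le> k\<close>, then \<open>k + s \<le> (1 + \<epsilon>) * k\<close> is good
  enough.  Otherwise \<open>2 ^ k \<le> n ^ q\<close> and \<open>k\<^sup>2 \<le> q\<^sup>2 * n\<close>, and the Held-Karp recursion over subsets finds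
  an optimal order in time \<open>O(2 ^ k * k\<^sup>2)\<close>, which is \<open>O(n ^ (q + 1))\<close>.
\<close>


section \<open>Distances in graphs of sets\<close>

text \<open>The input does not tell which vertex of \<open>H\<close> is the empty clique, nor which
  vertex of \<open>G\<close> owns which coordinate, and complementing a coordinate of
  \<open>\<phi>\<close> gives another valid input. Hence only the sets of coordinates in which two
  strings differ are used. Seen from a base vertex of degree \<open>k\<close>, these sets are the
  cliques of a graph on the coordinates, in which two coordinates are adjacent if they occur in a
  common set. The minimality of \<open>k\<close> enters here: it makes the coordinates as many as
  the vertices of \<open>G\<close>.

  A clique of \<open>s + 1\<close> vertices has \<open>2 ^ (s + 1)\<close> subsets, all of them
  vertices of \<open>H\<close>; so a poor greedy order forces \<open>n\<close> to be large. With
  \<open>k < q * s\<close> and \<open>s * s \<le> 2 ^ (s + 1)\<close> this yields both bounds on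
  \<open>k\<close>. In the exponent \<open>2 + 1 / \<epsilon>\<close>, one unit pays for rounding
  \<open>1 / \<epsilon>\<close> up to \<open>q\<close>, the other for the factor
  \<open>k * k\<close> of the recursion.

  Arithmetic is modulo \<open>2 ^ w\<close>, so every address and value must also be shown not to
  overflow. The memory in use is polynomial in \<open>n\<close>, with an exponent depending on
  \<open>q\<close> only, which fixes the constant \<open>c\<close>.\<close>

lemma gdist_eqI:
  assumes wf: "wf_digraph G" and v: "v \<in> verts G"
    and zero: "f v = (0::nat)"
    and lip: "\<And>e. e \<in> arcs G \<Longrightarrow> f (tail G e) \<le> Suc (f (head G e))"
    and step: "\<And>u. u \<in> verts G \<Longrightarrow> u \<noteq> v \<Longrightarrow> \<exists>e\<in>arcs G. tail G e = u \<and> Suc (f (head G e)) = f u"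
    and u: "u \<in> verts G"
  shows "gdist G u v = ereal (real (f u))"
proof -
  interpret wf_digraph G by fact
  \<comment> \<open>\<open>f\<close> acts as a potential: an arc lowers it by at most one, which
    bounds walks from below, and \<open>step\<close> provides walks that lower it with every
    arc.\<close>
  have lower: "f u \<le> length p" if "awalk u p v" for u p
    using that
  proof (induction p arbitrary: u)
    case Nil
    then show ?case by (simp add: awalk_Nil_iff zero)
  next
    case (Cons e p)
    then have "e \<in> arcs G" "u = tail G e" "awalk (head G e) p v" by (auto simp: awalk_Cons_iff)
    then show ?case using lip[of e] Cons.IH[of "head G e"] by simp
  qed
  have upper: "\<exists>p. awalk u p v \<and> length p = m" if "u \<in> verts G" "f u = m" for u m
    using that
  proof (induction m arbitrary: u)
    case 0
    then have "u = v" using step by fastforce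
    then show ?case using v by (auto simp: awalk_Nil_iff intro!: exI[of _ "[]"])
  next
    case (Suc m)
    then have "u \<noteq> v" using zero by auto
    then obtain e where e: "e \<in> arcs G" "tail G e = u" "Suc (f (head G e)) = f u"
      using step Suc.prems by blast
    then obtain p where "awalk (head G e) p v" "length p = m"
      using Suc.IH[of "head G e"] Suc.prems by auto
    then show ?case using e by (auto simp: awalk_Cons_iff intro!: exI[of _ "e # p"])
  qed
  have cost: "awalk_cost (\<lambda>_. 1) p = real (length p)" for p :: "'b list"
    by (induction p) (auto simp: awalk_cost_def)
  obtain p where p: "awalk u p v" "length p = f u" using upper[OF u] by blast
  show ?thesis
    unfolding gdist_def \<mu>_def cost
    by (rule antisym) (use lower p in \<open>auto intro!: INF_lower2[of p] INF_greatest\<close>)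
qed

lemma card_sym_diff_toggle:
  assumes "finite A" "finite B" "a \<in> sym_diff A B"
  shows "Suc (card (sym_diff (sym_diff A {a}) B)) = card (sym_diff A B)"
proof -
  have "sym_diff (sym_diff A {a}) B = sym_diff A B - {a}" using assms(3) by auto
  moreover have "finite (sym_diff A B)" using assms(1,2) by simp
  ultimately show ?thesis using card_Suc_Diff1[OF _ assms(3)] by argo
qed

lemma card_sym_diff_triangle:
  assumes "finite A" "finite B" "finite C"
  shows "card (sym_diff A C) \<le> card (sym_diff A B) + card (sym_diff B C)"
proof -
  have "card (sym_diff A C) \<le> card (sym_diff A B \<union> sym_diff B C)"
    using assms by (intro card_mono) auto
  then show ?thesis using card_Un_le order_trans by blast
qed

text \<open>Because the family of sets is closed under subsets, one can first delete the surplus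
  elements of \<open>S u\<close> one by one, staying among its subsets, and then insert the missing
  ones, staying among the subsets of \<open>S v\<close>. This covers cubes, Fibonacci cubes and
  simplex graphs at once.\<close>

lemma gdist_downset:
  assumes wf: "wf_digraph G"
    and fin: "\<And>u. u \<in> verts G \<Longrightarrow> finite (S u)"
    and inj: "inj_on S (verts G)"
    and adj: "\<And>u v. u \<in> verts G \<Longrightarrow> v \<in> verts G \<Longrightarrow>
                (\<exists>e\<in>arcs G. tail G e = u \<and> head G e = v) \<longleftrightarrow> card (sym_diff (S u) (S v)) = 1"
    and down: "\<And>u X. u \<in> verts G \<Longrightarrow> X \<subseteq> S u \<Longrightarrow> \<exists>v\<in>verts G. S v = X"
    and u: "u \<in> verts G" and v: "v \<in> verts G"
  shows "gdist G u v = ereal (real (card (sym_diff (S u) (S v))))"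
proof (rule gdist_eqI[OF wf v _ _ _ u, where f = "\<lambda>u. card (sym_diff (S u) (S v))"])
  interpret wf_digraph G by fact
  fix e assume e: "e \<in> arcs G"
  have "card (sym_diff (S (tail G e)) (S (head G e))) = 1"
    by (rule iffD1[OF adj[OF wellformed[OF e]]]) (use e in blast)
  then show "card (sym_diff (S (tail G e)) (S v)) \<le> Suc (card (sym_diff (S (head G e)) (S v)))"
    using card_sym_diff_triangle[of "S (tail G e)" "S (head G e)" "S v"] fin e v by simp
next
  fix u assume u: "u \<in> verts G" "u \<noteq> v"
  have ne: "S u \<noteq> S v" using inj u v by (auto dest: inj_onD)
  have "\<exists>a\<in>sym_diff (S u) (S v). \<exists>w\<in>verts G. S w = sym_diff (S u) {a}"
  proof (cases "S u \<subseteq> S v")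
    case True
    then obtain a where a: "a \<in> S v - S u" using ne by auto
    then have "sym_diff (S u) {a} \<subseteq> S v" using True by auto
    then obtain w where "w \<in> verts G" "S w = sym_diff (S u) {a}" using down[OF v] by metis
    then show ?thesis using a by (intro bexI[of _ a] bexI[of _ w]) auto
  next
    case False
    then obtain a where a: "a \<in> S u - S v" by auto
    then have "sym_diff (S u) {a} \<subseteq> S u" by auto
    then obtain w where "w \<in> verts G" "S w = sym_diff (S u) {a}" using down[OF u(1)] by metis
    then show ?thesis using a by (intro bexI[of _ a] bexI[of _ w]) auto
  qed
  then obtain a w where a: "a \<in> sym_diff (S u) (S v)" "w \<in> verts G" "S w = sym_diff (S u) {a}"
    by blast
  then have "sym_diff (S u) (S w) = {a}" by auto
  then obtain e where "e \<in> arcs G" "tail G e = u" "head G e = w"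
    using adj[OF u(1) a(2)] by auto
  moreover have "Suc (card (sym_diff (S w) (S v))) = card (sym_diff (S u) (S v))"
    unfolding a(3) by (rule card_sym_diff_toggle) (use fin u v a in auto)
  ultimately show "\<exists>e\<in>arcs G. tail G e = u \<and> Suc (card (sym_diff (S (head G e)) (S v))) = card (sym_diff (S u) (S v))"
    by blast
qed auto

section \<open>Bit strings as sets of positions; distances in cubes and Fibonacci cubes\<close>

definition ones :: "bool list \<Rightarrow> nat set" where
  "ones x = {i. i < length x \<and> x ! i}"

lemma finite_ones [simp]: "finite (ones x)"
  by (simp add: ones_def)

lemma ones_eq_iff: "length x = length y \<Longrightarrow> ones x = ones y \<longleftrightarrow> x = y"
  by (auto simp: ones_def list_eq_iff_nth_eq)

lemma sym_diff_ones:
  "length x = d \<Longrightarrow> length y = d \<Longrightarrow> sym_diff (ones x) (ones y) = {i. i < d \<and> x ! i \<noteq> y ! i}"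
  by (auto simp: ones_def)

definition string_of :: "nat \<Rightarrow> nat set \<Rightarrow> bool list" where
  "string_of d X = map (\<lambda>i. i \<in> X) [0..<d]"

lemma length_string_of [simp]: "length (string_of d X) = d"
  by (simp add: string_of_def)

lemma nth_string_of [simp]: "i < d \<Longrightarrow> string_of d X ! i \<longleftrightarrow> i \<in> X"
  by (simp add: string_of_def)

lemma ones_string_of [simp]: "X \<subseteq> {..<d} \<Longrightarrow> ones (string_of d X) = X"
  by (auto simp: ones_def)

lemma fibonacci_string_iff:
  "fibonacci_string x \<longleftrightarrow> (\<forall>i. Suc i < length x \<longrightarrow> \<not> (x ! i \<and> x ! Suc i))"
  by (auto simp: fibonacci_string_def successively_conv_nth)

lemma gdist_cube:
  assumes "length x = d" "length y = d"
  shows "gdist (with_proj (cube d)) x y = ereal (real (card {i. i < d \<and> x ! i \<noteq> y ! i}))"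
proof -
  have "gdist (with_proj (cube d)) x y = ereal (real (card (sym_diff (ones x) (ones y))))"
  proof (rule gdist_downset)
    show "wf_digraph (with_proj (cube d))"
      by unfold_locales (auto simp: cube_def)
    show "inj_on ones (verts (with_proj (cube d)))"
      by (auto simp: inj_on_def cube_def ones_eq_iff)
    show "\<exists>v\<in>verts (with_proj (cube d)). ones v = X"
      if "u \<in> verts (with_proj (cube d))" "X \<subseteq> ones u" for u X
      using that by (intro bexI[of _ "string_of d X"]) (auto simp: cube_def ones_def)
    show "(\<exists>e\<in>arcs (with_proj (cube d)). tail (with_proj (cube d)) e = u \<and> head (with_proj (cube d)) e = v)
            \<longleftrightarrow> card (sym_diff (ones u) (ones v)) = 1"
      if "u \<in> verts (with_proj (cube d))" "v \<in> verts (with_proj (cube d))" for u v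
      using that sym_diff_ones[of u d v] by (auto simp: cube_def)
  qed (use assms in \<open>auto simp: cube_def\<close>)
  then show ?thesis by (simp add: sym_diff_ones[OF assms])
qed

lemma verts_fibonacci_cube:
  "verts (fibonacci_cube d) = {x. length x = d \<and> fibonacci_string x}"
  by (auto simp: fibonacci_cube_def induce_subgraph_def cube_def)

lemma gdist_fibonacci_cube:
  assumes "x \<in> verts (fibonacci_cube d)" "y \<in> verts (fibonacci_cube d)"
  shows "gdist (fibonacci_cube d) x y = ereal (real (card {i. i < d \<and> x ! i \<noteq> y ! i}))"
proof -
  have "gdist (fibonacci_cube d) x y = ereal (real (card (sym_diff (ones x) (ones y))))"
  proof (rule gdist_downset)
    show "wf_digraph (fibonacci_cube d)"
      by unfold_locales (auto simp: fibonacci_cube_def cube_def induce_subgraph_def)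
    show "inj_on ones (verts (fibonacci_cube d))"
      by (auto simp: inj_on_def verts_fibonacci_cube ones_eq_iff)
    show "\<exists>v\<in>verts (fibonacci_cube d). ones v = X"
      if "u \<in> verts (fibonacci_cube d)" "X \<subseteq> ones u" for u X
    proof (intro bexI[of _ "string_of d X"])
      have "X \<subseteq> {..<d}" using that by (auto simp: verts_fibonacci_cube ones_def)
      then show "ones (string_of d X) = X" by simp
      show "string_of d X \<in> verts (fibonacci_cube d)"
        using that by (auto simp: verts_fibonacci_cube fibonacci_string_iff ones_def)
    qed
    show "(\<exists>e\<in>arcs (fibonacci_cube d). tail (fibonacci_cube d) e = u \<and> head (fibonacci_cube d) e = v)
            \<longleftrightarrow> card (sym_diff (ones u) (ones v)) = 1"
      if "u \<in> verts (fibonacci_cube d)" "v \<in> verts (fibonacci_cube d)" for u v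
      using that sym_diff_ones[of u d v]
      by (auto simp: fibonacci_cube_def cube_def induce_subgraph_def)
  qed (use assms in auto)
  then show ?thesis using assms by (simp add: sym_diff_ones[of _ d] verts_fibonacci_cube)
qed

section \<open>Simplex graphs as families of cliques\<close>

lemma simplex_graph_cliques:
  assumes "is_simplex_graph H"
  obtains G :: "nat pair_pre_digraph" and S where
    "pair_graph G" "pair_wf_digraph H" "bij_betw S (pverts H) {K. clique G K}"
    "\<And>u v. u \<in> pverts H \<Longrightarrow> v \<in> pverts H \<Longrightarrow> (u, v) \<in> parcs H \<longleftrightarrow> card (sym_diff (S u) (S v)) = 1"
proof -
  obtain G :: "nat pair_pre_digraph" and f where G: "pair_graph G"
    and f: "pre_digraph.digraph_isomorphism (with_proj (kappa G)) f"
    and H: "with_proj H = app_iso f (with_proj (kappa G))"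
    using assms unfolding is_simplex_graph_def digraph_iso_def by blast
  interpret K: wf_digraph "with_proj (kappa G)"
    using f by (simp add: pre_digraph.digraph_isomorphism_def)
  have wfH: "wf_digraph (with_proj H)" unfolding H by (rule K.wf_digraphI_app_iso[OF f])
  have vH: "pverts H = iso_verts f ` {K. clique G K}"
    using arg_cong[OF H, of verts] by (simp add: kappa_def)
  have inj: "inj_on (iso_verts f) {K. clique G K}"
    using f by (simp add: pre_digraph.digraph_isomorphism_def kappa_def)
  have aH: "parcs H = (\<lambda>(K, L). (iso_verts f K, iso_verts f L)) ` parcs (kappa G)"
    using K.arcs_ends_app_iso_eq[OF f] unfolding H[symmetric] by simp
  define S where "S = the_inv_into {K. clique G K} (iso_verts f)"
  have Sf: "S (iso_verts f K) = K" if "clique G K" for K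
    unfolding S_def using that inj by (simp add: the_inv_into_f_f)
  have bij: "bij_betw S (pverts H) {K. clique G K}"
    unfolding vH S_def using inj by (intro bij_betw_the_inv_into) (simp add: bij_betw_def)
  have "(u, v) \<in> parcs H \<longleftrightarrow> card (sym_diff (S u) (S v)) = 1" if uv: "u \<in> pverts H" "v \<in> pverts H" for u v
  proof -
    obtain K L where KL: "clique G K" "u = iso_verts f K" "clique G L" "v = iso_verts f L"
      using uv by (auto simp: vH)
    have "(u, v) \<in> parcs H \<longleftrightarrow> (K, L) \<in> parcs (kappa G)"
      using KL inj by (auto simp: aH kappa_def dest: inj_onD)
    then show ?thesis using KL Sf by (simp add: kappa_def)
  qed
  with that G bij wfH show ?thesis by (simp add: wf_digraph_wp_iff)
qed


section \<open>Coordinates of a simplex graph\<close>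

text \<open>Only differences between strings are meaningful: complementing a coordinate for all
  vertices keeps an embedding isometric.\<close>

definition flips :: "('v \<Rightarrow> bool list) \<Rightarrow> nat \<Rightarrow> 'v \<Rightarrow> 'v \<Rightarrow> nat set" where
  "flips \<phi> k u v = {i. i < k \<and> \<phi> u ! i \<noteq> \<phi> v ! i}"

lemma flips_subset: "flips \<phi> k u v \<subseteq> {..<k}"
  by (auto simp: flips_def)

lemma finite_flips [simp]: "finite (flips \<phi> k u v)"
  by (simp add: flips_def)

lemma flips_via: "flips \<phi> k u v = sym_diff (flips \<phi> k z u) (flips \<phi> k z v)"
  by (auto simp: flips_def)

text \<open>Expresses membership by cardinalities, which isometric embeddings preserve; thus the
  clique behind a vertex can be recovered from distances.\<close>

lemma card_sym_diff_singleton_mem: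
  assumes "finite A"
  shows "a \<in> A \<longleftrightarrow> card (sym_diff {a} A) < card A"
proof (cases "a \<in> A")
  case True
  then have "sym_diff {a} A = A - {a}" by auto
  then show ?thesis using True assms card_Diff1_less[of A a] by simp
next
  case False
  then have "sym_diff {a} A = insert a A" by auto
  then show ?thesis using False assms by simp
qed

lemma image_sym_diff:
  assumes "inj_on f V" "A \<subseteq> V" "B \<subseteq> V"
  shows "f ` sym_diff A B = sym_diff (f ` A) (f ` B)"
  using inj_on_image_set_diff[OF assms(1), of A B] inj_on_image_set_diff[OF assms(1), of B A] assms(2,3)
  by (simp add: image_Un Diff_subset subset_trans[OF Diff_subset])

text \<open>Up to complementing and renaming coordinates, \<open>\<phi>\<close> sends a clique to
  its characteristic vector. Characteristic vectors embed \<open>H\<close> into the cube of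
  dimension \<open>card (pverts G)\<close>, so \<open>k\<close> is at most this number. Conversely,
  each single vertex of \<open>G\<close> differs from the empty clique in one coordinate, and these
  coordinates are distinct, so they are all \<open>k\<close> of them. Distances to the singletons
  then determine the rest.\<close>

lemma simplex_graph_flips:
  fixes \<phi> :: "'v \<Rightarrow> bool list"
  assumes H: "is_simplex_graph H" and k: "k = idim (with_proj H)"
    and iso: "isometric_embedding (with_proj H) (with_proj (cube k)) \<phi>"
  obtains G :: "nat pair_pre_digraph" and S \<sigma> z0 where
    "pair_graph G" "pair_wf_digraph H"
    "bij_betw S (pverts H) {K. clique G K}" "bij_betw \<sigma> (pverts G) {..<k}"
    "z0 \<in> pverts H" "S z0 = {}"
    "\<And>u v. u \<in> pverts H \<Longrightarrow> v \<in> pverts H \<Longrightarrow> (u, v) \<in> parcs H \<longleftrightarrow> card (sym_diff (S u) (S v)) = 1"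
    "\<And>u v. u \<in> pverts H \<Longrightarrow> v \<in> pverts H \<Longrightarrow> gdist (with_proj H) u v = ereal (real (card (flips \<phi> k u v)))"
    "\<And>u v. u \<in> pverts H \<Longrightarrow> v \<in> pverts H \<Longrightarrow> flips \<phi> k u v = \<sigma> ` sym_diff (S u) (S v)"
proof -
  obtain G :: "nat pair_pre_digraph" and S where G: "pair_graph G" and wf: "pair_wf_digraph H"
    and S: "bij_betw S (pverts H) {K. clique G K}"
    and adj: "\<And>u v. u \<in> pverts H \<Longrightarrow> v \<in> pverts H \<Longrightarrow> (u, v) \<in> parcs H \<longleftrightarrow> card (sym_diff (S u) (S v)) = 1"
    using simplex_graph_cliques[OF H] by metis
  interpret G: pair_graph G by fact
  define V where "V = pverts G"
  have finV: "finite V" by (simp add: V_def)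
  have SV: "S u \<subseteq> V" "clique G (S u)" if "u \<in> pverts H" for u
    using bij_betwE[OF S] that by (auto simp: clique_def V_def)
  have finS: "finite (S u)" if "u \<in> pverts H" for u using SV[OF that] finV finite_subset by blast
  have onto: "\<exists>u\<in>pverts H. S u = K" if "clique G K" for K
    using S that by (auto simp: bij_betw_def image_iff set_eq_iff) metis
  have injS: "inj_on S (pverts H)" using S by (simp add: bij_betw_def)
  have dist_S: "gdist (with_proj H) u v = ereal (real (card (sym_diff (S u) (S v))))"
    if "u \<in> pverts H" "v \<in> pverts H" for u v
  proof (rule gdist_downset)
    show "wf_digraph (with_proj H)" using wf by (simp add: wf_digraph_wp_iff)
    show "\<exists>v\<in>verts (with_proj H). S v = X" if "u \<in> verts (with_proj H)" "X \<subseteq> S u" for u X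
    proof -
      have "clique G X" using SV(2)[of u] that unfolding clique_def by (simp add: subset_iff)
      then show ?thesis using onto by simp
    qed
    show "(\<exists>e\<in>arcs (with_proj H). tail (with_proj H) e = u \<and> head (with_proj H) e = v)
            \<longleftrightarrow> card (sym_diff (S u) (S v)) = 1"
      if "u \<in> verts (with_proj H)" "v \<in> verts (with_proj H)" for u v
      using adj[of u v] that by force
  qed (use that finS injS in auto)
  have k_le: "k \<le> card V"
  proof -
    obtain \<beta> where \<beta>: "bij_betw \<beta> V {..<card V}" using ex_bij_betw_finite_nat[OF finV]
      by (auto simp: atLeast0LessThan)
    define f where "f u = string_of (card V) (\<beta> ` S u)" for u
    have diff: "{i. i < card V \<and> f u ! i \<noteq> f v ! i} = \<beta> ` sym_diff (S u) (S v)"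
      if uv: "u \<in> pverts H" "v \<in> pverts H" for u v
    proof -
      have "\<beta> ` sym_diff (S u) (S v) = sym_diff (\<beta> ` S u) (\<beta> ` S v)"
        by (rule image_sym_diff[of _ V]) (use \<beta> SV[OF uv(1)] SV[OF uv(2)] in \<open>auto simp: bij_betw_def\<close>)
      moreover have "\<beta> ` S u \<subseteq> {..<card V}" "\<beta> ` S v \<subseteq> {..<card V}"
        using \<beta> SV[OF uv(1)] SV[OF uv(2)] by (auto simp: bij_betw_def)
      ultimately show ?thesis
        using sym_diff_ones[of "f u" "card V" "f v"] by (simp add: f_def)
    qed
    have card_diff: "card {i. i < card V \<and> f u ! i \<noteq> f v ! i} = card (sym_diff (S u) (S v))"
      if uv: "u \<in> pverts H" "v \<in> pverts H" for u v
      unfolding diff[OF uv]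
    proof (rule card_image)
      have "sym_diff (S u) (S v) \<subseteq> V" using SV[OF uv(1)] SV[OF uv(2)] by blast
      then show "inj_on \<beta> (sym_diff (S u) (S v))"
        using \<beta> inj_on_subset by (auto simp only: bij_betw_def)
    qed
    have "isometric_embedding (with_proj H) (with_proj (cube (card V))) f"
      unfolding isometric_embedding_def
    proof (intro conjI ballI)
      show "inj_on f (verts (with_proj H))"
      proof (rule inj_onI)
        fix u v assume uv: "u \<in> verts (with_proj H)" "v \<in> verts (with_proj H)" "f u = f v"
        then have "card (sym_diff (S u) (S v)) = 0" using card_diff[of u v] by simp
        then have "S u = S v" using uv finS[of u] finS[of v] by auto
        then show "u = v" using injS uv by (auto dest: inj_onD)
      qed
    next
      fix u v assume uv: "u \<in> verts (with_proj H)" "v \<in> verts (with_proj H)"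
      show "gdist (with_proj (cube (card V))) (f u) (f v) = gdist (with_proj H) u v"
        using uv card_diff[of u v] by (simp add: gdist_cube dist_S f_def)
    qed (auto simp: cube_def f_def)
    then show ?thesis unfolding k idim_def by (intro Least_le) blast
  qed
  have len: "length (\<phi> u) = k" if "u \<in> pverts H" for u
    using iso that by (auto simp: isometric_embedding_def cube_def)
  have dist_flips: "gdist (with_proj H) u v = ereal (real (card (flips \<phi> k u v)))"
    if "u \<in> pverts H" "v \<in> pverts H" for u v
    using iso that gdist_cube[OF len len, of u v]
    by (auto simp: isometric_embedding_def flips_def)
  have card_flips: "card (flips \<phi> k u v) = card (sym_diff (S u) (S v))"
    if "u \<in> pverts H" "v \<in> pverts H" for u v
    using dist_flips[OF that] dist_S[OF that] by simp
  obtain z0 where z0: "z0 \<in> pverts H" "S z0 = {}"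
    using onto[of "{}"] by (auto simp: clique_def)
  have "\<exists>e. \<forall>v\<in>V. e v \<in> pverts H \<and> S (e v) = {v}"
    using onto[of "{_}"] by (intro bchoice) (auto simp: clique_def V_def)
  then obtain e where e: "\<And>v. v \<in> V \<Longrightarrow> e v \<in> pverts H" "\<And>v. v \<in> V \<Longrightarrow> S (e v) = {v}" by blast
  have "\<exists>i. flips \<phi> k z0 (e v) = {i}" if "v \<in> V" for v
    using card_flips[OF z0(1) e(1)[OF that]] e(2)[OF that] z0(2) by (simp add: card_1_singleton_iff)
  then obtain \<sigma> where \<sigma>: "\<And>v. v \<in> V \<Longrightarrow> flips \<phi> k z0 (e v) = {\<sigma> v}" by metis
  have inj\<sigma>: "inj_on \<sigma> V"
  proof (rule inj_onI)
    fix v w assume vw: "v \<in> V" "w \<in> V" "\<sigma> v = \<sigma> w"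
    have "card (sym_diff {v} {w}) = card (flips \<phi> k (e v) (e w))"
      using card_flips[OF e(1) e(1)] vw e(2) by simp
    also have "flips \<phi> k (e v) (e w) = {}"
      unfolding flips_via[of \<phi> k "e v" "e w" z0] using \<sigma> vw by simp
    finally have zero: "card (sym_diff {v} {w}) = 0" by (simp only: card.empty)
    show "v = w"
    proof (rule ccontr)
      assume "v \<noteq> w"
      then have "sym_diff {v} {w} = {v, w}" by auto
      then show False using zero \<open>v \<noteq> w\<close> by simp
    qed
  qed
  have sub\<sigma>: "\<sigma> ` V \<subseteq> {..<k}" using \<sigma> flips_subset[of \<phi> k z0] by fastforce
  then have "card V \<le> k" using card_mono[OF _ sub\<sigma>] card_image[OF inj\<sigma>] by simp
  then have "\<sigma> ` V = {..<k}"
    using card_subset_eq[OF _ sub\<sigma>] card_image[OF inj\<sigma>] k_le by simp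
  then have bij\<sigma>: "bij_betw \<sigma> V {..<k}" using inj\<sigma> by (simp add: bij_betw_def)
  have mem: "\<sigma> v \<in> flips \<phi> k z0 u \<longleftrightarrow> v \<in> S u" if uv: "u \<in> pverts H" "v \<in> V" for u v
  proof -
    have "card (sym_diff {\<sigma> v} (flips \<phi> k z0 u)) = card (sym_diff {v} (S u))"
      using card_flips[OF e(1)[OF uv(2)] uv(1)] flips_via[of \<phi> k "e v" u z0] \<sigma>[OF uv(2)] e(2)[OF uv(2)]
      by simp
    moreover have "card (flips \<phi> k z0 u) = card (S u)"
      using card_flips[OF z0(1) uv(1)] z0(2) by simp
    ultimately show ?thesis
      unfolding card_sym_diff_singleton_mem[OF finite_flips, of "\<sigma> v"]
        card_sym_diff_singleton_mem[OF finS[OF uv(1)], of v] by (simp only:)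
  qed
  have flips0: "flips \<phi> k z0 u = \<sigma> ` S u" if u: "u \<in> pverts H" for u
  proof
    show "\<sigma> ` S u \<subseteq> flips \<phi> k z0 u" using mem[OF u] SV[OF u] by auto
    show "flips \<phi> k z0 u \<subseteq> \<sigma> ` S u"
    proof
      fix i assume i: "i \<in> flips \<phi> k z0 u"
      then have "i \<in> \<sigma> ` V" using bij\<sigma> flips_subset[of \<phi> k z0 u] by (auto simp: bij_betw_def)
      then show "i \<in> \<sigma> ` S u" using mem[OF u] i by auto
    qed
  qed
  have flips_S: "flips \<phi> k u v = \<sigma> ` sym_diff (S u) (S v)" if uv: "u \<in> pverts H" "v \<in> pverts H" for u v
    unfolding flips_via[of \<phi> k u v z0] flips0[OF uv(1)] flips0[OF uv(2)]
    by (rule image_sym_diff[OF inj\<sigma>, symmetric]) (use SV[OF uv(1)] SV[OF uv(2)] in auto)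
  show ?thesis
    using that[OF G wf S _ z0 adj dist_flips flips_S] bij\<sigma> unfolding V_def by blast
qed

text \<open>
  A vertex of full degree is a universal clique.  Complementing along it is an automorphism of the
  simplex graph, so it can play the part of the empty clique.
\<close>

lemma simplex_graph_base:
  fixes \<phi> :: "'v \<Rightarrow> bool list"
  assumes H: "is_simplex_graph H" and k: "k = idim (with_proj H)"
    and iso: "isometric_embedding (with_proj H) (with_proj (cube k)) \<phi>"
  shows "\<exists>z\<in>pverts H. card {v. (z, v) \<in> parcs H} = k"
    and "z \<in> pverts H \<Longrightarrow> card {v. (z, v) \<in> parcs H} = k \<Longrightarrow> C \<subseteq> {..<k} \<Longrightarrow>
         (\<And>i j. i \<in> C \<Longrightarrow> j \<in> C \<Longrightarrow> i \<noteq> j \<Longrightarrow> \<exists>u\<in>pverts H. i \<in> flips \<phi> k z u \<and> j \<in> flips \<phi> k z u) \<Longrightarrow>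
         \<exists>u\<in>pverts H. flips \<phi> k z u = C"
    and "u \<in> pverts H \<Longrightarrow> v \<in> pverts H \<Longrightarrow>
         gdist (with_proj H) u v = ereal (real (card (flips \<phi> k u v)))"
proof -
  obtain G :: "nat pair_pre_digraph" and S \<sigma> z0 where G: "pair_graph G" and wf: "pair_wf_digraph H"
    and S: "bij_betw S (pverts H) {K. clique G K}" and \<sigma>: "bij_betw \<sigma> (pverts G) {..<k}"
    and z0: "z0 \<in> pverts H" "S z0 = {}"
    and adj: "\<And>u v. u \<in> pverts H \<Longrightarrow> v \<in> pverts H \<Longrightarrow> (u, v) \<in> parcs H \<longleftrightarrow> card (sym_diff (S u) (S v)) = 1"
    and dist: "\<And>u v. u \<in> pverts H \<Longrightarrow> v \<in> pverts H \<Longrightarrow> gdist (with_proj H) u v = ereal (real (card (flips \<phi> k u v)))"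
    and flips_S: "\<And>u v. u \<in> pverts H \<Longrightarrow> v \<in> pverts H \<Longrightarrow> flips \<phi> k u v = \<sigma> ` sym_diff (S u) (S v)"
    using simplex_graph_flips[OF assms] by metis
  interpret G: pair_graph G by fact
  interpret H: pair_wf_digraph H by fact
  have arcs_verts: "v \<in> pverts H" if "(u, v) \<in> parcs H" for u v using H.in_arcsD2[OF that] .
  have SV: "clique G (S u)" "S u \<subseteq> pverts G" if "u \<in> pverts H" for u
    using bij_betwE[OF S] that by (auto simp: clique_def)
  have onto: "\<exists>u\<in>pverts H. S u = K" if "clique G K" for K
    using S that by (auto simp: bij_betw_def image_iff set_eq_iff) metis
  have injS: "inj_on S (pverts H)" using S by (simp add: bij_betw_def)
  have card_V: "card (pverts G) = k" using bij_betw_same_card[OF \<sigma>] by simp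
  \<comment> \<open>The vertices of \<open>G\<close> whose insertion into or removal from the clique
    \<open>S z\<close> leaves a clique; they correspond to the neighbours of
    \<open>z\<close>.\<close>
  define N where "N z = {a \<in> pverts G. clique G (sym_diff (S z) {a})}" for z
  have nbrs: "S ` {v. (z, v) \<in> parcs H} = (\<lambda>a. sym_diff (S z) {a}) ` N z" if z: "z \<in> pverts H" for z
  proof
    show "S ` {v. (z, v) \<in> parcs H} \<subseteq> (\<lambda>a. sym_diff (S z) {a}) ` N z"
    proof clarify
      fix v assume v: "(z, v) \<in> parcs H"
      then obtain a where a: "sym_diff (S z) (S v) = {a}"
        using adj[OF z arcs_verts[OF v]] by (auto simp: card_1_singleton_iff)
      then have "S v = sym_diff (S z) {a}" by auto
      moreover have "a \<in> pverts G" using a SV(2)[OF z] SV(2)[OF arcs_verts[OF v]] by auto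
      ultimately show "S v \<in> (\<lambda>a. sym_diff (S z) {a}) ` N z"
        using SV(1)[OF arcs_verts[OF v]] unfolding N_def by (intro image_eqI[of _ _ a]) auto
    qed
    show "(\<lambda>a. sym_diff (S z) {a}) ` N z \<subseteq> S ` {v. (z, v) \<in> parcs H}"
    proof
      fix X assume "X \<in> (\<lambda>a. sym_diff (S z) {a}) ` N z"
      then obtain a where a: "clique G X" "X = sym_diff (S z) {a}" by (auto simp: N_def)
      then obtain v where v: "v \<in> pverts H" "S v = X" using onto by blast
      have "sym_diff (S z) (S v) = {a}" using v a by auto
      then have "(z, v) \<in> parcs H" using adj[OF z v(1)] by simp
      then show "X \<in> S ` {v. (z, v) \<in> parcs H}" using v by auto
    qed
  qed
  have deg: "card {v. (z, v) \<in> parcs H} = card (N z)" if z: "z \<in> pverts H" for z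
  proof -
    have "inj_on S {v. (z, v) \<in> parcs H}" using injS arcs_verts by (auto simp: inj_on_def)
    then have c1: "card (S ` {v. (z, v) \<in> parcs H}) = card {v. (z, v) \<in> parcs H}"
      by (rule card_image)
    have "inj_on (\<lambda>a. sym_diff (S z) {a}) (N z)" by (rule inj_onI) blast
    then have c2: "card ((\<lambda>a. sym_diff (S z) {a}) ` N z) = card (N z)" by (rule card_image)
    show ?thesis unfolding c1[symmetric] nbrs[OF z] c2 ..
  qed
  show "\<exists>z\<in>pverts H. card {v. (z, v) \<in> parcs H} = k"
    using z0 deg[OF z0(1)] card_V by (intro bexI[of _ z0]) (simp_all add: N_def clique_def)
  show "gdist (with_proj H) u v = ereal (real (card (flips \<phi> k u v)))"
    if "u \<in> pverts H" "v \<in> pverts H" using dist that .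
  assume z: "z \<in> pverts H" and dz: "card {v. (z, v) \<in> parcs H} = k" and C: "C \<subseteq> {..<k}"
    and pw: "\<And>i j. i \<in> C \<Longrightarrow> j \<in> C \<Longrightarrow> i \<noteq> j \<Longrightarrow> \<exists>u\<in>pverts H. i \<in> flips \<phi> k z u \<and> j \<in> flips \<phi> k z u"
  have "N z = pverts G"
    using deg[OF z] dz card_V by (intro card_subset_eq) (auto simp: N_def)
  then have univ: "clique G (sym_diff (S z) {a})" if "a \<in> pverts G" for a
    using that by (auto simp: N_def)
  have sym: "(b, a) \<in> parcs G" if "(a, b) \<in> parcs G" for a b using G.arcs_symmetric[OF that] .
  \<comment> \<open>Since every vertex outside \<open>S z\<close> may be added to it, the elements
    of \<open>S z\<close> are adjacent to all other vertices of \<open>G\<close>.\<close>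
  have KV: "(a, b) \<in> parcs G" if "a \<in> S z" "b \<in> pverts G" "b \<noteq> a" for a b
  proof (cases "b \<in> S z")
    case True
    then show ?thesis using SV(1)[OF z] that by (auto simp: clique_def)
  next
    case False
    then show ?thesis using univ[OF that(2)] that by (auto simp: clique_def)
  qed
  define D where "D = {a \<in> pverts G. \<sigma> a \<in> C}"
  have \<sigma>D: "\<sigma> ` D = C" using \<sigma> C by (auto simp: D_def bij_betw_def)
  \<comment> \<open>A pair that meets \<open>S z\<close> is adjacent by \<open>KV\<close>; a pair
    outside \<open>S z\<close> lies in \<open>D\<close>, and \<open>pw\<close> provides a clique
    containing both.\<close>
  have "clique G (sym_diff (S z) D)"
    unfolding clique_def
  proof (intro conjI ballI impI)
    show "sym_diff (S z) D \<subseteq> pverts G" using SV(2)[OF z] by (auto simp: D_def)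
    fix a b assume ab: "a \<in> sym_diff (S z) D" "b \<in> sym_diff (S z) D" "a \<noteq> b"
    have abV: "a \<in> pverts G" "b \<in> pverts G" using ab SV(2)[OF z] by (auto simp: D_def)
    show "(a, b) \<in> parcs G"
    proof (cases "a \<in> S z \<or> b \<in> S z")
      case True
      then show ?thesis using KV sym ab(3) abV by metis
    next
      case False
      then have "\<sigma> a \<in> C" "\<sigma> b \<in> C" using ab by (auto simp: D_def)
      moreover have "\<sigma> a \<noteq> \<sigma> b" using \<sigma> abV ab(3) by (auto simp: bij_betw_def dest: inj_onD)
      ultimately obtain u where u: "u \<in> pverts H" "\<sigma> a \<in> flips \<phi> k z u" "\<sigma> b \<in> flips \<phi> k z u"
        using pw by blast
      have sub: "sym_diff (S z) (S u) \<subseteq> pverts G" using SV(2)[OF z] SV(2)[OF u(1)] by blast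
      have inj: "inj_on \<sigma> (pverts G)" using \<sigma> by (simp add: bij_betw_def)
      have "a \<in> sym_diff (S z) (S u)" "b \<in> sym_diff (S z) (S u)"
        using u(2,3) inj_on_image_mem_iff[OF inj abV(1) sub] inj_on_image_mem_iff[OF inj abV(2) sub]
        unfolding flips_S[OF z u(1)] by (simp_all only:)
      then have "a \<in> S u" "b \<in> S u" using False by blast+
      then show ?thesis using SV(1)[OF u(1)] ab(3) unfolding clique_def by blast
    qed
  qed
  then obtain u where u: "u \<in> pverts H" "S u = sym_diff (S z) D" using onto by blast
  have "sym_diff (S z) (S u) = D" using u(2) by auto
  then have "flips \<phi> k z u = C" using flips_S[OF z u(1)] \<sigma>D by simp
  then show "\<exists>u\<in>pverts H. flips \<phi> k z u = C" using u(1) by blast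
qed


section \<open>Orders of the coordinates\<close>

fun sep :: "('a \<Rightarrow> 'a \<Rightarrow> bool) \<Rightarrow> 'a list \<Rightarrow> nat" where
  "sep A [] = 0"
| "sep A [x] = 0"
| "sep A (x # y # xs) = of_bool (A x y) + sep A (y # xs)"

lemma sep_snoc: "xs \<noteq> [] \<Longrightarrow> sep A (xs @ [u]) = sep A xs + of_bool (A (last xs) u)"
proof (induction xs rule: induct_list012)
  case (3 x y xs)
  then show ?case by simp
qed simp_all

lemma sep_Cons: "sep A (x # xs) \<le> length xs"
  by (induction xs arbitrary: x) (auto simp: of_bool_def intro: le_SucI)

lemma sep_Cons_isolated: "(\<And>y. \<not> A x y) \<Longrightarrow> sep A (x # xs) = sep A xs"
  by (cases xs) auto

text \<open>The Held-Karp value. The predecessor \<open>v\<close> of the first vertex is kept apart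
  from the set \<open>X\<close> still to be ordered, so that fixing the first vertex leaves a
  problem of the same form.\<close>

definition opt :: "('a \<Rightarrow> 'a \<Rightarrow> bool) \<Rightarrow> 'a set \<Rightarrow> 'a \<Rightarrow> nat" where
  "opt A X v = (LEAST m. \<exists>xs. distinct xs \<and> set xs = X \<and> m = sep A (v # xs))"

lemma opt_le: "distinct xs \<Longrightarrow> set xs = X \<Longrightarrow> opt A X v \<le> sep A (v # xs)"
  unfolding opt_def by (intro Least_le) blast

lemma opt_attained:
  assumes "finite X"
  obtains xs where "distinct xs" "set xs = X" "opt A X v = sep A (v # xs)"
proof -
  obtain ys where "distinct ys" "set ys = X" using finite_distinct_list[OF assms] by blast
  then have "\<exists>m xs. distinct xs \<and> set xs = X \<and> m = sep A (v # xs)" by blast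
  from LeastI_ex[OF this] show ?thesis using that unfolding opt_def by blast
qed

lemma opt_empty [simp]: "opt A {} v = 0"
  using opt_le[of "[]" "{}" A v] by simp

lemma opt_le_card:
  assumes "finite X"
  shows "opt A X v \<le> card X"
proof -
  obtain xs where "distinct xs" "set xs = X" "opt A X v = sep A (v # xs)"
    using opt_attained[OF assms] .
  then show ?thesis using sep_Cons[of A v xs] distinct_card[of xs] by simp
qed

lemma opt_le_step:
  assumes "finite X" "u \<in> X"
  shows "opt A X v \<le> of_bool (A v u) + opt A (X - {u}) u"
proof -
  obtain xs where "distinct xs" "set xs = X - {u}" "opt A (X - {u}) u = sep A (u # xs)"
    using opt_attained[of "X - {u}" A u] assms by auto
  moreover have "set (u # xs) = X" using calculation(2) assms(2) by auto
  ultimately show ?thesis using opt_le[of "u # xs" X A v] by simp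
qed

lemma opt_step:
  assumes "finite X" "X \<noteq> {}"
  shows "\<exists>u\<in>X. opt A X v = of_bool (A v u) + opt A (X - {u}) u"
proof -
  obtain xs where xs: "distinct xs" "set xs = X" "opt A X v = sep A (v # xs)"
    using opt_attained[OF assms(1)] .
  then obtain u ys where u: "xs = u # ys" using assms(2) by (cases xs) auto
  have "opt A (X - {u}) u \<le> sep A (u # ys)" using xs u by (intro opt_le) auto
  then show ?thesis using opt_le_step[OF assms(1), of u A v] xs u by (intro bexI[of _ u]) auto
qed

text \<open>The Bellman equation in the form in which a minimum search delivers it: a lower bound
  for all candidates that one of them attains.\<close>

lemma opt_eqI:
  assumes "finite X" "\<And>u. u \<in> X \<Longrightarrow> b \<le> of_bool (A v u) + opt A (X - {u}) u"
    and "u \<in> X" "b = of_bool (A v u) + opt A (X - {u}) u"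
  shows "b = opt A X v"
  using opt_le_step[OF assms(1,3), of A v] opt_step[OF assms(1), of A v] assms(2,3,4)
  by (metis antisym empty_iff)

section \<open>Greedy and optimal orders as sequences of cheapest steps\<close>

definition step_cost :: "(nat \<Rightarrow> nat \<Rightarrow> bool) \<Rightarrow> (nat set \<Rightarrow> nat \<Rightarrow> nat) \<Rightarrow> nat set \<Rightarrow> nat \<Rightarrow> nat \<Rightarrow> nat" where
  "step_cost A g X v u = of_bool (A v u) + g (X - {u}) u"

text \<open>
  Here \<open>g X u\<close> estimates the cost of continuing from \<open>u\<close> through \<open>X\<close>: the greedy order has \<open>g = 0\<close>, the
  optimal one \<open>g = opt A\<close>.  The number \<open>k\<close> itself is the dummy predecessor of the first vertex.
\<close>

inductive walk :: "(nat \<Rightarrow> nat \<Rightarrow> bool) \<Rightarrow> (nat set \<Rightarrow> nat \<Rightarrow> nat) \<Rightarrow> nat \<Rightarrow> nat list \<Rightarrow> bool"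
  for A g k where
  Nil: "walk A g k []"
| snoc: "walk A g k xs \<Longrightarrow> u < k \<Longrightarrow> u \<notin> set xs \<Longrightarrow>
     (\<And>y. y < k \<Longrightarrow> y \<notin> set xs \<Longrightarrow> step_cost A g ({..<k} - set xs) (last (k # xs)) u
                                 \<le> step_cost A g ({..<k} - set xs) (last (k # xs)) y) \<Longrightarrow>
     walk A g k (xs @ [u])"

lemma walk_distinct: "walk A g k xs \<Longrightarrow> distinct xs \<and> set xs \<subseteq> {..<k}"
  by (induction rule: walk.induct) auto

lemma walk_complete:
  assumes "walk A g k xs" "length xs = k"
  shows "set xs = {..<k}"
  using walk_distinct[OF assms(1)] assms(2) by (intro card_subset_eq) (auto simp: distinct_card)

text \<open>A minimizer in the Bellman equation moves cost from what lies ahead to what has been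
  paid without changing the sum, so the optimum of the whole problem is an invariant.\<close>

lemma walk_opt:
  assumes "walk A (opt A) k xs"
  shows "sep A (k # xs) + opt A ({..<k} - set xs) (last (k # xs)) = opt A {..<k} k"
  using assms
proof (induction rule: walk.induct)
  case Nil
  then show ?case by simp
next
  case (snoc xs u)
  define X where "X = {..<k} - set xs"
  have "u \<in> X" using snoc by (simp add: X_def)
  have "opt A X (last (k # xs)) = step_cost A (opt A) X (last (k # xs)) u"
    using opt_eqI[of X "step_cost A (opt A) X (last (k # xs)) u" A "last (k # xs)" u] \<open>u \<in> X\<close> snoc.hyps(4)
    by (auto simp: X_def step_cost_def)
  moreover have "{..<k} - set (xs @ [u]) = X - {u}" by (auto simp: X_def)
  moreover have "sep A (k # xs @ [u]) = sep A (k # xs) + of_bool (A (last (k # xs)) u)"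
    using sep_snoc[of "k # xs" A u] by simp
  ultimately show ?case using snoc.IH by (simp add: step_cost_def X_def)
qed

corollary walk_opt_minimal:
  assumes "walk A (opt A) k xs" "length xs = k" "distinct ys" "set ys = {..<k}"
  shows "sep A (k # xs) \<le> sep A (k # ys)"
  using walk_opt[OF assms(1)] walk_complete[OF assms(1,2)] opt_le[OF assms(3,4), of A k] by simp

lemma last_notin_butlast: "distinct xs \<Longrightarrow> xs \<noteq> [] \<Longrightarrow> last xs \<notin> set (butlast xs)"
  by (cases xs rule: rev_cases) simp_all

text \<open>
  The vertices at which the greedy walk gets stuck are adjacent to everything that follows.
\<close>

lemma walk_greedy:
  assumes "walk A (\<lambda>_ _. 0) k xs" "xs \<noteq> []" and "\<And>j. \<not> A k j"
  shows "\<exists>C\<subseteq>set (butlast xs). card C = sep A (k # xs) \<and>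
           (\<forall>c\<in>C. \<forall>y<k. y \<notin> set (butlast xs) \<longrightarrow> A c y) \<and> (\<forall>c\<in>C. \<forall>d\<in>C. c \<noteq> d \<longrightarrow> A c d \<or> A d c)"
  using assms(1,2)
proof (induction rule: walk.induct)
  case Nil
  then show ?case by simp
next
  case (snoc xs u)
  show ?case
  proof (cases "xs = []")
    case True
    \<comment> \<open>The dummy predecessor has no neighbours, so the first vertex costs nothing and
      the empty set will do.\<close>
    then show ?thesis using assms(3) by auto
  next
    case False
    then obtain C where C: "C \<subseteq> set (butlast xs)" "card C = sep A (k # xs)"
      "\<forall>c\<in>C. \<forall>y<k. y \<notin> set (butlast xs) \<longrightarrow> A c y" "\<forall>c\<in>C. \<forall>d\<in>C. c \<noteq> d \<longrightarrow> A c d \<or> A d c"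
      using snoc.IH by blast
    have d: "distinct xs" "set xs \<subseteq> {..<k}" using walk_distinct[OF snoc.hyps(1)] by auto
    have xs: "xs = butlast xs @ [last xs]" using False by simp
    have last: "last xs \<notin> set (butlast xs)" "last xs < k"
    using d False last_in_set[of xs] by (auto simp: last_notin_butlast simp del: last_in_set)
    have sub: "set (butlast xs) \<subseteq> set xs" by (auto dest: in_set_butlastD)
    have sep: "sep A (k # xs @ [u]) = sep A (k # xs) + of_bool (A (last xs) u)"
      using sep_snoc[of "k # xs" A u] False by simp
    show ?thesis
    proof (cases "A (last xs) u")
      case True
      \<comment> \<open>With the estimate 0 the cost of a step is the adjacency bit alone; if the
        cheapest step costs one, so do all others.\<close>
      then have stuck: "A (last xs) y" if "y < k" "y \<notin> set xs" for y
        using snoc.hyps(4)[OF that] False by (auto simp: step_cost_def of_bool_def split: if_splits)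
      have "finite C" "last xs \<notin> C" using C(1) last finite_subset by auto
      then have "card (insert (last xs) C) = sep A (k # xs @ [u])" using C(2) sep True by simp
      moreover have "insert (last xs) C \<subseteq> set (butlast (xs @ [u]))"
        using C(1) sub False by auto
      moreover have "A c y" if "c \<in> C" "y < k" "y \<notin> set xs" for c y
        using C(3) sub that by blast
      moreover have "A c (last xs)" if "c \<in> C" for c
        using C(3) last that by blast
      ultimately show ?thesis
        using C(4) stuck by (intro exI[of _ "insert (last xs) C"]) auto
    next
      case False
      then have "card C = sep A (k # xs @ [u])" using C(2) sep by simp
      moreover have "A c y" if "c \<in> C" "y < k" "y \<notin> set xs" for c y
        using C(3) sub that by blast
      ultimately show ?thesis using C(1,4) sub by (intro exI[of _ C]) auto
    qed
  qed
qed

text \<open>The stuck vertices lie in \<open>butlast xs\<close>, so the last vertex is not among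
  them and enlarges the clique by one. The gain matters: \<open>s * s \<le> 2 ^ (s + 1)\<close>
  always holds, while \<open>s * s \<le> 2 ^ s\<close> fails for \<open>s = 3\<close>.\<close>

corollary walk_greedy_clique:
  assumes "walk A (\<lambda>_ _. 0) k xs" "length xs = k" "0 < k"
    and "\<And>j. \<not> A k j" and sym: "\<And>i j. A i j \<Longrightarrow> A j i"
  shows "\<exists>C\<subseteq>{..<k}. card C = Suc (sep A (k # xs)) \<and> (\<forall>c\<in>C. \<forall>d\<in>C. c \<noteq> d \<longrightarrow> A c d)"
proof -
  have ne: "xs \<noteq> []" using assms by auto
  obtain C where C: "C \<subseteq> set (butlast xs)" "card C = sep A (k # xs)"
      "\<forall>c\<in>C. \<forall>y<k. y \<notin> set (butlast xs) \<longrightarrow> A c y" "\<forall>c\<in>C. \<forall>d\<in>C. c \<noteq> d \<longrightarrow> A c d \<or> A d c"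
    using walk_greedy[OF assms(1) ne assms(4)] by blast
  have d: "distinct xs" "set xs \<subseteq> {..<k}" using walk_distinct[OF assms(1)] by auto
  have last: "last xs \<notin> set (butlast xs)" "last xs < k"
    using d ne last_in_set[of xs] by (auto simp: last_notin_butlast simp del: last_in_set)
  have "finite C" "last xs \<notin> C" "C \<subseteq> {..<k}"
    using C(1) last d finite_subset by (auto dest: in_set_butlastD)
  moreover have "A c d" if "c \<in> C" "d \<in> C" "c \<noteq> d" for c d using C(4) sym that by blast
  moreover have "A c (last xs)" "A (last xs) c" if "c \<in> C" for c using C(3) last sym that by blast+
  ultimately show ?thesis
    using C(2) last by (intro exI[of _ "insert (last xs) C"]) auto
qed

text \<open>What the construction uses of a simplex graph: its vertices are labelled by sets of
  coordinates that realize the distances and are exactly the cliques of the relation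
  \<open>A\<close>. Neither \<open>G\<close> nor the choice of the base vertex is visible.
  Singletons are labels, so \<open>A i i\<close> holds for every \<open>i < k\<close>; adjacency is
  meaningful between distinct coordinates only.\<close>

locale clique_coding =
  fixes H :: "nat pair_pre_digraph" and k :: nat and L :: "nat \<Rightarrow> nat set"
    and A :: "nat \<Rightarrow> nat \<Rightarrow> bool"
  assumes finite_H: "finite (pverts H)"
    and L_subset: "u \<in> pverts H \<Longrightarrow> L u \<subseteq> {..<k}"
    and L_inj: "inj_on L (pverts H)"
    and dist: "u \<in> pverts H \<Longrightarrow> v \<in> pverts H \<Longrightarrow>
      gdist (with_proj H) u v = ereal (real (card (sym_diff (L u) (L v))))"
    and A_iff: "A i j \<longleftrightarrow> (\<exists>u\<in>pverts H. i \<in> L u \<and> j \<in> L u)"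
    and L_clique: "C \<subseteq> {..<k} \<Longrightarrow> (\<And>i j. i \<in> C \<Longrightarrow> j \<in> C \<Longrightarrow> i \<noteq> j \<Longrightarrow> A i j) \<Longrightarrow>
      \<exists>u\<in>pverts H. L u = C"
begin

lemma A_sym: "A i j \<Longrightarrow> A j i"
  by (auto simp: A_iff)

lemma A_outside: "\<not> A k j"
  using L_subset by (auto simp: A_iff)

text \<open>Every subset of a clique is a clique and therefore the label of a vertex.\<close>

lemma clique_bound:
  assumes "C \<subseteq> {..<k}" "\<And>i j. i \<in> C \<Longrightarrow> j \<in> C \<Longrightarrow> i \<noteq> j \<Longrightarrow> A i j"
  shows "2 ^ card C \<le> card (pverts H)"
proof -
  have "Pow C \<subseteq> L ` pverts H"
  proof
    fix D assume "D \<in> Pow C"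
    then have "\<exists>u\<in>pverts H. L u = D" using assms by (intro L_clique) blast+
    then show "D \<in> L ` pverts H" by blast
  qed
  then have "card (Pow C) \<le> card (pverts H)"
    using finite_H by (meson card_image_le card_mono finite_imageI le_trans)
  moreover have "finite C" using assms(1) finite_subset by blast
  ultimately show ?thesis by (simp add: card_Pow)
qed

lemma dimension_bound: "Suc k \<le> card (pverts H)"
proof -
  have "insert {} ((\<lambda>i. {i}) ` {..<k}) \<subseteq> L ` pverts H"
  proof
    fix D assume "D \<in> insert {} ((\<lambda>i. {i}) ` {..<k})"
    then have "\<exists>u\<in>pverts H. L u = D" by (intro L_clique) auto
    then show "D \<in> L ` pverts H" by blast
  qed
  then have "card (insert {} ((\<lambda>i. {i}) ` {..<k})) \<le> card (pverts H)"
    using finite_H by (meson card_image_le card_mono finite_imageI le_trans)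
  then show ?thesis by (subst (asm) card_insert_disjoint) (auto simp: card_image)
qed

text \<open>Positions outside the range of \<open>p\<close> are zero in every string, so distances
  do not change. Two consecutive ones would come from two coordinates of a common label, hence from
  an adjacent pair at consecutive positions.\<close>

lemma embedding_of_positions:
  assumes inj: "inj_on p {..<k}" and f: "\<And>i. i < k \<Longrightarrow> p i < f"
    and apart: "\<And>i j. i < k \<Longrightarrow> j < k \<Longrightarrow> p j = Suc (p i) \<Longrightarrow> \<not> A i j"
  shows "isometric_embedding (with_proj H) (fibonacci_cube f) (\<lambda>u. string_of f (p ` L u))"
proof -
  have sub: "p ` L u \<subseteq> {..<f}" if "u \<in> pverts H" for u using L_subset[OF that] f by auto
  have fib: "string_of f (p ` L u) \<in> verts (fibonacci_cube f)" if u: "u \<in> pverts H" for u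
  proof -
    have "\<not> (i \<in> p ` L u \<and> Suc i \<in> p ` L u)" for i
    proof
      assume "i \<in> p ` L u \<and> Suc i \<in> p ` L u"
      then obtain a b where ab: "i = p a" "a \<in> L u" "Suc i = p b" "b \<in> L u" by auto
      then have "A a b" using u by (auto simp: A_iff)
      then show False using apart[of a b] ab L_subset[OF u] by auto
    qed
    then show ?thesis by (auto simp: verts_fibonacci_cube fibonacci_string_iff)
  qed
  have dist_eq: "gdist (fibonacci_cube f) (string_of f (p ` L u)) (string_of f (p ` L v)) =
                 gdist (with_proj H) u v" if uv: "u \<in> pverts H" "v \<in> pverts H" for u v
  proof -
    have "{i. i < f \<and> string_of f (p ` L u) ! i \<noteq> string_of f (p ` L v) ! i}
            = sym_diff (p ` L u) (p ` L v)"
      using sym_diff_ones[of "string_of f (p ` L u)" f "string_of f (p ` L v)"] sub uv by simp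
    also have "\<dots> = p ` sym_diff (L u) (L v)"
      by (rule image_sym_diff[OF inj, symmetric]) (use L_subset uv in auto)
    finally have eq: "{i. i < f \<and> string_of f (p ` L u) ! i \<noteq> string_of f (p ` L v) ! i}
            = p ` sym_diff (L u) (L v)" .
    have "inj_on p (sym_diff (L u) (L v))"
      using L_subset[OF uv(1)] L_subset[OF uv(2)] by (intro inj_on_subset[OF inj]) blast
    then have "card (p ` sym_diff (L u) (L v)) = card (sym_diff (L u) (L v))" by (rule card_image)
    then show ?thesis unfolding gdist_fibonacci_cube[OF fib fib, OF uv] eq dist[OF uv] by (simp only:)
  qed
  have "inj_on (\<lambda>u. string_of f (p ` L u)) (pverts H)"
  proof (rule inj_onI)
    fix u v assume uv: "u \<in> pverts H" "v \<in> pverts H" "string_of f (p ` L u) = string_of f (p ` L v)"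
    then have "p ` L u = p ` L v" using sub ones_string_of by metis
    then have "L u = L v" using inj_on_image_eq_iff[OF inj] L_subset uv by blast
    then show "u = v" using L_inj uv by (auto dest: inj_onD)
  qed
  then show ?thesis unfolding isometric_embedding_def using fib dist_eq by auto
qed

end

section \<open>Lower bound: orders from embeddings into Fibonacci cubes\<close>

lemma sorted_positions_bound:
  assumes "xs \<noteq> []" "sorted_wrt (\<lambda>i j. p i < (p j :: nat)) xs"
    and "\<And>i j. i \<in> set xs \<Longrightarrow> j \<in> set xs \<Longrightarrow> A i j \<Longrightarrow> p j \<noteq> Suc (p i)"
  shows "p (hd xs) + length xs + sep A xs \<le> Suc (p (last xs))"
  using assms
proof (induction xs rule: induct_list012)
  case (3 x y xs)
  have "p (hd (y # xs)) + length (y # xs) + sep A (y # xs) \<le> Suc (p (last (y # xs)))"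
    using 3 by (intro 3) auto
  \<comment> \<open>Strictly increasing positions differ by at least one, and for an adjacent pair
    the difference one is excluded.\<close>
  moreover have "p x < p y" "A x y \<Longrightarrow> p y \<noteq> Suc (p x)" using 3 by auto
  ultimately show ?case by (auto simp: of_bool_def)
qed auto

context clique_coding
begin

text \<open>Between the empty label and the label \<open>{i}\<close> exactly one position
  \<open>\<tau> i\<close> flips; sorting the coordinates by \<open>\<tau>\<close> gives the order.
  The embedding is arbitrary: some positions may be constant and some inverted.\<close>

lemma fibonacci_lower_bound:
  assumes iso: "isometric_embedding (with_proj H) (fibonacci_cube d) \<psi>"
  shows "\<exists>xs. distinct xs \<and> set xs = {..<k} \<and> k + sep A xs \<le> d"
proof (cases "k = 0")
  case True
  then show ?thesis by (intro exI[of _ "[]"]) auto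
next
  case False
  have \<psi>: "length (\<psi> u) = d" "fibonacci_string (\<psi> u)" if "u \<in> pverts H" for u
    using iso that by (auto simp: isometric_embedding_def verts_fibonacci_cube)
  define D where "D u v = {i. i < d \<and> \<psi> u ! i \<noteq> \<psi> v ! i}" for u v
  have card_D: "card (D u v) = card (sym_diff (L u) (L v))" if uv: "u \<in> pverts H" "v \<in> pverts H" for u v
  proof -
    have "gdist (fibonacci_cube d) (\<psi> u) (\<psi> v) = ereal (real (card (D u v)))"
      unfolding D_def using \<psi> uv by (intro gdist_fibonacci_cube) (auto simp: verts_fibonacci_cube)
    moreover have "gdist (fibonacci_cube d) (\<psi> u) (\<psi> v) = gdist (with_proj H) u v"
      using iso uv by (auto simp: isometric_embedding_def)
    ultimately show ?thesis using dist[OF uv] by (simp only: ereal.inject of_nat_eq_iff)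
  qed
  have D_via: "D u v = sym_diff (D x u) (D x v)" for u v x by (auto simp: D_def)
  have finD: "finite (D u v)" for u v by (simp add: D_def)
  obtain z where z: "z \<in> pverts H" "L z = {}" using L_clique[of "{}"] by auto
  have "\<exists>e. \<forall>i<k. e i \<in> pverts H \<and> L (e i) = {i}"
    using L_clique[of "{_}"] by (intro choice) (metis empty_iff insert_iff lessThan_iff subsetI)
  then obtain e where e: "\<And>i. i < k \<Longrightarrow> e i \<in> pverts H" "\<And>i. i < k \<Longrightarrow> L (e i) = {i}" by blast
  have "\<exists>t. D z (e i) = {t}" if i: "i < k" for i
    using card_D[OF z(1) e(1)[OF i]] e(2)[OF i] z(2) by (simp add: card_1_singleton_iff)
  then obtain \<tau> where \<tau>: "\<And>i. i < k \<Longrightarrow> D z (e i) = {\<tau> i}" by metis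
  have \<tau>_less: "\<tau> i < d" if "i < k" for i using \<tau>[OF that] by (auto simp: D_def)
  have card_pair: "card (sym_diff {i} {j}) = 2" if "i \<noteq> j" for i j :: nat
  proof -
    have "sym_diff {i} {j} = {i, j}" using that by auto
    then show ?thesis using that by simp
  qed
  have \<tau>_inj: "\<tau> i \<noteq> \<tau> j" if ij: "i < k" "j < k" "i \<noteq> j" for i j
  proof
    assume eq: "\<tau> i = \<tau> j"
    have "D (e i) (e j) = {}" unfolding D_via[of "e i" "e j" z] \<tau>[OF ij(1)] \<tau>[OF ij(2)] eq by simp
    then show False
      using card_D[OF e(1)[OF ij(1)] e(1)[OF ij(2)]] card_pair[OF ij(3)]
      unfolding e(2)[OF ij(1)] e(2)[OF ij(2)] by (metis card.empty zero_neq_numeral)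
  qed
  have apart: "\<tau> j \<noteq> Suc (\<tau> i)" if ij: "i < k" "j < k" "i \<noteq> j" "A i j" for i j
  proof
    assume eq: "\<tau> j = Suc (\<tau> i)"
    obtain u where u: "u \<in> pverts H" "L u = {i, j}"
      using L_clique[of "{i, j}"] ij A_sym by auto
    define E where "E = D z u"
    have cE: "card E = 2" unfolding E_def using card_D[OF z(1) u(1)] u(2) z(2) ij(3) by simp
    \<comment> \<open>The label \<open>{i, j}\<close> is at distance two from the empty one and at
      distance one from \<open>{a}\<close>, which forces the position of \<open>a\<close> to be
      among its two flipped ones.\<close>
    have mem: "\<tau> a \<in> E" if a: "a \<in> {i, j}" for a
    proof -
      have ak: "a < k" using a ij by auto
      have "sym_diff {a} {i, j} = {if a = i then j else i}" using a ij(3) by auto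
      then have "card (sym_diff {a} {i, j}) = card {if a = i then j else i}" by (simp only:)
      then have "card (D (e a) u) = 1"
        using card_D[OF e(1)[OF ak] u(1)] unfolding u(2) e(2)[OF ak]
        by (simp only: card.insert finite.emptyI empty_iff not_False_eq_True card.empty One_nat_def)
      moreover have "D (e a) u = sym_diff {\<tau> a} E" using D_via[of "e a" u z] \<tau>[OF ak] by (simp add: E_def)
      ultimately have c1: "card (sym_diff {\<tau> a} E) = 1" by (simp only:)
      have "finite E" by (simp add: E_def finD)
      then show ?thesis unfolding card_sym_diff_singleton_mem[OF \<open>finite E\<close>] c1 cE by simp
    qed
    define t where "t = \<tau> i"
    have td: "Suc t < d" using \<tau>_less[OF ij(2)] eq by (simp add: t_def)
    have z_u: "\<psi> u ! t \<noteq> \<psi> z ! t" "\<psi> u ! Suc t \<noteq> \<psi> z ! Suc t"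
      using mem[of i] mem[of j] eq by (auto simp: E_def D_def t_def)
    have m: "t \<in> D z (e i)" "Suc t \<notin> D z (e i)" "t \<notin> D z (e j)" "Suc t \<in> D z (e j)"
      unfolding \<tau>[OF ij(1)] \<tau>[OF ij(2)] eq by (simp_all add: t_def)
    have z_i: "\<psi> (e i) ! t \<noteq> \<psi> z ! t" "\<psi> (e i) ! Suc t = \<psi> z ! Suc t"
      using m(1,2) td by (auto simp: D_def)
    have z_j: "\<psi> (e j) ! t = \<psi> z ! t" "\<psi> (e j) ! Suc t \<noteq> \<psi> z ! Suc t"
      using m(3,4) td by (auto simp: D_def)
    \<comment> \<open>Relative to \<open>\<psi> z\<close> these four strings flip every subset of
      the positions \<open>t\<close> and \<open>Suc t\<close>; whatever the bits of
      \<open>\<psi> z\<close>, one of them has two ones there.\<close>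
    have "\<not> (\<psi> x ! t \<and> \<psi> x ! Suc t)" if "x \<in> {z, u, e i, e j}" for x
      using that \<psi> z(1) u(1) e(1) ij td by (auto simp: fibonacci_string_iff)
    then show False using z_u z_i z_j by auto
  qed
  define xs where "xs = sort_key \<tau> [0..<k]"
  have inj: "inj_on \<tau> {..<k}" using \<tau>_inj by (auto simp: inj_on_def)
  have xs: "distinct xs" "set xs = {..<k}" by (auto simp: xs_def)
  have sorted: "sorted_wrt (<) (map \<tau> xs)"
    using inj xs unfolding strict_sorted_iff by (simp add: distinct_map) (simp add: xs_def)
  have len: "length xs = k" using xs(1,2) distinct_card by fastforce
  have "xs \<noteq> []" using False len by auto
  have "\<tau> (hd xs) + length xs + sep A xs \<le> Suc (\<tau> (last xs))"
  proof (rule sorted_positions_bound[OF \<open>xs \<noteq> []\<close>])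
    show "sorted_wrt (\<lambda>i j. \<tau> i < \<tau> j) xs" using sorted by (simp add: sorted_wrt_map)
    show "\<tau> j \<noteq> Suc (\<tau> i)" if "i \<in> set xs" "j \<in> set xs" "A i j" for i j
      using apart[of i j] that xs(2) by (cases "i = j") auto
  qed
  moreover have "\<tau> (last xs) < d" using \<tau>_less xs(2) \<open>xs \<noteq> []\<close> last_in_set by blast
  ultimately show ?thesis using xs len by (intro exI[of _ xs]) auto
qed

end

section \<open>Upper bound: embeddings from orders\<close>

lemma sep_take_Suc:
  assumes "Suc t < length xs"
  shows "sep A (v # take (Suc (Suc t)) xs) = sep A (v # take (Suc t) xs) + of_bool (A (xs ! t) (xs ! Suc t))"
proof -
  have "last (v # take (Suc t) xs) = xs ! t"
    using assms by (simp add: take_Suc_conv_app_nth)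
  moreover have "take (Suc (Suc t)) xs = take (Suc t) xs @ [xs ! Suc t]"
    using assms by (rule take_Suc_conv_app_nth)
  ultimately show ?thesis using sep_snoc[of "v # take (Suc t) xs" A "xs ! Suc t"] by simp
qed

context clique_coding
begin

text \<open>The vertex in place \<open>t\<close> moves to position \<open>t\<close> plus the number
  of separators before it, the one directly in front of it included. Positions of successive
  vertices thus differ by two where a separator stands and by one otherwise, and no other pair of
  positions differs by one.\<close>

lemma embedding_of_order:
  assumes xs: "distinct xs" "set xs = {..<k}"
    and p: "\<And>t. t < k \<Longrightarrow> p (xs ! t) = t + sep A (k # take (Suc t) xs)"
  shows "inj_on p {..<k}" "\<And>i. i < k \<Longrightarrow> p i < k + sep A (k # xs)"
    "isometric_embedding (with_proj H) (fibonacci_cube (k + sep A (k # xs))) (\<lambda>u. string_of (k + sep A (k # xs)) (p ` L u))"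
proof -
  define h where "h t = t + sep A (k # take (Suc t) xs)" for t
  have len: "length xs = k" using xs distinct_card by fastforce
  have h_Suc: "h (Suc t) = Suc (h t) + of_bool (A (xs ! t) (xs ! Suc t))" if "Suc t < k" for t
    using sep_take_Suc[of t xs A k] that len by (simp add: h_def)
  have mono: "h i < h j" if "i < j" "j < k" for i j
    using that
  proof (induction j)
    case (Suc j)
    then show ?case using h_Suc[of j] by (cases "i = j") auto
  qed simp
  have bound: "h t < k + sep A (k # xs)" if "t < k" for t
  proof -
    have "h t \<le> h (k - 1)"
    proof (cases "t = k - 1")
      case False
      then have "t < k - 1" "k - 1 < k" using that by auto
      then show ?thesis using mono[of t "k - 1"] by simp
    qed simp
    moreover have "h (k - 1) = k - 1 + sep A (k # xs)" using that len by (simp add: h_def)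
    ultimately show ?thesis using that by simp
  qed
  have ex: "\<exists>t<k. i = xs ! t" if "i < k" for i
    using that xs(2) len by (metis in_set_conv_nth lessThan_iff)
  have p_h: "p (xs ! t) = h t" if "t < k" for t using p[OF that] by (simp add: h_def)
  show inj: "inj_on p {..<k}"
  proof (rule inj_onI)
    fix i j assume ij: "i \<in> {..<k}" "j \<in> {..<k}" "p i = p j"
    then obtain s t where st: "s < k" "t < k" "i = xs ! s" "j = xs ! t"
      using ex[of i] ex[of j] by (metis lessThan_iff)
    then have "h s = h t" using ij p_h by simp
    then have "s = t" using mono[of s t] mono[of t s] st by (metis less_irrefl linorder_neqE_nat)
    then show "i = j" using st by simp
  qed
  show less: "p i < k + sep A (k # xs)" if "i < k" for i
    using ex[OF that] p_h bound by auto
  show "isometric_embedding (with_proj H) (fibonacci_cube (k + sep A (k # xs))) (\<lambda>u. string_of (k + sep A (k # xs)) (p ` L u))"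
  proof (rule embedding_of_positions[OF inj less])
    fix i j assume ij: "i < k" "j < k" "p j = Suc (p i)"
    then obtain s t where st: "s < k" "t < k" "i = xs ! s" "j = xs ! t"
      using ex[of i] ex[of j] by metis
    then have h: "h t = Suc (h s)" using ij p_h by simp
    have "s < t"
    proof (rule ccontr)
      assume "\<not> s < t"
      then have "t = s \<or> h t < h s" using mono[of t s] st(1) by (cases "t = s") auto
      then show False using h by auto
    qed
    have "t = Suc s"
    proof (rule ccontr)
      assume "t \<noteq> Suc s"
      then have "Suc s < t" using \<open>s < t\<close> by simp
      then have "h s < h (Suc s)" "h (Suc s) < h t" using mono st by auto
      then show False using h by simp
    qed
    then show "\<not> A i j" using h_Suc[of s] h st by (auto simp: of_bool_def split: if_splits)
  qed
qed

lemma fdim_lower_bound: "\<exists>ys. distinct ys \<and> set ys = {..<k} \<and> k + sep A ys \<le> fdim (with_proj H)"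
proof -
  \<comment> \<open>\<open>fdim\<close> is defined by \<open>LEAST\<close>, so some embedding has to
    be exhibited before its property can be used; any order gives one.\<close>
  have "\<exists>d f. isometric_embedding (with_proj H) (fibonacci_cube d) f"
    using embedding_of_order(3)[of "[0..<k]" "\<lambda>t. t + sep A (k # take (Suc t) [0..<k])"] by fastforce
  from LeastI_ex[OF this] obtain f where
    "isometric_embedding (with_proj H) (fibonacci_cube (fdim (with_proj H))) f"
    unfolding fdim_def by blast
  then show ?thesis by (rule fibonacci_lower_bound)
qed

end


section \<open>Running time bounds for programs\<close>

text \<open>Total correctness with a time bound. As \<open>exec\<close> is deterministic, the
  existential quantifier speaks about the only run.\<close>

definition runs :: "nat \<Rightarrow> com \<Rightarrow> state \<Rightarrow> nat \<Rightarrow> (state \<Rightarrow> bool) \<Rightarrow> bool" where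
  "runs w c s T Q \<longleftrightarrow> (\<exists>t s'. exec w c s t s' \<and> t \<le> T \<and> Q s')"

lemma runs_mono:
  "runs w c s T Q \<Longrightarrow> T \<le> T' \<Longrightarrow> (\<And>s'. Q s' \<Longrightarrow> Q' s') \<Longrightarrow> runs w c s T' Q'"
  unfolding runs_def using order_trans by blast

lemma runs_exec: "exec w c s t s' \<Longrightarrow> t = T \<Longrightarrow> Q s' \<Longrightarrow> runs w c s T Q"
  unfolding runs_def by blast

lemma runs_Seq:
  assumes "runs w c1 s T1 (\<lambda>s'. runs w c2 s' T2 Q)"
  shows "runs w (Seq c1 c2) s (T1 + T2) Q"
proof -
  obtain t1 s1 t2 s2 where "exec w c1 s t1 s1" "t1 \<le> T1" "exec w c2 s1 t2 s2" "t2 \<le> T2" "Q s2"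
    using assms unfolding runs_def by blast
  then show ?thesis unfolding runs_def by (intro exI[of _ "t1 + t2"] exI[of _ s2]) (auto intro: exec.Seq)
qed

lemma runs_Cond:
  assumes "eval_exp w e s \<noteq> 0 \<Longrightarrow> runs w c1 s T Q" "eval_exp w e s = 0 \<Longrightarrow> runs w c2 s T Q"
  shows "runs w (Cond e c1 c2) s (1 + exp_cost e + T) Q"
proof (cases "eval_exp w e s = 0")
  case True
  then obtain t s' where "exec w c2 s t s'" "t \<le> T" "Q s'" using assms unfolding runs_def by blast
  then show ?thesis unfolding runs_def using exec.CondFalse[OF True] by (meson add_left_mono)
next
  case False
  then obtain t s' where "exec w c1 s t s'" "t \<le> T" "Q s'" using assms unfolding runs_def by blast
  then show ?thesis unfolding runs_def using exec.CondTrue[OF False] by (meson add_left_mono)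
qed

text \<open>Code without loops is run symbolically by \<open>result\<close>; invariants are then
  needed for the counting loops alone.\<close>

fun loop_free :: "com \<Rightarrow> bool" where
  "loop_free (Seq c1 c2) \<longleftrightarrow> loop_free c1 \<and> loop_free c2"
| "loop_free (Cond e c1 c2) \<longleftrightarrow> loop_free c1 \<and> loop_free c2"
| "loop_free (While e c) \<longleftrightarrow> False"
| "loop_free _ \<longleftrightarrow> True"

fun result :: "nat \<Rightarrow> com \<Rightarrow> state \<Rightarrow> state" where
  "result w (Assign r e) s = s\<lparr>regs := (regs s)(r := eval_exp w e s)\<rparr>"
| "result w (Store a e) s = s\<lparr>mem := (mem s)(eval_exp w a s := eval_exp w e s)\<rparr>"
| "result w (Seq c1 c2) s = result w c2 (result w c1 s)"
| "result w (Cond e c1 c2) s = (if eval_exp w e s \<noteq> 0 then result w c1 s else result w c2 s)"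
| "result w _ s = s"

text \<open>Adding the costs of both branches keeps the bounds free of maxima at the price of a
  constant factor.\<close>

fun max_cost :: "com \<Rightarrow> nat" where
  "max_cost (Assign r e) = 1 + exp_cost e"
| "max_cost (Store a e) = 1 + exp_cost a + exp_cost e"
| "max_cost (Seq c1 c2) = max_cost c1 + max_cost c2"
| "max_cost (Cond e c1 c2) = 1 + exp_cost e + (max_cost c1 + max_cost c2)"
| "max_cost _ = 1"

lemma runs_loop_free:
  assumes "loop_free c" "Q (result w c s)"
  shows "runs w c s (max_cost c) Q"
  using assms
proof (induction c arbitrary: s Q)
  case (Seq c1 c2)
  then show ?case by (auto intro!: runs_Seq)
next
  case (Cond e c1 c2)
  have "runs w c1 s (max_cost c1 + max_cost c2) Q" if "eval_exp w e s \<noteq> 0"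
    by (rule runs_mono[OF Cond.IH(1)[of Q s]]) (use Cond.prems that in auto)
  moreover have "runs w c2 s (max_cost c1 + max_cost c2) Q" if "eval_exp w e s = 0"
    by (rule runs_mono[OF Cond.IH(2)[of Q s]]) (use Cond.prems that in auto)
  ultimately show ?case unfolding max_cost.simps by (rule runs_Cond)
next
  case Skip
  show ?case by (rule runs_exec[OF exec.Skip]) (use Skip in simp_all)
next
  case (Assign r e)
  show ?case by (rule runs_exec[OF exec.Assign]) (use Assign in simp_all)
next
  case (Store a e)
  show ?case by (rule runs_exec[OF exec.Store]) (use Store in simp_all)
qed simp

definition For :: "nat \<Rightarrow> nat \<Rightarrow> nat \<Rightarrow> com \<Rightarrow> com" where
  "For r a b c = Seq (Assign r (Const a))
     (While (Op Less (Reg r) (Reg b)) (Seq c (Assign r (Op Add (Reg r) (Const 1)))))"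

text \<open>An iteration costs 8 beyond its body, 4 for the test and 4 for the increment; the
  initial assignment and the last test cost 6. The invariant is restored for the counter already
  advanced, and \<open>bound\<close> fixes the limit, which every test reads anew.\<close>

lemma runs_For:
  assumes N: "N < 2 ^ w" "a \<le> N" and w: "0 < w"
    and init: "I a (s\<lparr>regs := (regs s)(r := a)\<rparr>)"
    and bound: "\<And>i s. I i s \<Longrightarrow> regs s b = N"
    and body: "\<And>i s. a \<le> i \<Longrightarrow> i < N \<Longrightarrow> I i s \<Longrightarrow> regs s r = i \<Longrightarrow>
      runs w c s T (\<lambda>s'. regs s' r = i \<and> I (Suc i) (s'\<lparr>regs := (regs s')(r := Suc i)\<rparr>))"
    and final: "\<And>s. I N s \<Longrightarrow> Q s"
  shows "runs w (For r a b c) s (6 + N * (T + 8)) Q"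
proof -
  let ?W = "While (Op Less (Reg r) (Reg b)) (Seq c (Assign r (Op Add (Reg r) (Const 1))))"
  have loop: "runs w ?W s (4 + (N - i) * (T + 8)) Q" if "I i s" "regs s r = i" "a \<le> i" "i \<le> N" for i s
    using that
  proof (induction "N - i" arbitrary: i s)
    case 0
    then have "i = N" by simp
    then have "eval_exp w (Op Less (Reg r) (Reg b)) s = 0" using 0 N bound[OF 0(2)] by simp
    show ?case
      by (rule runs_exec[OF exec.WhileFalse]) (fact, use 0 final \<open>i = N\<close> in simp_all)
  next
    case (Suc m)
    then have less: "i < N" by simp
    have one: "(1 :: nat) < 2 ^ w" by (rule one_less_power) (use w in simp_all)
    have guard: "eval_exp w (Op Less (Reg r) (Reg b)) s \<noteq> 0"
      using Suc less N bound[OF Suc.prems(1)] one w by simp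
    obtain t1 s1 where s1: "exec w c s t1 s1" "t1 \<le> T" "regs s1 r = i"
      "I (Suc i) (s1\<lparr>regs := (regs s1)(r := Suc i)\<rparr>)"
      using body[OF Suc.prems(3) less Suc.prems(1,2)] unfolding runs_def by blast
    define s2 where "s2 = s1\<lparr>regs := (regs s1)(r := Suc i)\<rparr>"
    have ev: "eval_exp w (Op Add (Reg r) (Const 1)) s1 = Suc i" using s1(3) less N one w by simp
    have e2: "exec w (Assign r (Op Add (Reg r) (Const 1))) s1 4 s2"
      using exec.Assign[of w r "Op Add (Reg r) (Const 1)" s1] unfolding ev s2_def
      by (simp add: eval_nat_numeral)
    have "m = N - Suc i" using Suc(2) by simp
    then have "runs w ?W s2 (4 + (N - Suc i) * (T + 8)) Q"
      using Suc.hyps(1)[of "Suc i" s2] s1(4) less Suc.prems by (simp add: s2_def)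
    then obtain t3 s3 where s3: "exec w ?W s2 t3 s3" "t3 \<le> 4 + (N - Suc i) * (T + 8)" "Q s3"
      unfolding runs_def by blast
    have "exec w ?W s (1 + 3 + (t1 + 4) + t3) s3"
      using exec.WhileTrue[OF guard exec.Seq[OF s1(1) e2] s3(1)] by (simp add: eval_nat_numeral)
    moreover have "1 + 3 + (t1 + 4) + t3 \<le> 4 + (N - i) * (T + 8)"
    proof -
      have "(N - i) * (T + 8) = (T + 8) + (N - Suc i) * (T + 8)"
        using less by (metis Suc_diff_Suc mult_Suc)
      then show ?thesis using s1(2) s3(2) by simp
    qed
    ultimately show ?case unfolding runs_def using s3(3) by blast
  qed
  have a: "eval_exp w (Const a) s = a" using N by simp
  have "runs w (For r a b c) s (2 + (4 + (N - a) * (T + 8))) Q"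
    unfolding For_def
  proof (rule runs_Seq)
    have "runs w ?W (s\<lparr>regs := (regs s)(r := a)\<rparr>) (4 + (N - a) * (T + 8)) Q"
      using init N by (intro loop) auto
    then show "runs w (Assign r (Const a)) s 2 (\<lambda>s'. runs w ?W s' (4 + (N - a) * (T + 8)) Q)"
      by (intro runs_exec[OF exec.Assign]) (simp_all only: a exp_cost.simps one_add_one)
  qed
  then show ?thesis by (rule runs_mono) auto
qed

section \<open>Frame conditions and the minimum search\<close>

definition same :: "nat set \<Rightarrow> state \<Rightarrow> state \<Rightarrow> bool" where
  "same R s s' \<longleftrightarrow> (\<forall>x. x \<notin> R \<longrightarrow> regs s' x = regs s x)"

lemma same_refl [simp]: "same R s s"
  by (simp add: same_def)

lemma sameD: "same R s s' \<Longrightarrow> x \<notin> R \<Longrightarrow> regs s' x = regs s x"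
  by (simp add: same_def)

lemma same_trans: "same R s s' \<Longrightarrow> same R' s' s'' \<Longrightarrow> R \<subseteq> R'' \<Longrightarrow> R' \<subseteq> R'' \<Longrightarrow> same R'' s s''"
  unfolding same_def by (metis subsetD)

lemma same_upd [simp]:
  "x \<in> R \<Longrightarrow> same R s (s'\<lparr>regs := f\<rparr>) \<Longrightarrow> same R s (s'\<lparr>regs := f(x := v)\<rparr>)"
  "same R s (s'\<lparr>regs := regs s'\<rparr>) \<longleftrightarrow> same R s s'"
  "same R s (s'\<lparr>mem := m\<rparr>) \<longleftrightarrow> same R s s'"
  "same R s (s'\<lparr>regs := f, mem := m\<rparr>) \<longleftrightarrow> same R s (s'\<lparr>regs := f\<rparr>)"
  by (auto simp: same_def)

text \<open>The initial minimum \<open>k + 2\<close> exceeds every cost, since estimates are at most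
  \<open>k\<close> and an adjacency bit adds at most one; while it is unchanged, no candidate has
  been met.\<close>

definition scan :: "exp \<Rightarrow> exp \<Rightarrow> com" where
  "scan e ce = Seq (Assign 13 (Op Add (Reg 1) (Const 2)))
     (For 15 0 1 (Cond e (Seq (Assign 18 ce)
        (Cond (Op Less (Reg 18) (Reg 13)) (Seq (Assign 13 (Reg 18)) (Assign 14 (Reg 15))) Skip)) Skip))"

lemma runs_scan:
  assumes k: "regs s 1 = k" "k + 2 < 2 ^ w" and w: "0 < w"
    and X: "X \<subseteq> {..<k}"
    and e: "\<And>s'. same {13,14,15,18} s s' \<Longrightarrow> mem s' = mem s \<Longrightarrow> regs s' 15 < k \<Longrightarrow>
      eval_exp w e s' \<noteq> 0 \<longleftrightarrow> regs s' 15 \<in> X"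
    and ce: "\<And>s'. same {13,14,15,18} s s' \<Longrightarrow> mem s' = mem s \<Longrightarrow> regs s' 15 \<in> X \<Longrightarrow>
      eval_exp w ce s' = c (regs s' 15)"
    and c: "\<And>u. u \<in> X \<Longrightarrow> c u < k + 2"
    and Q: "\<And>s'. same {13,14,15,18} s s' \<Longrightarrow> mem s' = mem s \<Longrightarrow> (\<forall>u\<in>X. regs s' 13 \<le> c u) \<Longrightarrow>
      (X \<noteq> {} \<longrightarrow> regs s' 14 \<in> X \<and> regs s' 13 = c (regs s' 14)) \<Longrightarrow> Q s'"
  shows "runs w (scan e ce) s (10 + k * (exp_cost e + exp_cost ce + 20)) Q"
proof -
  define I where "I i s' \<longleftrightarrow> same {13,14,15,18} s s' \<and> mem s' = mem s \<and> regs s' 13 \<le> k + 2 \<and>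
    (\<forall>u\<in>X. u < i \<longrightarrow> regs s' 13 \<le> c u) \<and>
    (regs s' 13 < k + 2 \<longrightarrow> regs s' 14 \<in> X \<and> regs s' 13 = c (regs s' 14))" for i s'
  let ?body = "Cond e (Seq (Assign 18 ce)
        (Cond (Op Less (Reg 18) (Reg 13)) (Seq (Assign 13 (Reg 18)) (Assign 14 (Reg 15))) Skip)) Skip"
  define s0 where "s0 = s\<lparr>regs := (regs s)(13 := k + 2)\<rparr>"
  have one: "(1 :: nat) < 2 ^ w" by (rule one_less_power) (use w in simp_all)
  have body: "runs w ?body s' (max_cost ?body) (\<lambda>s'. regs s' 15 = i \<and> I (Suc i) (s'\<lparr>regs := (regs s')(15 := Suc i)\<rparr>))"
    if i: "i < k" and I: "I i s'" "regs s' 15 = i" for i s'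
  proof (rule runs_loop_free)
    have s': "same {13,14,15,18} s s'" "mem s' = mem s" using I by (auto simp: I_def)
    have less: "(u < Suc i) = (u < i \<or> u = i)" for u by auto
    show "regs (result w ?body s') 15 = i \<and>
      I (Suc i) (result w ?body s'\<lparr>regs := (regs (result w ?body s'))(15 := Suc i)\<rparr>)"
    proof (cases "i \<in> X")
      case False
      then have "eval_exp w e s' = 0" using e[OF s'] I i by auto
      then show ?thesis using I False by (auto simp: I_def less)
    next
      case True
      then have ev: "eval_exp w e s' \<noteq> 0" "eval_exp w ce s' = c i" using e[OF s'] ce[OF s'] I i by auto
      define s1 where "s1 = s'\<lparr>regs := (regs s')(18 := c i)\<rparr>"
      have ci: "c i < k + 2" using c True by blast
      have R: "regs s1 18 = c i" "regs s1 13 = regs s' 13" "regs s1 15 = i" "regs s1 14 = regs s' 14"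
        using I by (simp_all add: s1_def)
      have s1: "same {13,14,15,18} s s1" "mem s1 = mem s" using s' by (auto simp: s1_def)
      have le: "regs s' 13 \<le> k + 2" using I by (simp add: I_def)
      have test: "eval_exp w (Op Less (Reg 18) (Reg 13)) s1 \<noteq> 0 \<longleftrightarrow> c i < regs s' 13"
        using R ci le k one by simp
      have i_mod: "i mod 2 ^ w = i" "c i mod 2 ^ w = c i" using i ci k by auto
      have res: "result w ?body s' = (if c i < regs s' 13
          then s1\<lparr>regs := (regs s1)(13 := c i, 14 := i)\<rparr> else s1)"
        using ev test R i_mod by (auto simp: s1_def)
      have X1: "\<forall>u\<in>X. u < i \<longrightarrow> regs s' 13 \<le> c u" using I by (simp add: I_def)
      have X2: "regs s' 13 < k + 2 \<longrightarrow> regs s' 14 \<in> X \<and> regs s' 13 = c (regs s' 14)"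
        using I by (simp add: I_def)
      show ?thesis
        unfolding res I_def using R s1 ci le X1 X2 True
        by (auto simp: less)
    qed
  qed simp
  have "runs w (For 15 0 1 ?body) s0 (6 + k * (max_cost ?body + 8)) Q"
  proof (rule runs_For[where I = I])
    show "I 0 (s0\<lparr>regs := (regs s0)(15 := 0)\<rparr>)" by (auto simp: I_def s0_def same_def)
    show "regs s 1 = k" if "I i s" for i s using that k by (auto simp: I_def same_def)
    show "Q s'" if "I k s'" for s'
    proof (rule Q)
      have le: "\<forall>u\<in>X. regs s' 13 \<le> c u" using that X by (auto simp: I_def)
      show "same {13, 14, 15, 18} s s'" "mem s' = mem s" "\<forall>u\<in>X. regs s' 13 \<le> c u"
        using that le by (auto simp: I_def)
      show "X \<noteq> {} \<longrightarrow> regs s' 14 \<in> X \<and> regs s' 13 = c (regs s' 14)"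
      proof
        assume "X \<noteq> {}"
        then obtain u where "u \<in> X" by blast
        then have "regs s' 13 < k + 2" using le c[of u] by (meson le_less_trans)
        then show "regs s' 14 \<in> X \<and> regs s' 13 = c (regs s' 14)" using that by (auto simp: I_def)
      qed
    qed
  qed (use k w body in auto)
  moreover have "runs w (Assign 13 (Op Add (Reg 1) (Const 2))) s 4 (\<lambda>s'. s' = s0)"
    using runs_loop_free[of "Assign 13 (Op Add (Reg 1) (Const 2))" "\<lambda>s'. s' = s0" w s] k
    by (simp add: s0_def mod_simps eval_nat_numeral)
  ultimately have "runs w (scan e ce) s (4 + (6 + k * (max_cost ?body + 8))) Q"
    unfolding scan_def by (intro runs_Seq) (auto elim: runs_mono)
  then show ?thesis by (rule runs_mono) (auto simp: algebra_simps)
qed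


section \<open>The program\<close>

definition idx :: "nat \<Rightarrow> nat \<Rightarrow> nat \<Rightarrow> nat \<Rightarrow> exp" where
  "idx b i c j = Op Add (Reg b) (Op Add (Op Mul (Reg i) (Reg c)) (Reg j))"

definition idx1 :: "nat \<Rightarrow> nat \<Rightarrow> exp" where
  "idx1 b j = Op Add (Reg b) (Reg j)"

lemma exp_cost_idx [simp]: "exp_cost (idx b i c j) = 7" "exp_cost (idx1 b j) = 3"
  by (simp_all add: idx_def idx1_def)

lemma eval_idx:
  "eval_exp w (idx b i c j) s = (regs s b + (regs s i * regs s c + regs s j)) mod 2 ^ w"
  "eval_exp w (idx1 b j) s = (regs s b + regs s j) mod 2 ^ w"
  by (simp_all add: idx_def idx1_def mod_simps)

lemma runs_loop_free_le:
  "loop_free c \<Longrightarrow> max_cost c \<le> T \<Longrightarrow> Q (result w c s) \<Longrightarrow> runs w c s T Q"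
  by (rule runs_mono[OF runs_loop_free])

lemma runs_Seq_loop_free:
  assumes "loop_free c1" "runs w c2 (result w c1 s) T Q"
  shows "runs w (Seq c1 c2) s (max_cost c1 + T) Q"
  by (rule runs_Seq, rule runs_loop_free) (use assms in auto)

definition table :: "nat \<Rightarrow> nat \<Rightarrow> (nat \<Rightarrow> nat \<Rightarrow> bool) \<Rightarrow> (nat \<Rightarrow> nat) \<Rightarrow> bool" where
  "table r c R a \<longleftrightarrow> (\<forall>i<r. \<forall>j<c. a (i * c + j) = of_bool (R i j))"

lemma index_less:
  assumes "i < (r :: nat)" "j < c"
  shows "i * c + j < r * c"
proof -
  have "i * c + j < Suc i * c" using assms(2) by simp
  also have "\<dots> \<le> r * c" using assms(1) by (intro mult_le_mono1) simp
  finally show ?thesis .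
qed

lemma index_eq_iff:
  assumes "j < c" "j' < (c :: nat)"
  shows "i * c + j = i' * c + j' \<longleftrightarrow> i = i' \<and> j = j'"
proof
  assume eq: "i * c + j = i' * c + j'"
  have "(i * c + j) div c = i" "(i' * c + j') div c = i'" using assms by auto
  then show "i = i' \<and> j = j'" using eq by auto
qed auto

lemma tableD: "table r c R a \<Longrightarrow> i < r \<Longrightarrow> j < c \<Longrightarrow> a (i * c + j) = of_bool (R i j)"
  by (simp add: table_def)

lemma table_update:
  assumes "table r c R a" "i < r" "j < c"
    and "\<And>i' j'. i' < r \<Longrightarrow> j' < c \<Longrightarrow> R' i' j' \<longleftrightarrow> (if i' = i \<and> j' = j then v else R i' j')"
  shows "table r c R' (a(i * c + j := of_bool v))"
  using assms by (auto simp: table_def index_eq_iff)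

lemma table_cong:
  "table r c R a \<Longrightarrow> (\<And>i j. i < r \<Longrightarrow> j < c \<Longrightarrow> R i j \<longleftrightarrow> R' i j) \<Longrightarrow> table r c R' a"
  by (simp add: table_def)

text \<open>
  Registers 2 to 7 hold the start addresses of the table of \<open>\<phi>\<close>, of the \<open>(k + 1) \<times> k\<close> adjacency matrix
  of the coordinates (whose last row, for the dummy predecessor, is zero), of three arrays of length \<open>k\<close>
  (marks of the vertices that are already placed, positions, powers of two), and of a table with
  row length \<open>k\<close>, indexed by codes of vertex sets, for the estimates \<open>g\<close>.  Register 9 holds the number of
  rows of that table, behind which the output is written.  Register 8 holds the vertex of \<open>H\<close> that
  is taken for the empty clique, 10 the last placed vertex, 11 the code of the set of the
  remaining ones, 12 the number of separators, 13 and 14 the minimum of a scan and its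
  position; 15 to 17 are loop counters and 18 and 19 are temporary.
\<close>

definition flip_exp :: "nat \<Rightarrow> nat \<Rightarrow> exp" where
  "flip_exp ru ri = Op Equal (Op Equal (Mem (idx 2 ru 1 ri)) (Mem (idx 2 8 1 ri))) (Const 0)"

text \<open>The table row is the code of the remaining set without the candidate in register 15, so
  removing the candidate is a subtraction of its power of two; the column is the candidate
  itself.\<close>

definition cost_exp :: exp where
  "cost_exp = Op Add (Mem (idx 3 10 1 15))
     (Mem (Op Add (Reg 7) (Op Add (Op Mul (Op Sub (Reg 11) (Mem (idx1 6 15))) (Reg 1)) (Reg 15))))"

lemma exp_costs [simp]: "exp_cost (flip_exp ru ri) = 19" "exp_cost cost_exp = 22"
  by (simp_all add: flip_exp_def cost_exp_def)

definition prepare :: com where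
  "prepare = Seq (Assign 2 (Op Mul (Reg 0) (Reg 0)))
     (Seq (Assign 3 (Op Add (Reg 2) (Op Mul (Reg 0) (Reg 1))))
     (Seq (Assign 4 (Op Add (Reg 3) (Op Add (Op Mul (Reg 1) (Reg 1)) (Reg 1))))
     (Seq (Assign 5 (Op Add (Reg 4) (Reg 1)))
     (Seq (Assign 6 (Op Add (Reg 5) (Reg 1)))
     (Seq (Assign 7 (Op Add (Reg 6) (Reg 1)))
     (Assign 9 (Const 1)))))))"

text \<open>Any vertex of degree \<open>k\<close> can serve as the base; the last one found is
  kept.\<close>

definition find_base :: com where
  "find_base = For 16 0 0 (Seq (Assign 19 (Const 0))
     (Seq (For 17 0 0 (Assign 19 (Op Add (Reg 19) (Mem (Op Add (Op Mul (Reg 16) (Reg 0)) (Reg 17))))))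
     (Cond (Op Equal (Reg 19) (Reg 1)) (Assign 8 (Reg 16)) Skip)))"

text \<open>Each vertex marks all pairs of coordinates in its label. The order of
  \<open>n * k * k\<close> steps fits the time bound because \<open>k < n\<close> and
  \<open>q \<ge> 2\<close>, so that \<open>n ^ 3\<close> is at most
  \<open>n ^ (q + 1)\<close>.\<close>

definition adjacency :: com where
  "adjacency = For 16 0 0 (For 17 0 1 (Cond (flip_exp 16 17)
     (For 15 0 1 (Cond (flip_exp 16 15) (Store (idx 3 17 1 15) (Const 1)) Skip)) Skip))"

text \<open>
  This serves for both orders.  Before the tables are filled, the powers of two and the
  estimates read as zero, so every set has code zero and the choice is greedy.  A vertex is
  placed if its mark has reached the value of register 9, which is \<open>1\<close> in the first run and
  \<open>2 ^ k\<close> in the second; so the marks need not be cleared.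
\<close>

definition order_com :: com where
  "order_com = Seq (Assign 10 (Reg 1)) (Seq (Assign 11 (Op Sub (Reg 9) (Const 1))) (Seq (Assign 12 (Const 0))
     (For 16 0 1 (Seq (scan (Op Less (Mem (idx1 4 15)) (Reg 9)) cost_exp)
       (Seq (Assign 12 (Op Add (Reg 12) (Mem (idx 3 10 1 14))))
       (Seq (Store (idx1 5 14) (Op Add (Reg 16) (Reg 12)))
       (Seq (Store (idx1 4 14) (Reg 9))
       (Seq (Assign 11 (Op Sub (Reg 11) (Mem (idx1 6 14))))
       (Assign 10 (Reg 14))))))))))"

text \<open>Removing an element lowers the code of a set, so counting codes upwards meets every
  entry after those it depends on. The loop starts at 1: the row of the empty set is zero, as is the
  untouched memory. The loop counters are registers 11 and 10, from which \<open>cost_exp\<close>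
  takes the set and the predecessor.\<close>

definition fill :: com where
  "fill = Seq (Assign 9 (Const 1))
     (Seq (For 16 0 1 (Seq (Store (idx1 6 16) (Reg 9)) (Assign 9 (Op Add (Reg 9) (Reg 9)))))
     (For 11 1 9 (For 10 0 1
       (Seq (scan (Op Mod (Op Div (Reg 11) (Mem (idx1 6 15))) (Const 2)) cost_exp)
       (Store (idx 7 11 1 10) (Reg 13))))))"

text \<open>Only the positions of coordinates are written; the columns of separators rely on zeros
  in the untouched memory behind the table.\<close>

definition emit :: com where
  "emit = Seq (Assign 12 (Op Add (Reg 1) (Reg 12)))
     (Seq (Assign 13 (Op Add (Reg 7) (Op Mul (Reg 9) (Reg 1))))
     (Seq (For 16 0 0 (For 17 0 1
        (Store (Op Add (Reg 13) (Op Add (Op Mul (Reg 16) (Reg 12)) (Mem (idx1 5 17)))) (flip_exp 16 17))))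
     (Seq (Assign 0 (Reg 12)) (Assign 1 (Reg 13)))))"

text \<open>\<open>E\<close> and \<open>b\<close> are the adjacency matrix and the bits of
  \<open>\<phi>\<close>. \<open>M\<close> bounds the memory from the table of estimates on, output
  included, so \<open>room\<close> says that no address in use wraps around modulo
  \<open>2 ^ w\<close>.\<close>

locale machine =
  fixes w n k M :: nat and E b :: "nat \<Rightarrow> nat \<Rightarrow> bool"
  assumes w: "0 < w"
    and room: "n * n + n * k + (k * k + k) + k + k + k + M < 2 ^ w"
    and M: "k + 2 \<le> M"
begin

definition "b2 = n * n + n * k"
definition "b3 = b2 + (k * k + k)"
definition "b4 = b3 + k"
definition "b5 = b4 + k"
definition "b6 = b5 + k"

lemmas b_defs = b6_def b5_def b4_def b3_def b2_def

lemma one_less_word: "(1 :: nat) < 2 ^ w"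
  by (rule one_less_power) (use w in simp_all)

definition inp :: "nat \<Rightarrow> nat" where
  "inp a = (if a < n * n then of_bool (E (a div n) (a mod n))
            else of_bool (b ((a - n * n) div k) ((a - n * n) mod k)))"

lemma inp_simps:
  "u < n \<Longrightarrow> v < n \<Longrightarrow> inp (u * n + v) = of_bool (E u v)"
  "i < k \<Longrightarrow> inp (n * n + (u * k + i)) = of_bool (b u i)"
  using index_less[of u n v n] by (auto simp: inp_def)

text \<open>Memory as a concatenation of blocks, each given by its own function: a write becomes an
  update of one of them, and the disjointness of the blocks is settled once and for all.\<close>

definition lay :: "(nat \<Rightarrow> nat) \<Rightarrow> (nat \<Rightarrow> nat) \<Rightarrow> (nat \<Rightarrow> nat) \<Rightarrow> (nat \<Rightarrow> nat) \<Rightarrow> (nat \<Rightarrow> nat) \<Rightarrow> nat \<Rightarrow> nat" where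
  "lay A U P W D a = (if a < b2 then inp a else if a < b3 then A (a - b2) else if a < b4 then U (a - b3)
     else if a < b5 then P (a - b4) else if a < b6 then W (a - b5) else D (a - b6))"

lemma lay_read:
  "a < b2 \<Longrightarrow> lay A U P W D a = inp a"
  "x < k * k + k \<Longrightarrow> lay A U P W D (b2 + x) = A x"
  "x < k \<Longrightarrow> lay A U P W D (b3 + x) = U x"
  "x < k \<Longrightarrow> lay A U P W D (b4 + x) = P x"
  "x < k \<Longrightarrow> lay A U P W D (b5 + x) = W x"
  "lay A U P W D (b6 + x) = D x"
  by (auto simp: lay_def b_defs)

lemma lay_write:
  "x < k * k + k \<Longrightarrow> (lay A U P W D)(b2 + x := v) = lay (A(x := v)) U P W D"
  "x < k \<Longrightarrow> (lay A U P W D)(b3 + x := v) = lay A (U(x := v)) P W D"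
  "x < k \<Longrightarrow> (lay A U P W D)(b4 + x := v) = lay A U (P(x := v)) W D"
  "x < k \<Longrightarrow> (lay A U P W D)(b5 + x := v) = lay A U P (W(x := v)) D"
  "(lay A U P W D)(b6 + x := v) = lay A U P W (D(x := v))"
  by (rule ext, auto simp: lay_def b_defs)+

definition base :: "state \<Rightarrow> bool" where
  "base s \<longleftrightarrow> regs s 0 = n \<and> regs s (Suc 0) = k \<and> regs s 2 = n * n \<and> regs s 3 = b2 \<and> regs s 4 = b3 \<and>
    regs s 5 = b4 \<and> regs s 6 = b5 \<and> regs s 7 = b6"

lemma base_same: "base s \<Longrightarrow> same R s s' \<Longrightarrow> R \<inter> {0..7} = {} \<Longrightarrow> base s'"
proof -
  assume *: "base s" "same R s s'" "R \<inter> {0..7} = {}"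
  have "regs s' x = regs s x" if "x \<le> 7" for x using * that by (auto simp: same_def disjoint_iff)
  then show ?thesis using *(1) by (simp add: base_def)
qed

lemma baseD:
  assumes "base s"
  shows "regs s 0 = n" "regs s 1 = k" "regs s (Suc 0) = k" "regs s 2 = n * n" "regs s 3 = b2"
    "regs s 4 = b3" "regs s 5 = b4" "regs s 6 = b5" "regs s 7 = b6"
  using assms by (auto simp: base_def)

lemma word_bounds: "n < 2 ^ w" "k < 2 ^ w" "n * n < 2 ^ w" "b2 < 2 ^ w" "b3 < 2 ^ w" "b4 < 2 ^ w" "b5 < 2 ^ w" "b6 < 2 ^ w"
  "k + 2 < 2 ^ w" "x < b6 \<Longrightarrow> x < 2 ^ w" "y \<le> M \<Longrightarrow> b6 + y < 2 ^ w"
proof -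
  have "n \<le> n * n" by simp
  then show "n < 2 ^ w" using room by linarith
qed (use room M in \<open>auto simp: b_defs\<close>)

lemma runs_prepare:
  assumes "regs s = (\<lambda>_. 0)(0 := n, 1 := k)"
    and Q: "\<And>s'. base s' \<Longrightarrow> regs s' 9 = 1 \<Longrightarrow> mem s' = mem s \<Longrightarrow> Q s'"
  shows "runs w prepare s (max_cost prepare) Q"
proof (rule runs_loop_free)
  show "Q (result w prepare s)"
  proof (rule Q)
    show "base (result w prepare s)"
      using word_bounds assms(1) by (simp add: prepare_def base_def mod_simps b_defs add.assoc)
  qed (use w in \<open>simp_all add: prepare_def\<close>)
qed (simp add: prepare_def)

lemma address_less:
  "u < n \<Longrightarrow> v < n \<Longrightarrow> u * n + v < 2 ^ w"
  "u < n \<Longrightarrow> i < k \<Longrightarrow> n * n + (u * k + i) < b2"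
  "v \<le> k \<Longrightarrow> i < k \<Longrightarrow> v * k + i < k * k + k"
proof -
  show "u < n \<Longrightarrow> v < n \<Longrightarrow> u * n + v < 2 ^ w" using index_less[of u n v n] word_bounds(3) by linarith
  show "u < n \<Longrightarrow> i < k \<Longrightarrow> n * n + (u * k + i) < b2" using index_less[of u n i k] by (simp add: b2_def)
  show "v \<le> k \<Longrightarrow> i < k \<Longrightarrow> v * k + i < k * k + k" using index_less[of v "Suc k" i k] by simp
qed

lemma eval_flip:
  assumes s: "base s" "mem s = lay A U P W D" "regs s 8 = z" "z < n"
    and u: "regs s ru = u" "u < n" and i: "regs s ri = i" "i < k"
  shows "eval_exp w (flip_exp ru ri) s = of_bool (b z i \<noteq> b u i)"
proof -
  have a: "eval_exp w (idx 2 ru 1 ri) s = n * n + (u * k + i)" "eval_exp w (idx 2 8 1 ri) s = n * n + (z * k + i)"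
    using address_less(2)[OF u(2) i(2)] address_less(2)[OF s(4) i(2)] word_bounds(4) baseD[OF s(1)] s(3) u i
    by (simp_all add: eval_idx)
  have m: "eval_exp w (Mem (idx 2 ru 1 ri)) s = of_bool (b u i)" "eval_exp w (Mem (idx 2 8 1 ri)) s = of_bool (b z i)"
    using address_less(2)[OF u(2) i(2)] address_less(2)[OF s(4) i(2)] i one_less_word w
    unfolding eval_exp.simps(3) a by (simp_all add: s(2) lay_read inp_simps of_bool_def)
  show ?thesis unfolding flip_exp_def eval_exp.simps(4) m using one_less_word w by (auto simp: of_bool_def)
qed

section \<open>Base vertex and adjacency of the coordinates\<close>

definition deg :: "nat \<Rightarrow> nat" where
  "deg u = card {v. v < n \<and> E u v}"

lemma runs_find_base:
  assumes s: "base s" "mem s = lay A U P W D"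
    and ex: "\<exists>z<n. deg z = k"
    and Q: "\<And>s'. same {8,16,17,19} s s' \<Longrightarrow> mem s' = mem s \<Longrightarrow> regs s' 8 < n \<Longrightarrow>
      deg (regs s' 8) = k \<Longrightarrow> Q s'"
  shows "runs w find_base s (6 + n * (2 + (6 + n * 17 + 8) + 8)) Q"
proof -
  define I where "I i s' \<longleftrightarrow> same {8,16,17,19} s s' \<and> mem s' = mem s \<and>
    ((\<exists>u<i. deg u = k) \<longrightarrow> regs s' 8 < n \<and> deg (regs s' 8) = k)" for i s'
  define J where "J u s0 j s' \<longleftrightarrow> same {17,19} s0 s' \<and> mem s' = mem s \<and> base s' \<and> regs s' 16 = u \<and>
    regs s' 19 = card {v. v < j \<and> E u v}" for u s0 j s'
  have J_body: "runs w (Assign 19 (Op Add (Reg 19) (Mem (Op Add (Op Mul (Reg 16) (Reg 0)) (Reg 17))))) s'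
       9 (\<lambda>s'. regs s' 17 = j \<and> J u s0 (Suc j) (s'\<lparr>regs := (regs s')(17 := Suc j)\<rparr>))"
    if u: "u < n" and j: "j < n" and J: "J u s0 j s'" "regs s' 17 = j" for u s0 j s'
  proof -
    have s': "base s'" "regs s' 16 = u" "regs s' 19 = card {v. v < j \<and> E u v}" "mem s' = lay A U P W D"
      using J s(2) by (auto simp: J_def)
    have "u * n + j < b2" using index_less[OF u j] by (simp add: b2_def)
    then have rd: "lay A U P W D (u * n + j) = of_bool (E u j)"
      using inp_simps(1)[OF u j] by (simp add: lay_read)
    have addr: "eval_exp w (Op Add (Op Mul (Reg 16) (Reg 0)) (Reg 17)) s' = u * n + j"
      using address_less(1)[OF u j] s' baseD[OF s'(1)] J(2) by (simp add: mod_simps)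
    have set: "{v. v < Suc j \<and> E u v} = (if E u j then insert j {v. v < j \<and> E u v} else {v. v < j \<and> E u v})"
      by (auto simp: less_Suc_eq)
    have c: "card {v. v < Suc j \<and> E u v} = card {v. v < j \<and> E u v} + of_bool (E u j)"
      unfolding set by simp
    have "card {v. v < Suc j \<and> E u v} \<le> Suc j"
      using card_mono[of "{..<Suc j}" "{v. v < Suc j \<and> E u v}"] by auto
    then have le: "card {v. v < j \<and> E u v} + of_bool (E u j) < 2 ^ w"
      using c j word_bounds(1) by linarith
    have val: "eval_exp w (Op Add (Reg 19) (Mem (Op Add (Op Mul (Reg 16) (Reg 0)) (Reg 17)))) s'
        = card {v. v < Suc j \<and> E u v}"
      unfolding eval_exp.simps(3) eval_exp.simps(4)[of _ _ "Reg 19"] addr using s' rd le c by (simp add: mod_simps)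
    have base': "base (s'\<lparr>regs := (regs s')(19 := x, 17 := y)\<rparr>)" for x y
      by (rule base_same[OF s'(1), of "{17,19}"]) auto
    show ?thesis
    proof (rule runs_loop_free_le)
      show "regs (result w (Assign 19 (Op Add (Reg 19) (Mem (Op Add (Op Mul (Reg 16) (Reg 0)) (Reg 17))))) s') 17 = j \<and>
        J u s0 (Suc j) (result w (Assign 19 (Op Add (Reg 19) (Mem (Op Add (Op Mul (Reg 16) (Reg 0)) (Reg 17))))) s'
           \<lparr>regs := (regs (result w (Assign 19 (Op Add (Reg 19) (Mem (Op Add (Op Mul (Reg 16) (Reg 0)) (Reg 17))))) s'))(17 := Suc j)\<rparr>)"
        unfolding result.simps(1) val using J base' by (simp add: J_def)
    qed simp_all
  qed
  show ?thesis
    unfolding find_base_def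
  proof (rule runs_For[where I = I])
    show "n < 2 ^ w" by (rule word_bounds)
    show "0 < w" by (rule w)
    show "I 0 (s\<lparr>regs := (regs s)(16 := 0)\<rparr>)" by (simp add: I_def)
    show "regs s' 0 = n" if "I i s'" for i s'
      using that s(1) by (auto simp: I_def base_def same_def)
    show "Q s'" if "I n s'" for s'
      using that ex by (intro Q) (auto simp: I_def)
    fix i s' assume i: "0 \<le> i" "i < n" "I i s'" "regs s' 16 = i"
    have b': "base s'" using i s(1) base_same by (auto simp: I_def)
    let ?s0 = "s'\<lparr>regs := (regs s')(19 := 0)\<rparr>"
    have base0: "base (s'\<lparr>regs := (regs s')(19 := x, 17 := y)\<rparr>)" for x y
      by (rule base_same[OF b', of "{17,19}"]) auto
    show "runs w (Seq (Assign 19 (Const 0))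
     (Seq (For 17 0 0 (Assign 19 (Op Add (Reg 19) (Mem (Op Add (Op Mul (Reg 16) (Reg 0)) (Reg 17))))))
     (Cond (Op Equal (Reg 19) (Reg 1)) (Assign 8 (Reg 16)) Skip))) s' (2 + (6 + n * 17 + 8))
      (\<lambda>s'. regs s' 16 = i \<and> I (Suc i) (s'\<lparr>regs := (regs s')(16 := Suc i)\<rparr>))"
    proof (rule runs_mono[OF runs_Seq_loop_free[OF _ runs_Seq[OF runs_For[where I = "J i ?s0" and N = n and T = 9]]]])
      show "loop_free (Assign 19 (Const 0))" "n < 2 ^ w" "0 < w" using word_bounds w by simp_all
      show "J i ?s0 0 (result w (Assign 19 (Const 0)) s'\<lparr>regs := (regs (result w (Assign 19 (Const 0)) s'))(17 := 0)\<rparr>)"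
        using i base0 by (simp add: J_def I_def)
      show "regs s1 0 = n" if "J i ?s0 j s1" for j s1 using that by (simp add: J_def base_def)
      show "runs w (Assign 19 (Op Add (Reg 19) (Mem (Op Add (Op Mul (Reg 16) (Reg 0)) (Reg 17))))) s1
       9 (\<lambda>s'. regs s' 17 = j \<and> J i ?s0 (Suc j) (s'\<lparr>regs := (regs s')(17 := Suc j)\<rparr>))"
        if "0 \<le> j" "j < n" "J i ?s0 j s1" "regs s1 17 = j" for j s1
        by (rule J_body) (use i that in auto)
      fix s1 assume J: "J i ?s0 n s1"
      let ?c = "Cond (Op Equal (Reg 19) (Reg 1)) (Assign 8 (Reg 16)) Skip"
      have d: "regs s1 19 = deg i" "regs s1 16 = i" "base s1" "mem s1 = mem s" "same {17,19} ?s0 s1"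
        using J by (auto simp: J_def deg_def)
      have le: "deg i \<le> n" using card_mono[of "{..<n}" "{v. v < n \<and> E i v}"] by (auto simp: deg_def)
      have eq: "eval_exp w (Op Equal (Reg 19) (Reg 1)) s1 \<noteq> 0 \<longleftrightarrow> deg i = k"
        using d baseD[OF d(3)] le word_bounds(1,2) one_less_word w by simp
      have "same {8,16,17,19} s' ?s0" by simp
      then have s1: "same {8,16,17,19} s s1" "regs s1 8 = regs s' 8"
        using i d(5) same_trans[of "{8,16,17,19}" s s' "{8,16,17,19}" s1 "{8,16,17,19}"]
          same_trans[of "{8,16,17,19}" s' ?s0 "{17,19}" s1 "{8,16,17,19}"]
        by (auto simp: I_def same_def)
      have i_mod: "i mod 2 ^ w = i" using i word_bounds(1) by simp
      have "I (Suc i) (s1\<lparr>regs := (regs s1)(8 := i, 16 := Suc i)\<rparr>)" if "deg i = k"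
        using i d s1 that by (auto simp: I_def)
      moreover have "I (Suc i) (s1\<lparr>regs := (regs s1)(16 := Suc i)\<rparr>)" if "deg i \<noteq> k"
        using i d s1 that by (auto simp: I_def less_Suc_eq)
      ultimately have res: "regs (result w ?c s1) 16 = i \<and>
          I (Suc i) (result w ?c s1\<lparr>regs := (regs (result w ?c s1))(16 := Suc i)\<rparr>)"
        unfolding result.simps(4) using eq d i_mod by auto
      show "runs w ?c s1 8 (\<lambda>s'. regs s' 16 = i \<and> I (Suc i) (s'\<lparr>regs := (regs s')(16 := Suc i)\<rparr>))"
        by (rule runs_loop_free_le) (use res in simp_all)
    qed simp_all
  qed simp_all
qed

end

lemma eval_Sub:
  assumes "eval_exp w e1 s = x" "eval_exp w e2 s = y" "y \<le> x" "x < 2 ^ w"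
  shows "eval_exp w (Op Sub e1 e2) s = x - y"
proof -
  have "(int x - int y) mod 2 ^ w = int ((x - y) mod 2 ^ w)"
    using assms(3) by (simp add: of_nat_diff zmod_int)
  then show ?thesis using assms by simp
qed

context machine
begin

lemma runs_adjacency:
  fixes z
  defines "F \<equiv> \<lambda>u i. b z i \<noteq> b u i"
  assumes s: "base s" "mem s = lay (\<lambda>_. 0) U P W D" "regs s 8 = z" "z < n"
    and Q: "\<And>s' A. same {15,16,17} s s' \<Longrightarrow> mem s' = lay A U P W D \<Longrightarrow>
      table (Suc k) k (\<lambda>i j. i < k \<and> (\<exists>u<n. F u i \<and> F u j)) A \<Longrightarrow> Q s'"
  shows "runs w adjacency s (6 + n * (6 + k * (20 + (6 + k * (30 + 8)) + 8) + 8)) Q"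
proof -
  define G where "G R s' \<longleftrightarrow> same {15,16,17} s s' \<and> (\<exists>A. mem s' = lay A U P W D \<and> table (Suc k) k R A)" for R s'
  have G_upd: "G R (s'\<lparr>regs := (regs s')(x := v)\<rparr>)" if "G R s'" "x \<in> {15,16,17}" for R s' x v
    using that by (auto simp: G_def)
  have G_cong: "G R' s'" if "G R s'" "\<And>i j. i \<le> k \<Longrightarrow> j < k \<Longrightarrow> R i j \<longleftrightarrow> R' i j" for R R' s'
    using that table_cong[of "Suc k" k R _ R'] by (auto simp: G_def)
  have G_base: "base s'" "regs s' 8 = z" if "G R s'" for R s'
  proof -
    have "same {15,16,17} s s'" using that by (simp add: G_def)
    then show "base s'" "regs s' 8 = z" using base_same[OF s(1), of "{15,16,17}" s'] s(3) sameD by auto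
  qed
  have G_flip: "eval_exp w (flip_exp ru ri) s' = of_bool (F u i)"
    if "G R s'" "regs s' ru = u" "u < n" "regs s' ri = i" "i < k" for R s' ru ri u i
    using that G_base[OF that(1)] eval_flip[of s' _ U P W D z ru u ri i] s(4) unfolding G_def F_def by blast
  \<comment> \<open>The pairs marked so far: by vertices below \<open>u\<close>, then also by
    \<open>u\<close> in rows below \<open>i\<close>, then also in row \<open>i\<close> in columns
    below \<open>j\<close>. All rows involved are below \<open>k\<close>, so the dummy row stays
    zero.\<close>
  define R1 where "R1 u = (\<lambda>i j. i < k \<and> (\<exists>v<u. F v i \<and> F v j))" for u
  define R2 where "R2 u i = (\<lambda>i' j'. R1 u i' j' \<or> i' < i \<and> F u i' \<and> F u j')" for u i
  define R3 where "R3 u i j = (\<lambda>i' j'. R2 u i i' j' \<or> i' = i \<and> j' < j \<and> F u i' \<and> F u j')" for u i j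
  let ?c4 = "Cond (flip_exp 16 15) (Store (idx 3 17 1 15) (Const 1)) Skip"
  let ?c3 = "For 15 0 1 ?c4"
  let ?c2 = "Cond (flip_exp 16 17) ?c3 Skip"
  let ?c1 = "For 17 0 1 ?c2"
  have c4: "runs w ?c4 s' 30 (\<lambda>s'. regs s' 15 = j \<and>
      (G (R3 u i (Suc j)) (s'\<lparr>regs := (regs s')(15 := Suc j)\<rparr>) \<and>
       regs (s'\<lparr>regs := (regs s')(15 := Suc j)\<rparr>) 16 = u \<and> regs (s'\<lparr>regs := (regs s')(15 := Suc j)\<rparr>) 17 = i))"
    if u: "u < n" and i: "i < k" and j: "j < k" and Fi: "F u i"
      and s': "G (R3 u i j) s'" "regs s' 16 = u" "regs s' 17 = i" "regs s' 15 = j" for u i j s'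
  proof (rule runs_loop_free_le)
    have ev: "eval_exp w (flip_exp 16 15) s' = of_bool (F u j)"
      using G_flip[OF s'(1,2) u s'(4) j] .
    have less: "i * k + j < k * k + k" using address_less(3)[of i j] i j by simp
    then have "b2 + (i * k + j) < 2 ^ w" by (intro word_bounds(10)) (simp add: b_defs)
    then have addr: "eval_exp w (idx 3 17 1 15) s' = b2 + (i * k + j)"
      using s' baseD[OF G_base(1)[OF s'(1)]] by (simp add: eval_idx)
    have const: "eval_exp w (Const 1) s' = 1" using w by simp
    have R3_Suc: "R3 u i (Suc j) i' j' \<longleftrightarrow> (if i' = i \<and> j' = j then F u j \<or> R3 u i j i' j' else R3 u i j i' j')" for i' j'
      using Fi by (auto simp: R3_def less_Suc_eq)
    have G1: "G (R3 u i (Suc j)) (result w ?c4 s')"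
    proof (cases "F u j")
      case True
      obtain A where A: "mem s' = lay A U P W D" "table (Suc k) k (R3 u i j) A"
        using s'(1) by (auto simp: G_def)
      have "table (Suc k) k (R3 u i (Suc j)) (A(i * k + j := of_bool True))"
        by (rule table_update[OF A(2)]) (use i j True R3_Suc in auto)
      moreover have "result w ?c4 s' = s'\<lparr>mem := lay (A(i * k + j := of_bool True)) U P W D\<rparr>"
        unfolding result.simps ev addr const A(1) lay_write(1)[OF less] using True by simp
      ultimately show ?thesis using s'(1) unfolding G_def by auto
    next
      case False
      then have "result w ?c4 s' = s'" unfolding result.simps ev by simp
      then show ?thesis using G_cong[OF s'(1)] R3_Suc False by simp
    qed
    moreover have "regs (result w ?c4 s') = regs s'" by simp
    ultimately show "regs (result w ?c4 s') 15 = j \<and>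
      (G (R3 u i (Suc j)) (result w ?c4 s'\<lparr>regs := (regs (result w ?c4 s'))(15 := Suc j)\<rparr>) \<and>
       regs (result w ?c4 s'\<lparr>regs := (regs (result w ?c4 s'))(15 := Suc j)\<rparr>) 16 = u \<and>
       regs (result w ?c4 s'\<lparr>regs := (regs (result w ?c4 s'))(15 := Suc j)\<rparr>) 17 = i)"
      using s' G_upd[OF G1, of 15 "Suc j"] by (simp del: result.simps)
  qed simp_all
  have c2: "runs w ?c2 s' (20 + (6 + k * (30 + 8))) (\<lambda>s'. regs s' 17 = i \<and>
      (G (R2 u (Suc i)) (s'\<lparr>regs := (regs s')(17 := Suc i)\<rparr>) \<and>
       regs (s'\<lparr>regs := (regs s')(17 := Suc i)\<rparr>) 16 = u))"
    if u: "u < n" and i: "i < k" and s': "G (R2 u i) s'" "regs s' 16 = u" "regs s' 17 = i" for u i s'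
  proof -
    have ev: "eval_exp w (flip_exp 16 17) s' = of_bool (F u i)"
      using G_flip[OF s'(1,2) u s'(3) i] .
    have "runs w ?c2 s' (1 + exp_cost (flip_exp 16 17) + (6 + k * (30 + 8))) (\<lambda>s'. regs s' 17 = i \<and>
      (G (R2 u (Suc i)) (s'\<lparr>regs := (regs s')(17 := Suc i)\<rparr>) \<and>
       regs (s'\<lparr>regs := (regs s')(17 := Suc i)\<rparr>) 16 = u))"
    proof (rule runs_Cond)
      assume "eval_exp w (flip_exp 16 17) s' \<noteq> 0"
      then have Fi: "F u i" using ev by simp
      show "runs w ?c3 s' (6 + k * (30 + 8)) (\<lambda>s'. regs s' 17 = i \<and>
        (G (R2 u (Suc i)) (s'\<lparr>regs := (regs s')(17 := Suc i)\<rparr>) \<and>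
         regs (s'\<lparr>regs := (regs s')(17 := Suc i)\<rparr>) 16 = u))"
      proof (rule runs_For[where I = "\<lambda>j s'. G (R3 u i j) s' \<and> regs s' 16 = u \<and> regs s' 17 = i"])
        have "G (R3 u i 0) s'" using s'(1) by (rule G_cong) (simp add: R3_def)
        then show "G (R3 u i 0) (s'\<lparr>regs := (regs s')(15 := 0)\<rparr>) \<and>
          regs (s'\<lparr>regs := (regs s')(15 := 0)\<rparr>) 16 = u \<and> regs (s'\<lparr>regs := (regs s')(15 := 0)\<rparr>) 17 = i"
          using s' G_upd by simp
        show "regs s1 1 = k" if "G (R3 u i j) s1 \<and> regs s1 16 = u \<and> regs s1 17 = i" for j s1
          using that G_base(1) baseD(2) by blast
        fix s1 assume s1: "G (R3 u i k) s1 \<and> regs s1 16 = u \<and> regs s1 17 = i"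
        have "G (R2 u (Suc i)) s1"
          by (rule G_cong[of "R3 u i k"]) (use s1 in \<open>auto simp: R3_def R2_def less_Suc_eq\<close>)
        then show "regs s1 17 = i \<and> (G (R2 u (Suc i)) (s1\<lparr>regs := (regs s1)(17 := Suc i)\<rparr>) \<and>
           regs (s1\<lparr>regs := (regs s1)(17 := Suc i)\<rparr>) 16 = u)"
          using s1 G_upd by simp
      qed (use c4[OF u i _ Fi] word_bounds(2) w in auto)
    next
      assume "eval_exp w (flip_exp 16 17) s' = 0"
      then have Fi: "\<not> F u i" using ev by simp
      have "G (R2 u (Suc i)) s'"
        by (rule G_cong[OF s'(1)]) (use Fi in \<open>auto simp: R2_def less_Suc_eq\<close>)
      then show "runs w Skip s' (6 + k * (30 + 8)) (\<lambda>s'. regs s' 17 = i \<and>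
        (G (R2 u (Suc i)) (s'\<lparr>regs := (regs s')(17 := Suc i)\<rparr>) \<and>
         regs (s'\<lparr>regs := (regs s')(17 := Suc i)\<rparr>) 16 = u))"
        by (intro runs_loop_free_le) (use s' G_upd in simp_all)
    qed
    then show ?thesis by simp
  qed
  have c1: "runs w ?c1 s' (6 + k * (20 + (6 + k * (30 + 8)) + 8)) (\<lambda>s'. regs s' 16 = u \<and>
      G (R1 (Suc u)) (s'\<lparr>regs := (regs s')(16 := Suc u)\<rparr>))"
    if u: "u < n" and s': "G (R1 u) s'" "regs s' 16 = u" for u s'
  proof (rule runs_For[where I = "\<lambda>i s'. G (R2 u i) s' \<and> regs s' 16 = u"])
    have "G (R2 u 0) s'" using s'(1) by (rule G_cong) (simp add: R2_def)
    then show "G (R2 u 0) (s'\<lparr>regs := (regs s')(17 := 0)\<rparr>) \<and> regs (s'\<lparr>regs := (regs s')(17 := 0)\<rparr>) 16 = u"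
      using s' G_upd by simp
    show "regs s1 1 = k" if "G (R2 u i) s1 \<and> regs s1 16 = u" for i s1
      using that G_base(1) baseD(2) by blast
    fix s1 assume s1: "G (R2 u k) s1 \<and> regs s1 16 = u"
    have "G (R1 (Suc u)) s1"
      by (rule G_cong[of "R2 u k"]) (use s1 in \<open>auto simp: R2_def R1_def less_Suc_eq\<close>)
    then show "regs s1 16 = u \<and> G (R1 (Suc u)) (s1\<lparr>regs := (regs s1)(16 := Suc u)\<rparr>)"
      using s1 G_upd by simp
  qed (use c2[OF u] word_bounds(2) w in auto)
  show ?thesis unfolding adjacency_def
  proof (rule runs_For[where I = "\<lambda>u s'. G (R1 u) s'"])
    have "G (R1 0) s" using s by (auto simp: G_def R1_def table_def intro!: exI[of _ "\<lambda>_. 0"])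
    then show "G (R1 0) (s\<lparr>regs := (regs s)(16 := 0)\<rparr>)" using G_upd by simp
    show "regs s1 0 = n" if "G (R1 u) s1" for u s1 using that G_base(1) baseD(1) by blast
    show "Q s1" if "G (R1 n) s1" for s1 using that Q unfolding G_def R1_def by blast
  qed (use c1 word_bounds(1) w in auto)
qed

section \<open>One run of the ordering loop\<close>

lemma eval_cost_exp:
  assumes s: "base s" "mem s = lay A U P W D" and A: "table (Suc k) k R A"
    and r: "regs s 10 = v" "v \<le> k" "regs s 11 = S" "S < 2 ^ w" "regs s 15 = u" "u < k"
    and W: "W u \<le> S" and D: "(S - W u) * k + u \<le> M" "D ((S - W u) * k + u) = g" "g \<le> k"
  shows "eval_exp w cost_exp s = of_bool (R v u) + g"
proof -
  note reg = baseD[OF s(1)] r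
  have less: "v * k + u < k * k + k" using address_less(3)[of v u] r by simp
  then have "b2 + (v * k + u) < 2 ^ w" by (intro word_bounds(10)) (simp add: b_defs)
  then have a1: "eval_exp w (idx 3 10 1 15) s = b2 + (v * k + u)" using reg by (simp add: eval_idx)
  have "A (v * k + u) = of_bool (R v u)" using tableD[OF A, of v u] r by simp
  then have m1: "eval_exp w (Mem (idx 3 10 1 15)) s = of_bool (R v u)"
    unfolding eval_exp.simps(3) a1 s(2) lay_read(2)[OF less] using w by (simp add: of_bool_def)
  have "b5 + u < 2 ^ w" using r(6) by (intro word_bounds(10)) (simp add: b_defs)
  then have a2: "eval_exp w (idx1 6 15) s = b5 + u" using reg by (simp add: eval_idx)
  have m2: "eval_exp w (Mem (idx1 6 15)) s = W u"
    unfolding eval_exp.simps(3) a2 s(2) lay_read(5)[OF r(6)] using W r(4) by simp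
  have sub: "eval_exp w (Op Sub (Reg 11) (Mem (idx1 6 15))) s = S - W u"
    by (rule eval_Sub[OF _ m2 W r(4)]) (use r in simp)
  have "b6 + ((S - W u) * k + u) < 2 ^ w" by (rule word_bounds(11)) (rule D)
  then have a3: "eval_exp w (Op Add (Reg 7) (Op Add (Op Mul (Op Sub (Reg 11) (Mem (idx1 6 15))) (Reg 1)) (Reg 15))) s
      = b6 + ((S - W u) * k + u)"
    unfolding eval_exp.simps(4)[of w Add] eval_exp.simps(4)[of w Mul] sub using reg by (simp add: mod_simps)
  have m3: "eval_exp w (Mem (Op Add (Reg 7) (Op Add (Op Mul (Op Sub (Reg 11) (Mem (idx1 6 15))) (Reg 1)) (Reg 15)))) s = g"
    unfolding eval_exp.simps(3)[of w "Op Add (Reg 7) _"] a3 s(2) lay_read(6) D(2) using D(3) word_bounds(2) by simp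
  have "of_bool (R v u) + g < 2 ^ w" using D(3) word_bounds(9) by (simp add: of_bool_def)
  then show ?thesis unfolding cost_exp_def eval_exp.simps(4)[of w Add] m1 m3 by simp
qed

text \<open>Marks, codes and estimates are parameters so that both runs are instances:
  \<open>F = 1\<close>, constant code 0 and zero estimates for the greedy order;
  \<open>F = 2 ^ k\<close>, \<open>set_encode\<close> and \<open>opt\<close> for the optimal one. In
  both cases \<open>F - 1\<close> is the code of the full set, with which register 11
  starts.\<close>

lemma runs_order:
  fixes code :: "nat set \<Rightarrow> nat"
  assumes s: "base s" "mem s = lay A U P W D" and A: "table (Suc k) k R A"
    and F: "regs s 9 = F" "0 < F" "F < 2 ^ w" "F * k \<le> M" and U: "\<And>u. u < k \<Longrightarrow> U u < F"
    and code_full: "code {..<k} = F - 1"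
    and code_less: "\<And>X. X \<subseteq> {..<k} \<Longrightarrow> code X < F"
    and code_diff: "\<And>X u. X \<subseteq> {..<k} \<Longrightarrow> u \<in> X \<Longrightarrow> W u \<le> code X \<and> code X - W u = code (X - {u})"
    and D: "\<And>X u. X \<subseteq> {..<k} \<Longrightarrow> u < k \<Longrightarrow> D (code X * k + u) = g X u"
    and g: "\<And>X u. X \<subseteq> {..<k} \<Longrightarrow> g X u \<le> k"
    and Q: "\<And>s' xs U' P'. same {10,11,12,13,14,15,16,18} s s' \<Longrightarrow> mem s' = lay A U' P' W D \<Longrightarrow>
      walk R g k xs \<Longrightarrow> length xs = k \<Longrightarrow> regs s' 12 = sep R (k # xs) \<Longrightarrow> (\<And>u. u < k \<Longrightarrow> U' u = F) \<Longrightarrow>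
      (\<And>t. t < k \<Longrightarrow> P' (xs ! t) = t + sep R (k # take (Suc t) xs)) \<Longrightarrow> Q s'"
  shows "runs w order_com s (2 + (4 + (2 + (6 + k * (10 + k * 48 + 32 + 8))))) Q"
proof -
  define I where "I t s' \<longleftrightarrow> same {10,11,12,13,14,15,16,18} s s' \<and> (\<exists>xs U' P'. walk R g k xs \<and> length xs = t \<and>
      mem s' = lay A U' P' W D \<and> (\<forall>u<k. if u \<in> set xs then U' u = F else U' u < F) \<and>
      (\<forall>t<length xs. P' (xs ! t) = t + sep R (k # take (Suc t) xs)) \<and>
      regs s' 10 = last (k # xs) \<and> regs s' 11 = code ({..<k} - set xs) \<and> regs s' 12 = sep R (k # xs))" for t s'
  have I_intro: "I t s'" if "same {10,11,12,13,14,15,16,18} s s'" "walk R g k xs" "length xs = t"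
      "mem s' = lay A U' P' W D" "\<forall>u<k. if u \<in> set xs then U' u = F else U' u < F"
      "\<forall>t<length xs. P' (xs ! t) = t + sep R (k # take (Suc t) xs)"
      "regs s' 10 = last (k # xs)" "regs s' 11 = code ({..<k} - set xs)" "regs s' 12 = sep R (k # xs)" for t s' xs U' P'
    unfolding I_def using that by blast
  let ?scan = "scan (Op Less (Mem (idx1 4 15)) (Reg 9)) cost_exp"
  let ?c = "Seq (Assign 12 (Op Add (Reg 12) (Mem (idx 3 10 1 14))))
       (Seq (Store (idx1 5 14) (Op Add (Reg 16) (Reg 12)))
       (Seq (Store (idx1 4 14) (Reg 9))
       (Seq (Assign 11 (Op Sub (Reg 11) (Mem (idx1 6 14))))
       (Assign 10 (Reg 14)))))"
  have body: "runs w (Seq ?scan ?c) s' (10 + k * 48 + 32)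
      (\<lambda>s'. regs s' 16 = t \<and> I (Suc t) (s'\<lparr>regs := (regs s')(16 := Suc t)\<rparr>))"
    if t: "t < k" and I: "I t s'" "regs s' 16 = t" for t s'
  proof -
    obtain xs U' P' where xs: "walk R g k xs" "length xs = t"
      and m: "mem s' = lay A U' P' W D" and U': "\<And>u. u < k \<Longrightarrow> if u \<in> set xs then U' u = F else U' u < F"
      and P': "\<And>t. t < length xs \<Longrightarrow> P' (xs ! t) = t + sep R (k # take (Suc t) xs)"
      and r: "regs s' 10 = last (k # xs)" "regs s' 11 = code ({..<k} - set xs)" "regs s' 12 = sep R (k # xs)"
      and sm: "same {10,11,12,13,14,15,16,18} s s'"
      using I(1) unfolding I_def by blast
    define X where "X = {..<k} - set xs"
    define v where "v = last (k # xs)"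
    define sp where "sp = sep R (k # xs)"
    have X: "X \<subseteq> {..<k}" by (auto simp: X_def)
    have dist: "distinct xs" "set xs \<subseteq> {..<k}" using walk_distinct[OF xs(1)] by auto
    have "card X = k - t" unfolding X_def using dist xs(2) distinct_card[of xs] by (simp add: card_Diff_subset)
    then have "X \<noteq> {}" using t by auto
    have v: "v \<le> k" unfolding v_def
      using dist(2) by (cases "xs = []") (simp, metis last.simps last_in_set lessThan_iff less_imp_le subsetD)
    have sp: "sp \<le> k" using sep_Cons[of R k xs] xs(2) t by (simp add: sp_def)
    have b': "base s'" "regs s' 9 = F" using base_same[OF s(1) sm] F(1) sm by (auto simp: same_def)
    have small_D: "code (Y - {u}) * k + u \<le> M" if "Y \<subseteq> {..<k}" "u < k" for Y u
    proof -
      have "code (Y - {u}) < F" using code_less[of "Y - {u}"] that by blast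
      then show ?thesis using index_less[of "code (Y - {u})" F u k] that F(4) by linarith
    qed
    have cost: "eval_exp w cost_exp s1 = step_cost R g X v (regs s1 15)"
      if s1: "same {13,14,15,18} s' s1" "mem s1 = mem s'" "regs s1 15 \<in> X" for s1
      unfolding step_cost_def
    proof (rule eval_cost_exp[OF _ _ A])
      have ux: "regs s1 15 < k" using s1(3) X by auto
      show "base s1" using base_same[OF b'(1) s1(1)] by simp
      show "mem s1 = lay A U' P' W D" using s1(2) m by simp
      show "regs s1 10 = v" "regs s1 11 = code X" using s1(1) r by (simp_all add: same_def v_def X_def)
      show "v \<le> k" "regs s1 15 = regs s1 15" "regs s1 15 < k" using v ux by simp_all
      show "code X < 2 ^ w" using code_less[OF X] F(3) by simp
      show "W (regs s1 15) \<le> code X" using code_diff[OF X s1(3)] by simp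
      have eq: "code X - W (regs s1 15) = code (X - {regs s1 15})" using code_diff[OF X s1(3)] by simp
      show "(code X - W (regs s1 15)) * k + regs s1 15 \<le> M" unfolding eq by (rule small_D[OF X ux])
      show "D ((code X - W (regs s1 15)) * k + regs s1 15) = g (X - {regs s1 15}) (regs s1 15)"
        unfolding eq using X by (intro D[OF _ ux]) auto
      show "g (X - {regs s1 15}) (regs s1 15) \<le> k" using X by (intro g) auto
    qed
    show ?thesis
    proof (rule runs_mono[OF runs_Seq[OF runs_scan[where X = X and c = "step_cost R g X v" and k = k]]])
      show "regs s' 1 = k" "k + 2 < 2 ^ w" "0 < w" "X \<subseteq> {..<k}"
        using baseD[OF b'(1)] word_bounds(9) w X by simp_all
      show "(eval_exp w (Op Less (Mem (idx1 4 15)) (Reg 9)) s1 \<noteq> 0) = (regs s1 15 \<in> X)"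
        if s1: "same {13,14,15,18} s' s1" "mem s1 = mem s'" "regs s1 15 < k" for s1
      proof -
        have b1: "base s1" "regs s1 9 = F" using base_same[OF b'(1) s1(1)] b'(2) s1(1) by (auto simp: same_def)
        have "b3 + regs s1 15 < 2 ^ w" using s1(3) by (intro word_bounds(10)) (simp add: b_defs)
        then have a: "eval_exp w (idx1 4 15) s1 = b3 + regs s1 15" using baseD[OF b1(1)] by (simp add: eval_idx)
        have le: "U' (regs s1 15) \<le> F" using U'[OF s1(3)] by (auto split: if_splits)
        have m1: "eval_exp w (Mem (idx1 4 15)) s1 = U' (regs s1 15)"
          unfolding eval_exp.simps(3) a s1(2) m lay_read(3)[OF s1(3)] using le F(3) by simp
        have "eval_exp w (Op Less (Mem (idx1 4 15)) (Reg 9)) s1 \<noteq> 0 \<longleftrightarrow> U' (regs s1 15) < F"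
          unfolding eval_exp.simps(4) m1 using b1(2) F(3) w by simp
        then show ?thesis using U'[OF s1(3)] s1(3) by (auto simp: X_def split: if_splits)
      qed
      show "eval_exp w cost_exp s1 = step_cost R g X v (regs s1 15)"
        if "same {13,14,15,18} s' s1" "mem s1 = mem s'" "regs s1 15 \<in> X" for s1
        by (rule cost[OF that])
      show "step_cost R g X v u < k + 2" if "u \<in> X" for u
      proof -
        have "X - {u} \<subseteq> {..<k}" using X by blast
        from g[OF this, of u] show ?thesis by (simp add: step_cost_def of_bool_def)
      qed
      fix s1 assume s1: "same {13,14,15,18} s' s1" "mem s1 = mem s'"
        "\<forall>u\<in>X. regs s1 13 \<le> step_cost R g X v u"
        "X \<noteq> {} \<longrightarrow> regs s1 14 \<in> X \<and> regs s1 13 = step_cost R g X v (regs s1 14)"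
      define u where "u = regs s1 14"
      have u: "u \<in> X" "u < k" "u \<notin> set xs" and min: "\<And>y. y \<in> X \<Longrightarrow> step_cost R g X v u \<le> step_cost R g X v y"
        using s1(3,4) \<open>X \<noteq> {}\<close> by (auto simp: u_def X_def)
      have b1: "base s1" using base_same[OF b'(1) s1(1)] by simp
      have r1: "regs s1 9 = F" "regs s1 10 = v" "regs s1 11 = code X" "regs s1 12 = sp" "regs s1 16 = t" "regs s1 14 = u"
        using s1(1) b'(2) r I(2) by (simp_all add: same_def v_def X_def sp_def u_def)
      note reg = baseD[OF b1] r1
      have less: "v * k + u < k * k + k" using address_less(3)[OF v u(2)] .
      have sm1: "b2 + (v * k + u) < 2 ^ w" "b3 + u < 2 ^ w" "b4 + u < 2 ^ w" "b5 + u < 2 ^ w"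
        using less u(2) by (auto intro!: word_bounds(10) simp: b_defs)
      have Au: "A (v * k + u) = of_bool (R v u)" using tableD[OF A, of v u] v u(2) by simp
      define sp' where "sp' = sp + of_bool (R v u)"
      have sp'_less: "sp' < 2 ^ w" "t + sp' < 2 ^ w"
        using sp t room by (auto simp: sp'_def of_bool_def)
      have e1: "eval_exp w (Op Add (Reg 12) (Mem (idx 3 10 1 14))) s1 = sp'"
      proof -
        have a: "eval_exp w (idx 3 10 1 14) s1 = b2 + (v * k + u)" using reg sm1 by (simp add: eval_idx)
        have "eval_exp w (Mem (idx 3 10 1 14)) s1 = of_bool (R v u)"
          unfolding eval_exp.simps(3) a s1(2) m lay_read(2)[OF less] Au using w by (simp add: of_bool_def)
        then show ?thesis unfolding eval_exp.simps(4) using reg sp'_less by (simp add: sp'_def mod_simps)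
      qed
      define s2 where "s2 = s1\<lparr>regs := (regs s1)(12 := sp')\<rparr>"
      have e2: "eval_exp w (idx1 5 14) s2 = b4 + u" "eval_exp w (Op Add (Reg 16) (Reg 12)) s2 = t + sp'"
        using reg sm1 sp'_less by (simp_all add: s2_def eval_idx mod_simps)
      define s3 where "s3 = s2\<lparr>mem := lay A U' (P'(u := t + sp')) W D\<rparr>"
      have e3: "eval_exp w (idx1 4 14) s3 = b3 + u" "eval_exp w (Reg 9) s3 = F"
        using reg sm1 F(3) by (simp_all add: s2_def s3_def eval_idx)
      define s4 where "s4 = s3\<lparr>mem := lay A (U'(u := F)) (P'(u := t + sp')) W D\<rparr>"
      have Wu: "W u \<le> code X" "code X - W u = code (X - {u})" "code X < 2 ^ w"
        using code_diff[OF X u(1)] code_less[OF X] F(3) by auto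
      have e4: "eval_exp w (Op Sub (Reg 11) (Mem (idx1 6 14))) s4 = code (X - {u})"
        unfolding Wu(2)[symmetric]
      proof (rule eval_Sub[OF _ _ Wu(1,3)])
        show "eval_exp w (Reg 11) s4 = code X" using reg Wu(3) by (simp add: s4_def s3_def s2_def)
        have a: "eval_exp w (idx1 6 14) s4 = b5 + u"
          using reg sm1 by (simp add: s4_def s3_def s2_def eval_idx)
        show "eval_exp w (Mem (idx1 6 14)) s4 = W u"
          unfolding eval_exp.simps(3) a using Wu u(2) by (simp add: s4_def lay_read)
      qed
      define s5 where "s5 = s4\<lparr>regs := (regs s4)(11 := code (X - {u}))\<rparr>"
      have e5: "eval_exp w (Reg 14) s5 = u"
        using reg u(2) word_bounds(2) by (simp add: s5_def s4_def s3_def s2_def)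
      have mem2: "mem s2 = lay A U' P' W D" using s1(2) m by (simp add: s2_def)
      have "result w ?c s1 = s5\<lparr>regs := (regs s5)(10 := u)\<rparr>"
        unfolding result.simps(3) result.simps(1)[of w 12] e1 s2_def[symmetric]
          result.simps(2)[of w "idx1 5 14"] e2 mem2 lay_write(3)[OF u(2)] s3_def[symmetric]
          result.simps(2)[of w "idx1 4 14"] e3
        unfolding result.simps(1)[of w 10]
        using e4 e5 by (simp add: s3_def lay_write(2)[OF u(2)] s4_def s5_def)
      also have "\<dots> = s1\<lparr>regs := (regs s1)(12 := sp', 11 := code (X - {u}), 10 := u),
          mem := lay A (U'(u := F)) (P'(u := t + sp')) W D\<rparr>"
        by (simp add: s5_def s4_def s3_def s2_def)
      finally have res: "result w ?c s1 = s1\<lparr>regs := (regs s1)(12 := sp', 11 := code (X - {u}), 10 := u),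
          mem := lay A (U'(u := F)) (P'(u := t + sp')) W D\<rparr>" .
      have walk': "walk R g k (xs @ [u])"
        using xs(1) u min by (intro walk.snoc) (auto simp: X_def v_def)
      have diff: "{..<k} - set (xs @ [u]) = X - {u}" by (auto simp: X_def)
      have sep': "sep R (k # xs @ [u]) = sp'"
        using sep_snoc[of "k # xs" R u] by (simp add: sp'_def sp_def v_def)
      have sm': "same {10,11,12,13,14,15,16,18} s s1"
        by (rule same_trans[OF sm s1(1)]) auto
      have "I (Suc t) (result w ?c s1\<lparr>regs := (regs (result w ?c s1))(16 := Suc t)\<rparr>)"
      proof (rule I_intro[where xs = "xs @ [u]" and U' = "U'(u := F)" and P' = "P'(u := t + sp')"])
        show "same {10,11,12,13,14,15,16,18} s (result w ?c s1\<lparr>regs := (regs (result w ?c s1))(16 := Suc t)\<rparr>)"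
          unfolding res using sm' by simp
        show "walk R g k (xs @ [u])" by (rule walk')
        show "\<forall>ua<k. if ua \<in> set (xs @ [u]) then (U'(u := F)) ua = F else (U'(u := F)) ua < F"
          using U' by (auto split: if_splits)
        show "\<forall>t'<length (xs @ [u]). (P'(u := t + sp')) ((xs @ [u]) ! t') = t' + sep R (k # take (Suc t') (xs @ [u]))"
        proof (intro allI impI)
          fix t' assume t': "t' < length (xs @ [u])"
          show "(P'(u := t + sp')) ((xs @ [u]) ! t') = t' + sep R (k # take (Suc t') (xs @ [u]))"
          proof (cases "t' < length xs")
            case True
            then have "xs ! t' \<noteq> u" using u(3) nth_mem by metis
            then show ?thesis using True P' by (simp add: nth_append)
          next
            case False
            then have "t' = t" using t' xs(2) by simp
            then show ?thesis using xs(2) sep' by (simp add: nth_append)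
          qed
        qed
      qed (unfold res, use xs(2) diff sep' in simp_all)
      moreover have "regs (result w ?c s1) 16 = t" unfolding res using r1 by simp
      ultimately show "runs w ?c s1 32 (\<lambda>s'. regs s' 16 = t \<and> I (Suc t) (s'\<lparr>regs := (regs s')(16 := Suc t)\<rparr>))"
        by (intro runs_loop_free_le) (simp_all del: result.simps)
    qed simp_all
  qed
  let ?s0 = "s\<lparr>regs := (regs s)(10 := k, 11 := F - 1, 12 := 0)\<rparr>"
  have main: "runs w (For 16 0 1 (Seq ?scan ?c)) ?s0 (6 + k * (10 + k * 48 + 32 + 8)) Q"
  proof (rule runs_For[where I = I])
    show "I 0 (?s0\<lparr>regs := (regs ?s0)(16 := 0)\<rparr>)"
      by (rule I_intro[where xs = "[]" and U' = U and P' = P]) (use s U code_full in \<open>auto intro: walk.Nil\<close>)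
    show "regs s' 1 = k" if "I t s'" for t s'
      using that s(1) by (auto simp: I_def base_def same_def)
    show "Q s'" if I: "I k s'" for s'
    proof -
      obtain xs U' P' where *: "same {10,11,12,13,14,15,16,18} s s'" "walk R g k xs" "length xs = k"
        "mem s' = lay A U' P' W D" "\<forall>u<k. if u \<in> set xs then U' u = F else U' u < F"
        "\<forall>t<length xs. P' (xs ! t) = t + sep R (k # take (Suc t) xs)" "regs s' 12 = sep R (k # xs)"
        using I unfolding I_def by blast
      have "set xs = {..<k}" using walk_complete[OF *(2,3)] .
      then show ?thesis using * by (intro Q[of s' U' P' xs]) auto
    qed
    show "runs w (Seq ?scan ?c) s' (10 + k * 48 + 32)
      (\<lambda>s'. regs s' 16 = i \<and> I (Suc i) (s'\<lparr>regs := (regs s')(16 := Suc i)\<rparr>))"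
      if "0 \<le> i" "i < k" "I i s'" "regs s' 16 = i" for i s' using body that by blast
  qed (use word_bounds(2) w in auto)
  have c1: "eval_exp w (Reg 1) s = k" using baseD[OF s(1)] word_bounds(2) by simp
  have c2: "eval_exp w (Op Sub (Reg 9) (Const 1)) (s\<lparr>regs := (regs s)(10 := k)\<rparr>) = F - 1"
    by (rule eval_Sub) (use F w in auto)
  have res: "result w (Assign 12 (Const 0)) (result w (Assign 11 (Op Sub (Reg 9) (Const 1)))
      (result w (Assign 10 (Reg 1)) s)) = ?s0"
    unfolding result.simps c1 c2 by simp
  show ?thesis unfolding order_com_def
    by (rule runs_mono[OF runs_Seq_loop_free[OF _ runs_Seq_loop_free[OF _ runs_Seq_loop_free[OF _ main[folded res]]]]])
       simp_all
qed

end

section \<open>Binary codes of sets and the Held-Karp table\<close>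

lemma set_decode_less: "S < 2 ^ k \<Longrightarrow> set_decode S \<subseteq> {..<k}"
proof
  fix u assume S: "S < 2 ^ k" and u: "u \<in> set_decode S"
  show "u \<in> {..<k}"
  proof (rule ccontr)
    assume "u \<notin> {..<k}"
    then have "(2::nat) ^ k \<le> 2 ^ u" by (intro power_increasing) auto
    then have "S < 2 ^ u" using S by linarith
    then have "S div 2 ^ u = 0" by simp
    then show False using u by (simp add: set_decode_def)
  qed
qed

lemma set_encode_diff:
  assumes "finite X" "u \<in> X"
  shows "2 ^ u \<le> set_encode X" "set_encode X - 2 ^ u = set_encode (X - {u})"
proof -
  have "set_encode X = 2 ^ u + set_encode (X - {u})"
    unfolding set_encode_def using sum.remove[OF assms, of "(^) 2"] .
  then show "2 ^ u \<le> set_encode X" "set_encode X - 2 ^ u = set_encode (X - {u})" by simp_all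
qed

lemma set_encode_lessThan: "set_encode {..<k} = 2 ^ k - 1"
  by (induction k) (simp_all add: lessThan_Suc)

lemma set_encode_less: "X \<subseteq> {..<k} \<Longrightarrow> set_encode X < 2 ^ k"
proof -
  assume "X \<subseteq> {..<k}"
  then have "set_encode X \<le> set_encode {..<k}" unfolding set_encode_def by (intro sum_mono2) auto
  moreover have "(0::nat) < 2 ^ k" by simp
  ultimately show "set_encode X < 2 ^ k" unfolding set_encode_lessThan by linarith
qed

context machine
begin

lemma runs_powers:
  assumes s: "base s" "mem s = lay A U P W D" "regs s 9 = 1" and room2: "2 ^ k \<le> M"
    and Q: "\<And>s' W'. same {9,16} s s' \<Longrightarrow> mem s' = lay A U P W' D \<Longrightarrow> regs s' 9 = 2 ^ k \<Longrightarrow>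
      (\<And>i. i < k \<Longrightarrow> W' i = 2 ^ i) \<Longrightarrow> Q s'"
  shows "runs w (For 16 0 1 (Seq (Store (idx1 6 16) (Reg 9)) (Assign 9 (Op Add (Reg 9) (Reg 9))))) s
    (6 + k * (9 + 8)) Q"
proof -
  let ?c = "Seq (Store (idx1 6 16) (Reg 9)) (Assign 9 (Op Add (Reg 9) (Reg 9)))"
  define I where "I i s' \<longleftrightarrow> same {9,16} s s' \<and> regs s' 9 = 2 ^ i \<and>
    (\<exists>W'. mem s' = lay A U P W' D \<and> (\<forall>j<i. W' j = 2 ^ j))" for i s'
  show ?thesis
  proof (rule runs_For[where I = I])
    show "I 0 (s\<lparr>regs := (regs s)(16 := 0)\<rparr>)" using s by (auto simp: I_def)
    show "regs s' 1 = k" if "I i s'" for i s'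
      using that s(1) by (auto simp: I_def base_def same_def)
    show "Q s'" if "I k s'" for s' using that Q unfolding I_def by blast
    fix i s' assume i: "0 \<le> i" "i < k" "I i s'" "regs s' 16 = i"
    obtain W' where W': "same {9,16} s s'" "regs s' 9 = 2 ^ i" "mem s' = lay A U P W' D" "\<forall>j<i. W' j = 2 ^ j"
      using i(3) unfolding I_def by blast
    have b': "base s'" using base_same[OF s(1) W'(1)] by simp
    have "b5 + i < 2 ^ w" using i(2) by (intro word_bounds(10)) (simp add: b_defs)
    then have a: "eval_exp w (idx1 6 16) s' = b5 + i" using baseD[OF b'] i by (simp add: eval_idx)
    have "(2::nat) ^ i \<le> 2 ^ k" "(2::nat) ^ Suc i \<le> 2 ^ k" using i(2) by (auto intro!: power_increasing simp del: power_Suc)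
    moreover have "M < 2 ^ w" using room by linarith
    ultimately have le: "(2::nat) ^ i < 2 ^ w" "(2::nat) ^ Suc i < 2 ^ w" using room2 by linarith+
    define s1 where "s1 = s'\<lparr>mem := lay A U P (W'(i := 2 ^ i)) D\<rparr>"
    have e1: "eval_exp w (Reg 9) s' = 2 ^ i" using W'(2) le by simp
    have e2: "eval_exp w (Op Add (Reg 9) (Reg 9)) s1 = 2 ^ Suc i"
      using W'(2) le by (simp add: s1_def)
    have res: "result w ?c s' = s1\<lparr>regs := (regs s1)(9 := 2 ^ Suc i)\<rparr>"
      unfolding result.simps(1-3) a e1 W'(3) lay_write(4)[OF i(2)] s1_def[symmetric] e2 ..
    have "I (Suc i) (result w ?c s'\<lparr>regs := (regs (result w ?c s'))(16 := Suc i)\<rparr>)"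
      unfolding res I_def using W'(1,4) by (auto simp: s1_def less_Suc_eq intro!: exI[of _ "W'(i := 2 ^ i)"])
    moreover have "regs (result w ?c s') 16 = i" unfolding res using i by (simp add: s1_def)
    ultimately show "runs w ?c s' 9 (\<lambda>s'. regs s' 16 = i \<and> I (Suc i) (s'\<lparr>regs := (regs s')(16 := Suc i)\<rparr>))"
      by (intro runs_loop_free_le) (simp_all del: result.simps)
  qed (use word_bounds(2) w in auto)
qed

lemma runs_fill:
  assumes s: "base s" "mem s = lay A U P W D" and A: "table (Suc k) k R A" and D: "\<And>x. D x = 0"
    and room2: "2 ^ k * k \<le> M" "2 ^ k \<le> M"
    and Q: "\<And>s' W' D'. base s' \<Longrightarrow> regs s' 8 = regs s 8 \<Longrightarrow> mem s' = lay A U P W' D' \<Longrightarrow> regs s' 9 = 2 ^ k \<Longrightarrow>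
      (\<And>i. i < k \<Longrightarrow> W' i = 2 ^ i) \<Longrightarrow>
      (\<And>S u. S < 2 ^ k \<Longrightarrow> u < k \<Longrightarrow> D' (S * k + u) = opt R (set_decode S) u) \<Longrightarrow>
      (\<And>x. 2 ^ k * k \<le> x \<Longrightarrow> D' x = 0) \<Longrightarrow> Q s'"
  shows "runs w fill s (2 + ((6 + k * (9 + 8)) + (6 + 2 ^ k * ((6 + k * (10 + k * 50 + 9 + 8)) + 8)))) Q"
proof -
  let ?scan = "scan (Op Mod (Op Div (Reg 11) (Mem (idx1 6 15))) (Const 2)) cost_exp"
  let ?store = "Store (idx 7 11 1 10) (Reg 13)"
  have pow_less: "(2::nat) ^ k < 2 ^ w" using room room2(2) by linarith
  have two: "(2::nat) < 2 ^ w" using word_bounds(9) by linarith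
  have tables: "runs w (For 11 1 9 (For 10 0 1 (Seq ?scan ?store))) s0
      (6 + 2 ^ k * ((6 + k * (10 + k * 50 + 9 + 8)) + 8)) Q"
    if s0: "base s0" "regs s0 8 = regs s 8" "mem s0 = lay A U P W' D" "regs s0 9 = 2 ^ k" and W': "\<And>i. i < k \<Longrightarrow> W' i = 2 ^ i"
    for s0 W'
  proof -
    let ?R = "{10,11,13,14,15,18} :: nat set"
    \<comment> \<open>Rows below \<open>S\<close> are complete and row \<open>S\<close> is filled up
      to column \<open>v\<close>; the part behind the table, where the output will go, is still
      zero.\<close>
    define ok where "ok S v D' \<longleftrightarrow> (\<forall>S' u. S' < S \<longrightarrow> u < k \<longrightarrow> D' (S' * k + u) = opt R (set_decode S') u) \<and>
      (\<forall>u<v. D' (S * k + u) = opt R (set_decode S) u) \<and> (\<forall>x. 2 ^ k * k \<le> x \<longrightarrow> D' x = (0::nat))" for S v D'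
    define I where "I S s' \<longleftrightarrow> same ?R s0 s' \<and> (\<exists>D'. mem s' = lay A U P W' D' \<and> ok S 0 D')" for S s'
    define J where "J S v s' \<longleftrightarrow> same ?R s0 s' \<and> regs s' 11 = S \<and> (\<exists>D'. mem s' = lay A U P W' D' \<and> ok S v D')" for S v s'
    have body: "runs w (Seq ?scan ?store) s' (10 + k * 50 + 9)
        (\<lambda>s'. regs s' 10 = v \<and> J S (Suc v) (s'\<lparr>regs := (regs s')(10 := Suc v)\<rparr>))"
      if S: "1 \<le> S" "S < 2 ^ k" and v: "v < k" and J: "J S v s'" "regs s' 10 = v" for S v s'
    proof -
      obtain D' where sm: "same ?R s0 s'" and r: "regs s' 11 = S" and m: "mem s' = lay A U P W' D'" and ok: "ok S v D'"
        using J(1) unfolding J_def by blast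
      define X where "X = set_decode S"
      have X: "X \<subseteq> {..<k}" unfolding X_def by (rule set_decode_less[OF S(2)])
      then have finX: "finite X" using finite_subset by blast
      have SX: "set_encode X = S" by (simp add: X_def)
      have "X \<noteq> {}" using SX S(1) by auto
      have b': "base s'" using base_same[OF s0(1) sm] by simp
      have Sw: "S < 2 ^ w" using S(2) pow_less by linarith
      show ?thesis
      proof (rule runs_mono[OF runs_Seq[OF runs_scan[where X = X and k = k and
              c = "\<lambda>u. of_bool (R v u) + opt R (X - {u}) u"]]])
        show "regs s' 1 = k" "k + 2 < 2 ^ w" "0 < w" "X \<subseteq> {..<k}"
          using baseD[OF b'] word_bounds(9) w X by simp_all
        show "(eval_exp w (Op Mod (Op Div (Reg 11) (Mem (idx1 6 15))) (Const 2)) s1 \<noteq> 0) = (regs s1 15 \<in> X)"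
          if s1: "same {13,14,15,18} s' s1" "mem s1 = mem s'" "regs s1 15 < k" for s1
        proof -
          have b1: "base s1" "regs s1 11 = S" using base_same[OF b' s1(1)] r s1(1) by (auto simp: same_def)
          have "b5 + regs s1 15 < 2 ^ w" using s1(3) by (intro word_bounds(10)) (simp add: b_defs)
          then have a: "eval_exp w (idx1 6 15) s1 = b5 + regs s1 15" using baseD[OF b1(1)] by (simp add: eval_idx)
          have "(2::nat) ^ regs s1 15 \<le> 2 ^ k" using s1(3) by (intro power_increasing) auto
          then have "(2::nat) ^ regs s1 15 < 2 ^ w" using pow_less by linarith
          then have m1: "eval_exp w (Mem (idx1 6 15)) s1 = 2 ^ regs s1 15"
            unfolding eval_exp.simps(3) a s1(2) m lay_read(5)[OF s1(3)] W'[OF s1(3)] by simp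
          have "S div 2 ^ regs s1 15 < 2 ^ w" using Sw div_le_dividend le_less_trans by blast
          moreover have "S div 2 ^ regs s1 15 mod 2 < 2 ^ w" using two by (rule less_trans[rotated]) simp
          ultimately have "eval_exp w (Op Mod (Op Div (Reg 11) (Mem (idx1 6 15))) (Const 2)) s1
              = S div 2 ^ regs s1 15 mod 2"
            unfolding eval_exp.simps(4) m1 using b1(2) Sw two by simp
          then show ?thesis by (simp add: X_def set_decode_def odd_iff_mod_2_eq_one)
        qed
        show "eval_exp w cost_exp s1 = of_bool (R v (regs s1 15)) + opt R (X - {regs s1 15}) (regs s1 15)"
          if s1: "same {13,14,15,18} s' s1" "mem s1 = mem s'" "regs s1 15 \<in> X" for s1
        proof (rule eval_cost_exp[OF _ _ A])
          have u: "regs s1 15 < k" using s1(3) X by auto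
          show "base s1" using base_same[OF b' s1(1)] by simp
          show "mem s1 = lay A U P W' D'" using s1(2) m by simp
          show "regs s1 10 = v" "regs s1 11 = S" using s1(1) r J(2) by (simp_all add: same_def)
          show "v \<le> k" "regs s1 15 = regs s1 15" "regs s1 15 < k" "S < 2 ^ w" using v u Sw by simp_all
          show "W' (regs s1 15) \<le> S" using set_encode_diff(1)[OF finX s1(3)] SX W'[OF u] by simp
          have eq: "S - W' (regs s1 15) = set_encode (X - {regs s1 15})"
            using set_encode_diff(2)[OF finX s1(3)] SX W'[OF u] by simp
          \<comment> \<open>The row needed belongs to a smaller code, hence is complete.\<close>
          have less: "S - W' (regs s1 15) < S" using S(1) W'[OF u] by simp
          show "(S - W' (regs s1 15)) * k + regs s1 15 \<le> M"
            using index_less[of "S - W' (regs s1 15)" "2 ^ k" "regs s1 15" k] less S(2) u room2(1) by linarith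
          have "set_decode (S - W' (regs s1 15)) = X - {regs s1 15}"
            unfolding eq using finX by simp
          then show "D' ((S - W' (regs s1 15)) * k + regs s1 15) = opt R (X - {regs s1 15}) (regs s1 15)"
            using ok less u unfolding ok_def by auto
          have "card (X - {regs s1 15}) \<le> card {..<k}" using X by (intro card_mono) auto
          then show "opt R (X - {regs s1 15}) (regs s1 15) \<le> k"
            using opt_le_card[of "X - {regs s1 15}" R "regs s1 15"] finX by simp
        qed
        show "of_bool (R v u) + opt R (X - {u}) u < k + 2" if "u \<in> X" for u
        proof -
          have "card (X - {u}) \<le> card {..<k}" using X by (intro card_mono) auto
          then show ?thesis using opt_le_card[of "X - {u}" R u] finX by (simp add: of_bool_def)
        qed
        fix s1 assume s1: "same {13,14,15,18} s' s1" "mem s1 = mem s'"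
          "\<forall>u\<in>X. regs s1 13 \<le> of_bool (R v u) + opt R (X - {u}) u"
          "X \<noteq> {} \<longrightarrow> regs s1 14 \<in> X \<and> regs s1 13 = of_bool (R v (regs s1 14)) + opt R (X - {regs s1 14}) (regs s1 14)"
        have best: "regs s1 13 = opt R X v"
          using s1(3,4) \<open>X \<noteq> {}\<close> by (intro opt_eqI[OF finX]) auto
        have "card X \<le> card {..<k}" using X by (intro card_mono) auto
        then have "opt R X v \<le> k" using opt_le_card[OF finX, of R v] by simp
        then have e: "eval_exp w (Reg 13) s1 = opt R X v" using best word_bounds(2) by simp
        have b1: "base s1" using base_same[OF b' s1(1)] by simp
        have r1: "regs s1 11 = S" "regs s1 10 = v" using s1(1) r J(2) by (simp_all add: same_def)
        have iless: "S * k + v < 2 ^ k * k" using index_less[OF S(2) v] .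
        then have "b6 + (S * k + v) < 2 ^ w" using room2(1) by (intro word_bounds(11)) simp
        then have a: "eval_exp w (idx 7 11 1 10) s1 = b6 + (S * k + v)"
          using baseD[OF b1] r1 by (simp add: eval_idx)
        have res: "result w ?store s1 = s1\<lparr>mem := lay A U P W' (D'(S * k + v := opt R X v))\<rparr>"
          unfolding result.simps a e s1(2) m lay_write(5) ..
        have ok': "ok S (Suc v) (D'(S * k + v := opt R X v))"
          unfolding ok_def
        proof (intro conjI allI impI)
          show "(D'(S * k + v := opt R X v)) (S' * k + u) = opt R (set_decode S') u" if "S' < S" "u < k" for S' u
            using ok that index_eq_iff[OF that(2) v, of S' S] by (simp add: ok_def)
          show "(D'(S * k + v := opt R X v)) (S * k + u) = opt R (set_decode S) u" if "u < Suc v" for u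
            using ok that by (auto simp: ok_def X_def less_Suc_eq)
          show "(D'(S * k + v := opt R X v)) x = 0" if "2 ^ k * k \<le> x" for x
            using ok that iless by (auto simp: ok_def)
        qed
        have "same ?R s0 s1" by (rule same_trans[OF sm s1(1)]) auto
        then have "J S (Suc v) (result w ?store s1\<lparr>regs := (regs (result w ?store s1))(10 := Suc v)\<rparr>)"
          unfolding J_def res using ok' r1 by auto
        moreover have "regs (result w ?store s1) 10 = v" unfolding res using r1 by simp
        ultimately show "runs w ?store s1 9 (\<lambda>s'. regs s' 10 = v \<and> J S (Suc v) (s'\<lparr>regs := (regs s')(10 := Suc v)\<rparr>))"
          by (intro runs_loop_free_le) (simp_all del: result.simps)
      qed simp_all
    qed
    show ?thesis
    proof (rule runs_For[where I = I])
      have "ok 1 0 D" unfolding ok_def using D by auto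
      then show "I 1 (s0\<lparr>regs := (regs s0)(11 := 1)\<rparr>)" using s0 by (auto simp: I_def)
      show "regs s' 9 = 2 ^ k" if "I S s'" for S s' using that s0(4) by (auto simp: I_def same_def)
      show "Q s'" if I: "I (2 ^ k) s'" for s'
      proof -
        obtain D' where D': "same ?R s0 s'" "mem s' = lay A U P W' D'" "ok (2 ^ k) 0 D'"
          using I unfolding I_def by blast
        have "base s'" using base_same[OF s0(1) D'(1)] by simp
        moreover have "regs s' 8 = regs s 8" "regs s' 9 = 2 ^ k" using D'(1) s0 by (auto simp: same_def)
        ultimately show ?thesis using Q[of s' W' D'] D'(2,3) W' by (simp add: ok_def)
      qed
      fix S s' assume S: "1 \<le> S" "S < 2 ^ k" "I S s'" "regs s' 11 = S"
      show "runs w (For 10 0 1 (Seq ?scan ?store)) s' (6 + k * (10 + k * 50 + 9 + 8))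
        (\<lambda>s'. regs s' 11 = S \<and> I (Suc S) (s'\<lparr>regs := (regs s')(11 := Suc S)\<rparr>))"
      proof (rule runs_For[where I = "J S"])
        show "J S 0 (s'\<lparr>regs := (regs s')(10 := 0)\<rparr>)" using S by (auto simp: I_def J_def)
        show "regs s1 1 = k" if "J S v s1" for v s1
          using that s0(1) by (auto simp: J_def base_def same_def)
        show "regs s1 11 = S \<and> I (Suc S) (s1\<lparr>regs := (regs s1)(11 := Suc S)\<rparr>)" if "J S k s1" for s1
        proof -
          have "ok (Suc S) 0 D'" if "ok S k D'" for D' using that by (auto simp: ok_def less_Suc_eq)
          then show ?thesis using that by (auto simp: J_def I_def)
        qed
      qed (use body S word_bounds(2) w in auto)
    qed (use pow_less w in auto)
  qed
  have init: "eval_exp w (Const 1) s = 1" using w by simp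
  show ?thesis unfolding fill_def
  proof (rule runs_mono[OF runs_Seq_loop_free[OF _ runs_Seq[OF runs_powers]]])
    show "loop_free (Assign 9 (Const 1))" by simp
    show "base (result w (Assign 9 (Const 1)) s)" unfolding result.simps init
      by (rule base_same[OF s(1), of "{9}"]) auto
    show "mem (result w (Assign 9 (Const 1)) s) = lay A U P W D" using s by simp
    show "regs (result w (Assign 9 (Const 1)) s) 9 = 1" unfolding result.simps init by simp
    show "2 ^ k \<le> M" by (rule room2)
    fix s' W' assume s': "same {9,16} (result w (Assign 9 (Const 1)) s) s'" "mem s' = lay A U P W' D"
      "regs s' 9 = 2 ^ k" "\<And>i. i < k \<Longrightarrow> W' i = 2 ^ i"
    have "same {9,16} s s'" using s'(1) by (auto simp: same_def)
    then have "base s'" "regs s' 8 = regs s 8" using base_same[OF s(1), of "{9,16}" s'] by (auto simp: same_def)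
    then show "runs w (For 11 1 9 (For 10 0 1 (Seq ?scan ?store))) s'
      (6 + 2 ^ k * ((6 + k * (10 + k * 50 + 9 + 8)) + 8)) Q"
      using tables s' by blast
  qed simp_all
qed

section \<open>Writing the output\<close>

lemma runs_emit:
  fixes z
  defines "F \<equiv> \<lambda>u i. b z i \<noteq> b u i"
  assumes s: "base s" "mem s = lay A U P W D" "regs s 8 = z" "z < n" "regs s 9 = K" "regs s 12 = sp"
    and D: "\<And>x. K * k \<le> x \<Longrightarrow> D x = 0" and P: "\<And>i. i < k \<Longrightarrow> P i < k + sp" "inj_on P {..<k}"
    and room3: "K * k + n * (k + sp) \<le> M" "k + sp \<le> M" "K \<le> M"
    and Q: "\<And>s'. regs s' 0 = k + sp \<Longrightarrow>
      (\<And>u j. u < n \<Longrightarrow> j < k + sp \<Longrightarrow> mem s' (regs s' 1 + u * (k + sp) + j) = of_bool (\<exists>i<k. P i = j \<and> F u i)) \<Longrightarrow> Q s'"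
  shows "runs w emit s (4 + (6 + ((6 + n * ((6 + k * (30 + 8)) + 8)) + 4))) Q"
proof -
  define f where "f = k + sp"
  define out where "out = K * k"
  have Mw: "M < 2 ^ w" using room by linarith
  have fw: "f < 2 ^ w" "sp < 2 ^ w" "K < 2 ^ w" "b6 + out < 2 ^ w"
    using room3 Mw by (auto simp: f_def out_def intro!: word_bounds(11))
  define s0 where "s0 = s\<lparr>regs := (regs s)(12 := f, 13 := b6 + out)\<rparr>"
  let ?R = "{16,17} :: nat set"
  define G where "G R s' \<longleftrightarrow> same ?R s0 s' \<and> (\<exists>D'. mem s' = lay A U P W D' \<and> table n f R (\<lambda>x. D' (out + x)))" for R s'
  have G_upd: "G R (s'\<lparr>regs := (regs s')(x := v)\<rparr>)" if "G R s'" "x \<in> ?R" for R s' x v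
    using that by (auto simp: G_def)
  have G_cong: "G R' s'" if "G R s'" "\<And>i j. i < n \<Longrightarrow> j < f \<Longrightarrow> R i j \<longleftrightarrow> R' i j" for R R' s'
    using that table_cong[of n f R _ R'] by (auto simp: G_def)
  have base0: "base s0" unfolding s0_def by (rule base_same[OF s(1), of "{12,13}"]) auto
  have G_base: "base s'" "regs s' 8 = z" "regs s' 12 = f" "regs s' 13 = b6 + out" if "G R s'" for R s'
  proof -
    have sm: "same ?R s0 s'" using that by (simp add: G_def)
    show "base s'" by (rule base_same[OF base0 sm]) auto
    show "regs s' 8 = z" "regs s' 12 = f" "regs s' 13 = b6 + out"
      using sameD[OF sm] s(3) by (simp_all add: s0_def)
  qed
  define R1 where "R1 u = (\<lambda>u' j. u' < u \<and> (\<exists>i<k. P i = j \<and> F u' i))" for u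
  define R2 where "R2 u i = (\<lambda>u' j. R1 u u' j \<or> u' = u \<and> (\<exists>i'<i. P i' = j \<and> F u i'))" for u i
  let ?addr = "Op Add (Reg 13) (Op Add (Op Mul (Reg 16) (Reg 12)) (Mem (idx1 5 17)))"
  let ?c = "Store ?addr (flip_exp 16 17)"
  have c: "runs w ?c s' 30 (\<lambda>s'. regs s' 17 = i \<and> (G (R2 u (Suc i)) (s'\<lparr>regs := (regs s')(17 := Suc i)\<rparr>) \<and>
      regs (s'\<lparr>regs := (regs s')(17 := Suc i)\<rparr>) 16 = u))"
    if u: "u < n" and i: "i < k" and s': "G (R2 u i) s'" "regs s' 16 = u" "regs s' 17 = i" for u i s'
  proof -
    obtain D' where D': "same ?R s0 s'" "mem s' = lay A U P W D'" "table n f (R2 u i) (\<lambda>x. D' (out + x))"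
      using s'(1) unfolding G_def by blast
    note reg = baseD[OF G_base(1)[OF s'(1)]] G_base(2-4)[OF s'(1)] s'(2,3)
    have ev: "eval_exp w (flip_exp 16 17) s' = of_bool (F u i)"
      unfolding F_def by (rule eval_flip[OF G_base(1)[OF s'(1)] D'(2) G_base(2)[OF s'(1)] s(4) s'(2) u s'(3) i])
    have Pi: "P i < f" using P(1)[OF i] by (simp add: f_def)
    have less: "u * f + P i < n * f" by (rule index_less[OF u Pi])
    have "b6 + (out + (u * f + P i)) < 2 ^ w"
      using less room3(1) by (intro word_bounds(11)) (simp add: out_def f_def)
    moreover have "b4 + i < 2 ^ w" using i by (intro word_bounds(10)) (simp add: b_defs)
    moreover from this have "eval_exp w (idx1 5 17) s' = b4 + i" using reg by (simp add: eval_idx)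
    then have "eval_exp w (Mem (idx1 5 17)) s' = P i"
      unfolding eval_exp.simps(3) D'(2) using i Pi fw(1) by (simp add: lay_read)
    ultimately have addr: "eval_exp w ?addr s' = b6 + (out + (u * f + P i))"
      unfolding eval_exp.simps(4) using reg by (simp add: mod_simps add.assoc)
    have res: "result w ?c s' = s'\<lparr>mem := lay A U P W (D'(out + (u * f + P i) := of_bool (F u i)))\<rparr>"
      unfolding result.simps addr ev D'(2) lay_write(5) ..
    have R2_Suc: "R2 u (Suc i) u' j \<longleftrightarrow> (if u' = u \<and> j = P i then F u i else R2 u i u' j)" for u' j
    proof -
      \<comment> \<open>Positions are distinct, so no earlier coordinate has touched this cell, and
        overwriting it loses nothing.\<close>
      have "P i' \<noteq> P i" if "i' < i" for i' using inj_onD[OF P(2), of i' i] that i by auto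
      then have "\<not> R2 u i u (P i)" by (auto simp: R2_def R1_def)
      then show ?thesis by (auto simp: R2_def less_Suc_eq)
    qed
    have "table n f (R2 u (Suc i)) ((\<lambda>x. D' (out + x))(u * f + P i := of_bool (F u i)))"
      by (rule table_update[OF D'(3) u Pi]) (rule R2_Suc)
    moreover have "(\<lambda>x. D' (out + x))(u * f + P i := of_bool (F u i)) =
        (\<lambda>x. (D'(out + (u * f + P i) := of_bool (F u i))) (out + x))" by (rule ext) auto
    ultimately have tab: "table n f (R2 u (Suc i)) (\<lambda>x. (D'(out + (u * f + P i) := of_bool (F u i))) (out + x))"
      by (simp only:)
    have G1: "G (R2 u (Suc i)) (result w ?c s')"
      unfolding res G_def
    proof (intro conjI exI)
      show "mem (s'\<lparr>mem := lay A U P W (D'(out + (u * f + P i) := of_bool (F u i)))\<rparr>)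
          = lay A U P W (D'(out + (u * f + P i) := of_bool (F u i)))" by simp
    qed (use D'(1) tab in simp_all)
    have "regs (result w ?c s') = regs s'" by simp
    then show ?thesis
      using G_upd[OF G1, of 17 "Suc i"] s' by (intro runs_loop_free_le) (simp_all del: result.simps)
  qed
  have main: "runs w (For 16 0 0 (For 17 0 1 ?c)) s0 (6 + n * ((6 + k * (30 + 8)) + 8)) (G (R1 n))"
  proof (rule runs_For[where I = "\<lambda>u. G (R1 u)"])
    have "G (R1 0) s0"
      using s(2) D by (auto simp: G_def s0_def R1_def table_def out_def intro!: exI[of _ D])
    then show "G (R1 0) (s0\<lparr>regs := (regs s0)(16 := 0)\<rparr>)" using G_upd by simp
    show "regs s1 0 = n" if "G (R1 u) s1" for u s1 using that G_base(1) baseD(1) by blast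
    fix u s1 assume u: "0 \<le> u" "u < n" "G (R1 u) s1" "regs s1 16 = u"
    show "runs w (For 17 0 1 ?c) s1 (6 + k * (30 + 8))
      (\<lambda>s'. regs s' 16 = u \<and> G (R1 (Suc u)) (s'\<lparr>regs := (regs s')(16 := Suc u)\<rparr>))"
    proof (rule runs_For[where I = "\<lambda>i s'. G (R2 u i) s' \<and> regs s' 16 = u"])
      have "G (R2 u 0) s1" using u(3) by (rule G_cong) (simp add: R2_def)
      then show "G (R2 u 0) (s1\<lparr>regs := (regs s1)(17 := 0)\<rparr>) \<and> regs (s1\<lparr>regs := (regs s1)(17 := 0)\<rparr>) 16 = u"
        using u G_upd by simp
      show "regs s2 1 = k" if "G (R2 u i) s2 \<and> regs s2 16 = u" for i s2
        using that G_base(1) baseD(2) by blast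
      fix s2 assume s2: "G (R2 u k) s2 \<and> regs s2 16 = u"
      have "G (R1 (Suc u)) s2"
        by (rule G_cong[of "R2 u k"]) (use s2 in \<open>auto simp: R2_def R1_def less_Suc_eq\<close>)
      then show "regs s2 16 = u \<and> G (R1 (Suc u)) (s2\<lparr>regs := (regs s2)(16 := Suc u)\<rparr>)"
        using s2 G_upd by simp
    qed (use c[OF u(2)] word_bounds(2) w in auto)
  qed (use word_bounds(1) w in auto)
  have e1: "eval_exp w (Op Add (Reg 1) (Reg 12)) s = f"
    using baseD[OF s(1)] s(6) fw by (simp add: f_def mod_simps)
  have e2: "eval_exp w (Op Add (Reg 7) (Op Mul (Reg 9) (Reg 1))) (s\<lparr>regs := (regs s)(12 := f)\<rparr>) = b6 + out"
    using baseD[OF s(1)] s(5) fw by (simp add: out_def mod_simps)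
  let ?end = "Seq (Assign 0 (Reg 12)) (Assign 1 (Reg 13))"
  have last: "runs w ?end s' 4 Q" if G: "G (R1 n) s'" for s'
  proof (rule runs_loop_free_le)
    obtain D' where D': "mem s' = lay A U P W D'" "table n f (R1 n) (\<lambda>x. D' (out + x))"
      using G unfolding G_def by blast
    have r: "regs (result w ?end s') 0 = f" "regs (result w ?end s') 1 = b6 + out" "mem (result w ?end s') = mem s'"
      using G_base(3,4)[OF G] fw by simp_all
    show "Q (result w ?end s')"
    proof (rule Q)
      show "regs (result w ?end s') 0 = k + sp" using r(1) by (simp add: f_def)
      fix u j assume uj: "u < n" "j < k + sp"
      have "mem (result w ?end s') (regs (result w ?end s') 1 + u * (k + sp) + j) = D' (out + (u * f + j))"
        unfolding r D'(1) using lay_read(6)[of A U P W D' "out + (u * f + j)"] by (simp add: f_def add.assoc)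
      also have "\<dots> = of_bool (\<exists>i<k. P i = j \<and> F u i)"
        using tableD[OF D'(2) uj(1), of j] uj by (simp add: f_def R1_def)
      finally show "mem (result w ?end s') (regs (result w ?end s') 1 + u * (k + sp) + j) = of_bool (\<exists>i<k. P i = j \<and> F u i)" .
    qed
  qed simp_all
  have main': "runs w (Seq (For 16 0 0 (For 17 0 1 ?c)) ?end) s0 ((6 + n * ((6 + k * (30 + 8)) + 8)) + 4) Q"
    by (rule runs_Seq, rule runs_mono[OF main]) (use last in auto)
  have res: "result w (Assign 13 (Op Add (Reg 7) (Op Mul (Reg 9) (Reg 1)))) (result w (Assign 12 (Op Add (Reg 1) (Reg 12))) s) = s0"
    unfolding result.simps e1 e2 by (simp add: s0_def)
  show ?thesis unfolding emit_def
    by (rule runs_mono[OF runs_Seq_loop_free[OF _ runs_Seq_loop_free[OF _ main'[folded res]]]]) simp_all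
qed

end

section \<open>The whole program and its running time\<close>

lemma square_le_power: "m * m \<le> 2 ^ Suc (m :: nat)"
proof (induction m)
  case (Suc m)
  \<comment> \<open>From 3 on, passing from \<open>m\<close> to \<open>m + 1\<close> at most doubles
    the square; smaller values are checked directly.\<close>
  have "m \<le> 2 \<or> 3 * m \<le> m * m" by (cases "m \<le> 2") auto
  then show ?case
  proof
    assume "m \<le> 2"
    then have "m = 0 \<or> m = 1 \<or> m = 2" by auto
    then show ?thesis by auto
  next
    assume "3 * m \<le> m * m"
    moreover from this have "Suc m * Suc m \<le> 2 * (m * m) \<or> m = 0" by (cases m) auto
    ultimately show ?thesis using Suc by auto
  qed
qed simp

definition program :: "nat \<Rightarrow> com" where
  "program q = Seq prepare (Seq find_base (Seq adjacency (Seq order_com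
     (Seq (Cond (Op Less (Reg 1) (Op Mul (Const q) (Reg 12))) (Seq fill order_com) Skip) emit))))"

text \<open>The ratio \<open>1 + 1 / q\<close>, which is at most \<open>1 + \<epsilon>\<close> for
  the chosen \<open>q\<close>, is cleared of fractions so that the argument stays within natural
  numbers.\<close>

lemma (in machine) runs_program:
  fixes H
  defines "L \<equiv> \<lambda>z u. {i. i < k \<and> b z i \<noteq> b u i}"
  defines "R \<equiv> \<lambda>z i j. \<exists>u<n. i \<in> L z u \<and> j \<in> L z u"
  assumes s: "regs s = (\<lambda>_. 0)(0 := n, 1 := k)" "mem s = lay (\<lambda>_. 0) (\<lambda>_. 0) (\<lambda>_. 0) (\<lambda>_. 0) (\<lambda>_. 0)"
    and H: "pverts H = {..<n}"
    and ex: "\<exists>z<n. deg z = k"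
    and coding: "\<And>z. z < n \<Longrightarrow> deg z = k \<Longrightarrow> clique_coding H k (L z) (R z)"
    and q: "2 \<le> q" "q * n < 2 ^ w" and M': "n ^ q * n + 2 * n * n + n + 2 \<le> M"
  shows "runs w (program q) s ((1000 + 1000 * (q * q)) * n ^ (q + 1))
     (\<lambda>s'. \<exists>f \<psi>. is_output n f \<psi> s' \<and> isometric_embedding (with_proj H) (fibonacci_cube f) \<psi> \<and>
        q * f \<le> (q + 1) * fdim (with_proj H))"
proof -
  let ?Q = "\<lambda>s'. \<exists>f \<psi>. is_output n f \<psi> s' \<and> isometric_embedding (with_proj H) (fibonacci_cube f) \<psi> \<and>
        q * f \<le> (q + 1) * fdim (with_proj H)"
  have kn: "Suc k \<le> n"
  proof -
    obtain z where "z < n" "deg z = k" using ex by blast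
    then interpret clique_coding H k "L z" "R z" by (rule coding)
    show ?thesis using dimension_bound H by simp
  qed
  have n1: "1 \<le> n" using kn by simp
  define N where "N = n ^ (q + 1)"
  have N: "1 \<le> N" "n \<le> N" "n * n \<le> N" "n * n * n \<le> N" "n ^ q * n = N"
  proof -
    have "n ^ 1 \<le> n ^ (q + 1)" "n ^ 2 \<le> n ^ (q + 1)" "n ^ 3 \<le> n ^ (q + 1)"
      using q n1 by (intro power_increasing; simp)+
    then show "n \<le> N" "n * n \<le> N" "n * n * n \<le> N" by (simp_all add: N_def power2_eq_square power3_eq_cube)
    then show "1 \<le> N" using n1 by simp
    show "n ^ q * n = N" by (simp add: N_def)
  qed
  have kk: "k \<le> N" "k * k \<le> N" "n * k \<le> N" "n * (k * k) \<le> N"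
  proof -
    have "k \<le> n" using kn by simp
    then have "k * k \<le> n * n" "n * k \<le> n * n" "n * (k * k) \<le> n * (n * n)" by (auto intro!: mult_le_mono)
    then show "k \<le> N" "k * k \<le> N" "n * k \<le> N" "n * (k * k) \<le> N" using N \<open>k \<le> n\<close> by (auto simp: mult.assoc)
  qed
  \<comment> \<open>Budget for the conditional second run: the part with \<open>q * q\<close> pays
    for the table, since \<open>2 ^ k * (k * k) \<le> q * q * N\<close>.\<close>
  define Tb where "Tb = (500 + 150 * (q * q)) * N"
  have Tb_eq: "Tb = 500 * N + 150 * (q * q * N)" by (simp add: Tb_def algebra_simps)
  then have Tb1: "1 \<le> Tb" using N(1) by linarith
  let ?branch = "Cond (Op Less (Reg 1) (Op Mul (Const q) (Reg 12))) (Seq fill order_com) Skip"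
  let ?ord = "2 + (4 + (2 + (6 + k * (10 + k * 48 + 32 + 8))))"
  let ?emit = "4 + (6 + ((6 + n * ((6 + k * (30 + 8)) + 8)) + 4))"
  have ord_le: "?ord \<le> 112 * N" using kk N by (simp add: algebra_simps)
  have order_branch: "runs w (Seq order_com (Seq ?branch emit)) s1 (?ord + ((6 + Tb) + ?emit)) ?Q"
    if z: "z < n" "deg z = k" and s1: "base s1" "mem s1 = lay A (\<lambda>_. 0) (\<lambda>_. 0) (\<lambda>_. 0) (\<lambda>_. 0)"
      "regs s1 8 = z" "regs s1 9 = 1" and A: "table (Suc k) k (R z) A" for z s1 A
  proof -
    interpret clique_coding H k "L z" "R z" using z by (rule coding)
    obtain ys where ys: "distinct ys" "set ys = {..<k}" "k + sep (R z) ys \<le> fdim (with_proj H)"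
      using fdim_lower_bound by blast
    have k_fdim: "k \<le> fdim (with_proj H)" using ys(3) by simp
    have emit_ok: "runs w emit s' ?emit ?Q"
      if s': "base s'" "mem s' = lay A U P W D" "regs s' 8 = z" "regs s' 9 = K" "regs s' 12 = sp"
        and D: "\<And>x. K * k \<le> x \<Longrightarrow> D x = 0" and K: "K * k \<le> n ^ q * n" "K \<le> n ^ q * n"
        and xs: "walk (R z) g k xs" "length xs = k" "sp = sep (R z) (k # xs)"
        and P: "\<And>t. t < k \<Longrightarrow> P (xs ! t) = t + sep (R z) (k # take (Suc t) xs)"
        and opt: "q * (k + sp) \<le> (q + 1) * fdim (with_proj H)" for s' U P W D K sp g xs
    proof -
      have dist: "distinct xs" using walk_distinct[OF xs(1)] by simp
      note emb = embedding_of_order[OF dist walk_complete[OF xs(1,2)] P, folded xs(3)]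
      have sp: "sp \<le> k" using sep_Cons[of "R z" k xs] xs by simp
      have "n * (k + sp) \<le> n * (2 * n)" using sp kn by (intro mult_le_mono) auto
      moreover have "n * (2 * n) = 2 * n * n" by simp
      ultimately have room3: "K * k + n * (k + sp) \<le> M" using K M' by linarith
      show ?thesis
      proof (rule runs_emit[OF s'(1,2,3) z(1) s'(4,5) D emb(2,1) room3])
        have "n \<le> 2 * n * n" by simp
        then show "k + sp \<le> M" "K \<le> M" using sp kn K M' by linarith+
        fix s2 :: state assume s2: "regs s2 0 = k + sp"
          "\<And>u j. u < n \<Longrightarrow> j < k + sp \<Longrightarrow>
             mem s2 (regs s2 1 + u * (k + sp) + j) = of_bool (\<exists>i<k. P i = j \<and> b z i \<noteq> b u i)"
        have "is_output n (k + sp) (\<lambda>u. string_of (k + sp) (P ` L z u)) s2"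
          unfolding is_output_def
        proof (intro conjI allI impI)
          show "regs s2 0 = k + sp" by (rule s2)
          fix u j assume uj: "u < n" "j < k + sp"
          have "(\<exists>i<k. P i = j \<and> b z i \<noteq> b u i) \<longleftrightarrow> j \<in> P ` L z u" by (auto simp: L_def)
          then show "mem s2 (regs s2 1 + u * (k + sp) + j) = of_bool (string_of (k + sp) (P ` L z u) ! j)"
            using s2(2)[OF uj] uj by simp
        qed
        then show "?Q s2" using emb(3) opt by blast
      qed
    qed
    show ?thesis
    proof (rule runs_Seq)
      show "runs w order_com s1 ?ord (\<lambda>s'. runs w (Seq ?branch emit) s' ((6 + Tb) + ?emit) ?Q)"
      proof (rule runs_order[where F = 1 and code = "\<lambda>_. 0" and g = "\<lambda>_ _. 0", OF s1(1,2) A s1(4)])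
        show "1 * k \<le> M" using M by simp
        fix s2 xs U P
        assume s2: "same {10,11,12,13,14,15,16,18} s1 s2" "mem s2 = lay A U P (\<lambda>_. 0) (\<lambda>_. 0)"
          "walk (R z) (\<lambda>_ _. 0) k xs" "length xs = k" "regs s2 12 = sep (R z) (k # xs)"
          "\<And>u. u < k \<Longrightarrow> U u = 1" "\<And>t. t < k \<Longrightarrow> P (xs ! t) = t + sep (R z) (k # take (Suc t) xs)"
        define sp where "sp = sep (R z) (k # xs)"
        have b2: "base s2" "regs s2 8 = z" "regs s2 9 = 1"
          using base_same[OF s1(1) s2(1)] sameD[OF s2(1)] s1 by auto
        have sp: "sp \<le> k" using sep_Cons[of "R z" k xs] s2(4) by (simp add: sp_def)
        then have "sp \<le> n" using kn by simp
        then have "q * sp \<le> q * n" by (rule mult_le_mono2)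
        then have qsp: "q * sp < 2 ^ w" using q(2) by (rule le_less_trans)
        have r12: "regs s2 12 = sp" using s2(5) by (simp add: sp_def)
        have "eval_exp w (Op Mul (Const q) (Reg 12)) s2 = q * sp"
          using qsp by (simp add: r12 mod_simps)
        moreover have "eval_exp w (Reg 1) s2 = k" using baseD[OF b2(1)] word_bounds(2) by simp
        ultimately have test: "eval_exp w (Op Less (Reg 1) (Op Mul (Const q) (Reg 12))) s2 \<noteq> 0 \<longleftrightarrow> k < q * sp"
          unfolding eval_exp.simps(4)[of w Less] using w by simp
        show "runs w (Seq ?branch emit) s2 ((6 + Tb) + ?emit) ?Q"
        proof (rule runs_Seq)
          have "runs w ?branch s2 (1 + exp_cost (Op Less (Reg 1) (Op Mul (Const q) (Reg 12))) + Tb)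
             (\<lambda>s'. runs w emit s' ?emit ?Q)"
          proof (rule runs_Cond)
            assume "eval_exp w (Op Less (Reg 1) (Op Mul (Const q) (Reg 12))) s2 = 0"
            then have le: "q * sp \<le> k" using test by simp
            have "q * (k + sp) \<le> (q + 1) * k" using le by (simp add: algebra_simps)
            also have "\<dots> \<le> (q + 1) * fdim (with_proj H)" using k_fdim by (rule mult_le_mono2)
            finally have opt: "q * (k + sp) \<le> (q + 1) * fdim (with_proj H)" .
            \<comment> \<open>The greedy run reads only row 0 of a table that is zero, so the output
              starts behind this one row.\<close>
            have em: "runs w emit s2 ?emit ?Q"
              by (rule emit_ok[where K = 1 and sp = sp, OF b2(1) s2(2) b2(2,3) _ _ _ _ s2(3,4) _ s2(7) opt])
                 (use s2(5) kk N in \<open>simp_all add: sp_def\<close>)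
            show "runs w Skip s2 Tb (\<lambda>s'. runs w emit s' ?emit ?Q)"
            proof (rule runs_loop_free_le)
              show "runs w emit (result w Skip s2) ?emit ?Q" unfolding result.simps by (rule em)
            qed (use Tb1 in simp_all)
          next
            assume "eval_exp w (Op Less (Reg 1) (Op Mul (Const q) (Reg 12))) s2 \<noteq> 0"
            then have less: "k < q * sp" using test by simp
            have k0: "0 < k" using less sp by (cases k) auto
            obtain C where C: "C \<subseteq> {..<k}" "card C = Suc sp" "\<forall>c\<in>C. \<forall>d\<in>C. c \<noteq> d \<longrightarrow> R z c d"
              using walk_greedy_clique[OF s2(3,4) k0 A_outside A_sym] unfolding sp_def by blast
            have "2 ^ card C \<le> card (pverts H)" by (rule clique_bound[OF C(1)]) (use C(3) in blast)
            then have sp_n: "2 ^ Suc sp \<le> n" unfolding C(2) H by simp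
            have "(2::nat) ^ k \<le> 2 ^ (sp * q)" using less by (intro power_increasing) (auto simp: mult.commute)
            also have "\<dots> = (2 ^ sp) ^ q" by (rule power_mult)
            also have "\<dots> \<le> n ^ q" using sp_n by (intro power_mono) auto
            finally have two_k: "2 ^ k \<le> n ^ q" .
            have "k * k \<le> (q * sp) * (q * sp)" using less by (intro mult_le_mono) auto
            also have "\<dots> = (q * q) * (sp * sp)" by (simp add: algebra_simps)
            also have "\<dots> \<le> (q * q) * n" using square_le_power[of sp] sp_n by (intro mult_le_mono2) linarith
            finally have k2: "k * k \<le> (q * q) * n" .
            have room2: "2 ^ k * k \<le> n ^ q * n" "2 ^ k \<le> n ^ q * n"
            proof -
              show "2 ^ k * k \<le> n ^ q * n" using two_k kn by (intro mult_le_mono) auto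
              have "2 ^ k * 1 \<le> n ^ q * n" using two_k n1 by (intro mult_le_mono) auto
              then show "2 ^ k \<le> n ^ q * n" by simp
            qed
            let ?fill = "2 + ((6 + k * (9 + 8)) + (6 + 2 ^ k * ((6 + k * (10 + k * 50 + 9 + 8)) + 8)))"
            have time: "?fill + ?ord \<le> Tb"
            proof -
              have kle: "k \<le> k * k" "1 \<le> k * k" using k0 by (cases k, simp, simp)+
              have "k * (10 + k * 50 + 9 + 8) = 27 * k + 50 * (k * k)" by (simp add: algebra_simps)
              then have "(6 + k * (10 + k * 50 + 9 + 8)) + 8 \<le> 91 * (k * k)" using kle by linarith
              then have "2 ^ k * ((6 + k * (10 + k * 50 + 9 + 8)) + 8) \<le> 2 ^ k * (91 * (k * k))"
                by (rule mult_le_mono2)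
              also have "\<dots> \<le> n ^ q * (91 * ((q * q) * n))" by (rule mult_le_mono[OF two_k mult_le_mono2[OF k2]])
              also have "\<dots> = 91 * (q * q * (n ^ q * n))" by (simp add: algebra_simps)
              finally have "2 ^ k * ((6 + k * (10 + k * 50 + 9 + 8)) + 8) \<le> 91 * (q * q * N)"
                unfolding N(5) .
              moreover have "2 + ((6 + k * (9 + 8)) + (6 + X)) + Y \<le> 500 * N + 150 * Z"
                if "X \<le> 91 * Z" "Y \<le> 112 * N" for X Y Z
              proof -
                have "k * (9 + 8) = 17 * k" by simp
                then show ?thesis using that kk(1) N(1) by linarith
              qed
              ultimately show ?thesis using ord_le unfolding Tb_eq by blast
            qed
            have "runs w (Seq fill order_com) s2 (?fill + ?ord) (\<lambda>s'. runs w emit s' ?emit ?Q)"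
            proof (rule runs_Seq, rule runs_fill[OF b2(1) s2(2) A])
              show "2 ^ k * k \<le> M" "2 ^ k \<le> M" using room2 M' by linarith+
              fix s3 W D
              assume s3: "base s3" "regs s3 8 = regs s2 8" "mem s3 = lay A U P W D" "regs s3 9 = 2 ^ k"
                "\<And>i. i < k \<Longrightarrow> W i = 2 ^ i"
                "\<And>S u. S < 2 ^ k \<Longrightarrow> u < k \<Longrightarrow> D (S * k + u) = opt (R z) (set_decode S) u"
                "\<And>x. 2 ^ k * k \<le> x \<Longrightarrow> D x = 0"
              have M_less: "M < 2 ^ w" using room by linarith
              show "runs w order_com s3 ?ord (\<lambda>s'. runs w emit s' ?emit ?Q)"
              proof (rule runs_order[where F = "2 ^ k" and code = set_encode and g = "opt (R z)", OF s3(1,3) A s3(4)])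
                show "(2::nat) ^ k < 2 ^ w" "2 ^ k * k \<le> M" using room2 M' M_less by linarith+
                \<comment> \<open>The greedy run left every mark at 1. As \<open>0 < k\<close>, this
                  is below \<open>2 ^ k\<close>, so all vertices count as unplaced again.\<close>
                show "U u < 2 ^ k" if "u < k" for u
                  unfolding s2(6)[OF that] by (rule one_less_power) (use k0 in simp_all)
                show "set_encode {..<k} = 2 ^ k - 1" by (rule set_encode_lessThan)
                show "set_encode X < 2 ^ k" if "X \<subseteq> {..<k}" for X using that by (rule set_encode_less)
                show "W u \<le> set_encode X \<and> set_encode X - W u = set_encode (X - {u})"
                  if "X \<subseteq> {..<k}" "u \<in> X" for X u
                proof -
                  have "finite X" "u < k" using that finite_subset[of X "{..<k}"] by auto
                  then show ?thesis using set_encode_diff[of X u] that(2) s3(5) by simp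
                qed
                show "D (set_encode X * k + u) = opt (R z) X u" if "X \<subseteq> {..<k}" "u < k" for X u
                proof -
                  have "finite X" using that(1) finite_subset by blast
                  then show ?thesis using s3(6)[OF set_encode_less[OF that(1)] that(2)] by simp
                qed
                show "opt (R z) X u \<le> k" if "X \<subseteq> {..<k}" for X u
                proof -
                  have "card X \<le> card {..<k}" "finite X"
                    using that finite_subset[of X "{..<k}"] card_mono[of "{..<k}" X] by auto
                  then show ?thesis using opt_le_card[of X "R z" u] by simp
                qed
                fix s4 xs' U' P'
                assume s4: "same {10,11,12,13,14,15,16,18} s3 s4" "mem s4 = lay A U' P' W D"
                  "walk (R z) (opt (R z)) k xs'" "length xs' = k" "regs s4 12 = sep (R z) (k # xs')"
                  "\<And>t. t < k \<Longrightarrow> P' (xs' ! t) = t + sep (R z) (k # take (Suc t) xs')"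
                have b4: "base s4" "regs s4 8 = z" "regs s4 9 = 2 ^ k"
                  using base_same[OF s3(1) s4(1)] sameD[OF s4(1)] s3 b2 by auto
                have "sep (R z) (k # xs') \<le> sep (R z) (k # ys)"
                  by (rule walk_opt_minimal[OF s4(3,4) ys(1,2)])
                \<comment> \<open>The dummy predecessor \<open>k\<close> is isolated, so putting it
                  in front of \<open>ys\<close> adds no separator.\<close>
                also have "\<dots> = sep (R z) ys" using A_outside by (rule sep_Cons_isolated)
                finally have "k + sep (R z) (k # xs') \<le> fdim (with_proj H)" using ys(3) by simp
                then have opt: "q * (k + sep (R z) (k # xs')) \<le> (q + 1) * fdim (with_proj H)"
                  by (intro mult_le_mono) auto
                show "runs w emit s4 ?emit ?Q"
                  by (rule emit_ok[OF b4(1) s4(2) b4(2,3) s4(5) s3(7) room2 s4(3,4) refl s4(6) opt])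
              qed simp_all
            qed simp_all
            then show "runs w (Seq fill order_com) s2 Tb (\<lambda>s'. runs w emit s' ?emit ?Q)"
              by (rule runs_mono) (use time in auto)
          qed
          then show "runs w ?branch s2 (6 + Tb) (\<lambda>s'. runs w emit s' ?emit ?Q)"
            by (rule runs_mono) (simp, assumption)
        qed
      qed (use one_less_word in simp_all)
    qed
  qed
  let ?find = "6 + n * (2 + (6 + n * 17 + 8) + 8)"
  let ?adj = "6 + n * (6 + k * (20 + (6 + k * (30 + 8)) + 8) + 8)"
  have "runs w (program q) s (max_cost prepare + (?find + (?adj + (?ord + ((6 + Tb) + ?emit))))) ?Q"
    unfolding program_def
  proof (rule runs_Seq, rule runs_prepare[OF s(1)], rule runs_Seq)
    fix s1 assume s1: "base s1" "regs s1 9 = 1" "mem s1 = mem s"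
    show "runs w find_base s1 ?find (\<lambda>s'. runs w (Seq adjacency (Seq order_com (Seq ?branch emit))) s'
        (?adj + (?ord + ((6 + Tb) + ?emit))) ?Q)"
    proof (rule runs_find_base[OF s1(1) s1(3)[unfolded s(2)] ex], rule runs_Seq)
      fix s2 assume s2: "same {8,16,17,19} s1 s2" "mem s2 = mem s1" "regs s2 8 < n" "deg (regs s2 8) = k"
      define z where "z = regs s2 8"
      have b2: "base s2" "regs s2 9 = 1" using base_same[OF s1(1) s2(1)] sameD[OF s2(1)] s1 by auto
      show "runs w adjacency s2 ?adj (\<lambda>s'. runs w (Seq order_com (Seq ?branch emit)) s'
          (?ord + ((6 + Tb) + ?emit)) ?Q)"
      proof (rule runs_adjacency[OF b2(1) s2(2)[unfolded s1(3) s(2)] z_def[symmetric]])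
        show "z < n" using s2(3) by (simp add: z_def)
        fix s3 A assume s3: "same {15,16,17} s2 s3" "mem s3 = lay A (\<lambda>_. 0) (\<lambda>_. 0) (\<lambda>_. 0) (\<lambda>_. 0)"
          "table (Suc k) k (\<lambda>i j. i < k \<and> (\<exists>u<n. (b z i \<noteq> b u i) \<and> (b z j \<noteq> b u j))) A"
        have "table (Suc k) k (R z) A"
          by (rule table_cong[OF s3(3)]) (auto simp: R_def L_def)
        moreover have "base s3" "regs s3 8 = z" "regs s3 9 = 1"
          using base_same[OF b2(1) s3(1)] sameD[OF s3(1)] b2(2) by (auto simp: z_def)
        ultimately show "runs w (Seq order_com (Seq ?branch emit)) s3 (?ord + ((6 + Tb) + ?emit)) ?Q"
          using order_branch[of z s3 A] s2(3,4) s3(2) by (simp add: z_def)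
      qed
    qed
  qed
  then show ?thesis
  proof (rule runs_mono)
    have "max_cost prepare \<le> 100 * N" using N(1) by (simp add: prepare_def)
    moreover have "?find \<le> 47 * N" using N by (simp add: algebra_simps)
    moreover have "?adj \<le> 92 * N" using N kk by (simp add: algebra_simps)
    moreover have "?emit \<le> 72 * N" using N kk by (simp add: algebra_simps)
    ultimately have "max_cost prepare + (?find + (?adj + (?ord + ((6 + Tb) + ?emit)))) \<le> 429 * N + Tb"
      using ord_le N(1) by linarith
    also have "\<dots> \<le> 1000 * N + 1000 * (q * q * N)" unfolding Tb_eq by linarith
    also have "\<dots> = (1000 + 1000 * (q * q)) * N" by (simp add: algebra_simps)
    finally show "max_cost prepare + (?find + (?adj + (?ord + ((6 + Tb) + ?emit))))
        \<le> (1000 + 1000 * (q * q)) * n ^ (q + 1)" by (simp add: N_def)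
  qed
qed


section \<open>The main theorem\<close>

text \<open>Every vertex of degree \<open>k\<close> gives a coding, whether or not it is the empty
  clique. Labels differ for distinct vertices because \<open>flips\<close> between two vertices is
  determined by their labels, and no flip means equal strings.\<close>

lemma simplex_graph_coding:
  fixes \<phi> :: "nat \<Rightarrow> bool list"
  assumes H: "is_simplex_graph H" and k: "k = idim (with_proj H)"
    and iso: "isometric_embedding (with_proj H) (with_proj (cube k)) \<phi>"
    and n: "pverts H = {..<n}" and z: "z < n" "card {v. v < n \<and> (z, v) \<in> parcs H} = k"
  shows "clique_coding H k (flips \<phi> k z) (\<lambda>i j. \<exists>u<n. i \<in> flips \<phi> k z u \<and> j \<in> flips \<phi> k z u)"
proof
  have "{v. v < n \<and> (z, v) \<in> parcs H} = {v. (z, v) \<in> parcs H}"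
  proof -
    obtain G :: "nat pair_pre_digraph" and S where "pair_wf_digraph H"
      using simplex_graph_cliques[OF H] by metis
    then interpret pair_wf_digraph H .
    show ?thesis using in_arcsD2 n by auto
  qed
  then have deg: "card {v. (z, v) \<in> parcs H} = k" using z(2) by simp
  have zH: "z \<in> pverts H" using z n by simp
  show "finite (pverts H)" using n by simp
  show "flips \<phi> k z u \<subseteq> {..<k}" for u by (rule flips_subset)
  show "inj_on (flips \<phi> k z) (pverts H)"
  proof (rule inj_onI)
    fix u v assume uv: "u \<in> pverts H" "v \<in> pverts H" "flips \<phi> k z u = flips \<phi> k z v"
    have "length (\<phi> u) = k" "length (\<phi> v) = k"
      using iso uv by (auto simp: isometric_embedding_def cube_def)
    moreover have "flips \<phi> k u v = {}" unfolding flips_via[of \<phi> k u v z] uv(3) by simp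
    ultimately have "\<phi> u = \<phi> v" by (auto simp: flips_def list_eq_iff_nth_eq)
    then show "u = v" using iso uv by (auto simp: isometric_embedding_def dest: inj_onD)
  qed
  show "gdist (with_proj H) u v = ereal (real (card (sym_diff (flips \<phi> k z u) (flips \<phi> k z v))))"
    if "u \<in> pverts H" "v \<in> pverts H" for u v
    using simplex_graph_base(3)[OF H k iso that] unfolding flips_via[of \<phi> k u v z] .
  show "(\<exists>u<n. i \<in> flips \<phi> k z u \<and> j \<in> flips \<phi> k z u) \<longleftrightarrow>
      (\<exists>u\<in>pverts H. i \<in> flips \<phi> k z u \<and> j \<in> flips \<phi> k z u)" for i j
    by (auto simp: n)
  show "\<exists>u\<in>pverts H. flips \<phi> k z u = C"
    if "C \<subseteq> {..<k}" "\<And>i j. i \<in> C \<Longrightarrow> j \<in> C \<Longrightarrow> i \<noteq> j \<Longrightarrow> \<exists>u<n. i \<in> flips \<phi> k z u \<and> j \<in> flips \<phi> k z u" for C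
    by (rule simplex_graph_base(2)[OF H k iso zH deg that(1)]) (metis that(2) n lessThan_iff)
qed

text \<open>With \<open>m = n + 2\<close> the memory in use is at most
  \<open>6 * m ^ (q + 1)\<close>, and \<open>m ^ 3 \<ge> 8\<close> absorbs the constant. The offset
  2 keeps this true for small \<open>n\<close>.\<close>

lemma word_size_bounds:
  fixes n k q W :: nat
  assumes k: "k \<le> n" and q: "1 \<le> q" and W: "(n + 2) ^ (q + 8) \<le> W"
  shows "n * n + n * k + (k * k + k) + k + k + k + (n ^ q * n + 2 * n * n + n + 2) < W" "q * n < W"
proof -
  define m where "m = n + 2"
  have m: "2 \<le> m" "n \<le> m" by (simp_all add: m_def)
  have pos: "0 < m ^ (q + 1)" using m by simp
  have "m ^ 2 \<le> m ^ (q + 1)" using m q by (intro power_increasing) auto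
  moreover have "n ^ q * n \<le> m ^ (q + 1)" using m(2) power_mono[of n m "q + 1"] by (simp add: mult.commute)
  moreover have "n * k \<le> n * n" "k * k \<le> n * n" using k by (auto intro: mult_le_mono)
  moreover have "m ^ 2 = n * n + 4 * n + 4" by (simp add: m_def power2_eq_square algebra_simps)
  moreover have "2 * n * n = 2 * (n * n)" by simp
  ultimately have "n * n + n * k + (k * k + k) + k + k + k + (n ^ q * n + 2 * n * n + n + 2) \<le> 6 * m ^ (q + 1)"
    using k by linarith
  also have "\<dots> < 8 * m ^ (q + 1)" using pos by simp
  also have "\<dots> \<le> m ^ 3 * m ^ (q + 1)"
    using power_mono[of 2 m 3] m by (intro mult_le_mono1) simp
  also have "\<dots> = m ^ (q + 4)" unfolding power_add[symmetric] by (rule arg_cong[where f = "power m"]) simp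
  also have "\<dots> \<le> m ^ (q + 8)" using m by (intro power_increasing) auto
  finally show "n * n + n * k + (k * k + k) + k + k + k + (n ^ q * n + 2 * n * n + n + 2) < W"
    using W by (simp add: m_def)
  have "q < m ^ q" by (rule less_le_trans[OF less_exp power_mono]) (use m in simp_all)
  then have "q * n \<le> m ^ q * m" using m by (intro mult_le_mono) auto
  also have "\<dots> = m ^ (q + 1)" by simp
  also have "\<dots> < m ^ (q + 8)" using m by (intro power_strict_increasing) auto
  finally show "q * n < W" using W by (simp add: m_def)
qed

theorem theorem4p10:
  fixes \<epsilon> :: real
  assumes "0 < \<epsilon>" and "\<epsilon> < 1"
  shows "\<exists>(P :: com) (c :: nat) (T :: nat \<Rightarrow> nat).
           (\<lambda>n. real (T n)) \<in> O(\<lambda>n. real n powr (2 + 1 / \<epsilon>)) \<and>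
           (\<forall>(n :: nat) (H :: nat pair_pre_digraph) (k :: nat) (\<phi> :: nat \<Rightarrow> bool list) (w :: nat).
              pverts H = {..<n} \<and> is_simplex_graph H \<and> k = idim (with_proj H) \<and>
              isometric_embedding (with_proj H) (with_proj (cube k)) \<phi> \<and>
              (n + 2) ^ c \<le> 2 ^ w \<longrightarrow>
              (\<exists>t s f' \<psi>.
                 exec w P (input_state n H k \<phi>) t s \<and> t \<le> T n \<and>
                 is_output n f' \<psi> s \<and>
                 isometric_embedding (with_proj H) (fibonacci_cube f') \<psi> \<and>
                 real f' \<le> (1 + \<epsilon>) * real (fdim (with_proj H))))"
proof -
  define q where "q = nat \<lceil>1 / \<epsilon>\<rceil>"
  define C where "C = 1000 + 1000 * (q * q)"
  have gt1: "1 < 1 / \<epsilon>" using assms by (simp add: field_simps)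
  then have q: "1 / \<epsilon> \<le> real q" "real q < 1 / \<epsilon> + 1" unfolding q_def by linarith+
  \<comment> \<open>Here \<open>\<epsilon> < 1\<close> enters: \<open>q \<ge> 2\<close> lets
    \<open>n ^ (q + 1)\<close> cover the cubic cost of computing the adjacency of the
    coordinates.\<close>
  then have q2: "2 \<le> q" using gt1 by linarith
  show ?thesis
  proof (rule exI[of _ "program q"], rule exI[of _ "q + 8"], rule exI[of _ "\<lambda>n. C * n ^ (q + 1)"],
      intro conjI allI impI)
    show "(\<lambda>n. real (C * n ^ (q + 1))) \<in> O(\<lambda>n. real n powr (2 + 1 / \<epsilon>))"
    proof (rule bigoI[of _ "real C"], rule eventually_sequentiallyI[of 1])
      fix n :: nat assume n: "1 \<le> n"
      have "real n ^ (q + 1) = real n powr (real (q + 1))" using n by (subst powr_realpow) auto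
      \<comment> \<open>Rounding up adds less than one, so
        \<open>q + 1 < 2 + 1 / \<epsilon>\<close>; for \<open>n \<ge> 1\<close> the power is
        monotone in the exponent.\<close>
      also have "\<dots> \<le> real n powr (2 + 1 / \<epsilon>)" using n q(2) by (intro powr_mono) auto
      finally show "norm (real (C * n ^ (q + 1))) \<le> real C * norm (real n powr (2 + 1 / \<epsilon>))"
        by (simp add: mult_left_mono)
    qed
    fix n :: nat and H :: "nat pair_pre_digraph" and k :: nat and \<phi> :: "nat \<Rightarrow> bool list" and w :: nat
    assume "pverts H = {..<n} \<and> is_simplex_graph H \<and> k = idim (with_proj H) \<and>
              isometric_embedding (with_proj H) (with_proj (cube k)) \<phi> \<and> (n + 2) ^ (q + 8) \<le> 2 ^ w"
    then have H: "pverts H = {..<n}" "is_simplex_graph H" "k = idim (with_proj H)"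
      "isometric_embedding (with_proj H) (with_proj (cube k)) \<phi>" and W: "(n + 2) ^ (q + 8) \<le> 2 ^ w" by auto
    have "\<exists>z<n. card {v. v < n \<and> (z, v) \<in> parcs H} = k"
    proof -
      obtain z where z: "z \<in> pverts H" "card {v. (z, v) \<in> parcs H} = k"
        using simplex_graph_base(1)[OF H(2-4)] by blast
      obtain G :: "nat pair_pre_digraph" and S where "pair_wf_digraph H"
        using simplex_graph_cliques[OF H(2)] by metis
      then interpret pair_wf_digraph H .
      have "{v. v < n \<and> (z, v) \<in> parcs H} = {v. (z, v) \<in> parcs H}" using in_arcsD2 H(1) by auto
      then show ?thesis using z H(1) by auto
    qed
    then obtain z where z: "z < n" "card {v. v < n \<and> (z, v) \<in> parcs H} = k" by blast
    interpret Z: clique_coding H k "flips \<phi> k z" "\<lambda>i j. \<exists>u<n. i \<in> flips \<phi> k z u \<and> j \<in> flips \<phi> k z u"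
      by (rule simplex_graph_coding[OF H(2-4,1) z])
    have kn: "k \<le> n" using Z.dimension_bound H(1) by simp
    have "w \<noteq> 0"
    proof
      assume "w = 0"
      then have "(n + 2) ^ (q + 8) \<le> 1" using W by simp
      moreover have "1 < (n + 2) ^ (q + 8)" by (rule one_less_power) simp_all
      ultimately show False by simp
    qed
    note bounds = word_size_bounds[OF kn _ W]
    \<comment> \<open>In the bound for \<open>M\<close>, the term \<open>n ^ q * n\<close> is room
      for the table and \<open>2 * n * n\<close> for \<open>n\<close> output strings, whose length
      is at most \<open>2 * k\<close>; the rest ensures \<open>k + 2 \<le> M\<close>.\<close>
    interpret machine w n k "n ^ q * n + 2 * n * n + n + 2" "\<lambda>u v. (u, v) \<in> parcs H" "\<lambda>u i. \<phi> u ! i"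
      by unfold_locales (use bounds kn q2 \<open>w \<noteq> 0\<close> in auto)
    have "runs w (program q) (input_state n H k \<phi>) ((1000 + 1000 * (q * q)) * n ^ (q + 1))
     (\<lambda>s'. \<exists>f \<psi>. is_output n f \<psi> s' \<and> isometric_embedding (with_proj H) (fibonacci_cube f) \<psi> \<and>
        q * f \<le> (q + 1) * fdim (with_proj H))"
    proof (rule runs_program)
      show "regs (input_state n H k \<phi>) = (\<lambda>_. 0)(0 := n, 1 := k)" by (simp add: input_state_def)
      show "mem (input_state n H k \<phi>) = lay (\<lambda>_. 0) (\<lambda>_. 0) (\<lambda>_. 0) (\<lambda>_. 0) (\<lambda>_. 0)"
        by (rule ext) (simp add: input_state_def lay_def inp_def b_defs)
      show "\<exists>z<n. deg z = k" using z by (auto simp: deg_def)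
      show "clique_coding H k (\<lambda>u. {i. i < k \<and> \<phi> z ! i \<noteq> \<phi> u ! i})
          (\<lambda>i j. \<exists>u<n. i \<in> {i. i < k \<and> \<phi> z ! i \<noteq> \<phi> u ! i} \<and> j \<in> {i. i < k \<and> \<phi> z ! i \<noteq> \<phi> u ! i})"
        if "z < n" "deg z = k" for z
        using simplex_graph_coding[OF H(2-4,1) that(1)] that(2) unfolding deg_def flips_def by blast
      show "q * n < 2 ^ w" using bounds q2 by simp
    qed (use H q2 in simp_all)
    then obtain t s f \<psi> where run: "exec w (program q) (input_state n H k \<phi>) t s" "t \<le> C * n ^ (q + 1)"
      "is_output n f \<psi> s" "isometric_embedding (with_proj H) (fibonacci_cube f) \<psi>"
      "q * f \<le> (q + 1) * fdim (with_proj H)"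
      unfolding runs_def C_def by blast
    have "real q * real f \<le> (real q + 1) * real (fdim (with_proj H))"
      using of_nat_mono[OF run(5), where 'a = real] by (simp add: algebra_simps)
    \<comment> \<open>The choice of \<open>q\<close> gives
      \<open>1 \<le> q * \<epsilon>\<close>.\<close>
    also have "\<dots> \<le> (real q + real q * \<epsilon>) * real (fdim (with_proj H))"
      using q(1) assms by (intro mult_right_mono) (auto simp: field_simps)
    also have "\<dots> = real q * ((1 + \<epsilon>) * real (fdim (with_proj H)))" by (simp add: algebra_simps)
    finally have "real f \<le> (1 + \<epsilon>) * real (fdim (with_proj H))" using q2 by simp
    then show "\<exists>t s f' \<psi>. exec w (program q) (input_state n H k \<phi>) t s \<and> t \<le> C * n ^ (q + 1) \<and>
        is_output n f' \<psi> s \<and> isometric_embedding (with_proj H) (fibonacci_cube f') \<psi> \<and>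
        real f' \<le> (1 + \<epsilon>) * real (fdim (with_proj H))"
      using run by blast
  qed
qed

end
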